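(* Let $d\ge 1$ and fix $p\in\mathbb{N}$. Assume that for some $\Omega\in\mathbb{R}\setminus[-4d,0]$ there exists a real $\mathcal{A}\in\ell^2(\mathbb{Z}^d)$ satisfying the stationary dNLS equation $$\Omega\mathcal{A}+\gamma_p|\mathcal{A}|^{2p}\mathcal{A}=\Delta\mathcal{A},\qquad \gamma_p=\frac{(2p+1)!}{p!\,(p+1)!},$$ and such that the Jacobian operator $J_\Omega:=\Omega+(1+2p)\gamma_p|\mathcal{A}|^{2p}-\Delta$ at this $\mathcal{A}$ has trivial null space in $\ell^2(\mathbb{Z}^d)$. Then there exist $\epsilon_0>0$ and $C_0>0$ such that for every $\epsilon\in(0,\epsilon_0)$ the breather equation $$(1-m^2\omega^2)A^{(m)}+\frac{\epsilon}{2\pi}\int_{-\pi}^{\pi}U^{1+2p}(\tau)e^{-im\tau}\,d\tau=\epsilon\,\Delta A^{(m)},\qquad m\in\mathbb{N}_0,\qquad U(\tau)=\sum_{m\in\mathbb{Z}}A^{(m)}e^{im\tau},$$ admits a unique $C^\omega$ (analytic) solution branch $\omega(\epsilon)\in\mathbb{R}$ and $\{A^{(m)}(\epsilon)\}\in\ell^{2,2}(\mathbb{Z};\ell^2(\mathbb{Z}^d))$ satisfying the bounds $$\left|\omega(\epsilon)-1+\tfrac12\epsilon\Omega\right|\le C_0\epsilon^2$$ and $$\|A^{(0)}\|_{\ell^2(\mathbb{Z}^d)}+\|A^{(1)}-\mathcal{A}\|_{\ell^2(\mathbb{Z}^d)}+\sum_{m\ge2}\|A^{(m)}\|_{\ell^2(\mathbb{Z}^d)}\le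 C_0\epsilon$$ for every $\epsilon\in(0,\epsilon_0)$.
   Context: $\Delta$ is the discrete Laplacian on $\ell^2(\mathbb{Z}^d)$, $(\Delta u)_n=\sum_{|k-n|=1}(u_k-u_n)$, whose spectrum is $[-4d,0]$. Products and powers of sequences are taken componentwise, e.g. $(U^{1+2p})_n=(U_n)^{1+2p}$. The space $\ell^{2,2}(\mathbb{Z};\ell^2(\mathbb{Z}^d))$ consists of sequences $A=\{A^{(m)}\}_{m\in\mathbb{Z}}$, $A^{(m)}\in\ell^2(\mathbb{Z}^d)$, with finite norm $\big(\sum_{m\in\mathbb{Z}}(1+|m|^2)^2\|A^{(m)}\|^2_{\ell^2(\mathbb{Z}^d)}\big)^{1/2}$. Breathers are sought as real, even-in-time functions, so the Fourier coefficients are real and satisfy $A^{(m)}=A^{(-m)}$; hence the equations for $m\in\mathbb{N}_0$ suffice. The breather equation is the Fourier form of $\omega^2U''+U+\epsilon U^{1+2p}=\epsilon\Delta U$ for $U\in H^2_{\rm per}([-\pi,\pi];\ell^2(\mathbb{Z}^d))$, i.e. $u(t)=U(\omega t)$ is a time-periodic solution of the scaled discrete Klein--Gordon equation $\ddot u_n+u_n+\epsilon u_n^{1+2p}=\epsilon(\Delta u)_n$, $n\in\mathbb{Z}^d$.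
   Formalization: Uniqueness of the branch as a pair (ω, A) fails (for 𝒜=0, A=0 solves the equation for every ω within C_0ε² of 1-εΩ/2); what is proved is that, for each ε and each given frequency, at most one solution A satisfies the bounds. *)

theory Defs
  imports "HOL-Analysis.Analysis"
begin

text \<open>The lattice \<open>\<int>\<^sup>d\<close> is the type \<open>int ^ 'd\<close> with \<open>d = CARD('d) \<ge> 1\<close>. All sequences are real
  valued, since the Fourier coefficients of a real, even-in-time function are real.\<close>

definition ell2 :: "('i \<Rightarrow> real) set" where
  "ell2 = {u. (\<lambda>n. (u n)\<^sup>2) summable_on UNIV}"

definition ell2_norm :: "('i \<Rightarrow> real) \<Rightarrow> real" where
  "ell2_norm u = sqrt (\<Sum>\<^sub>\<infinity>n. (u n)\<^sup>2)"

definition ell22 :: "(int \<Rightarrow> 'i \<Rightarrow> real) set" where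
  "ell22 = {A. (\<forall>m. A m \<in> ell2) \<and>
     (\<lambda>m. (1 + \<bar>real_of_int m\<bar>\<^sup>2)\<^sup>2 * (ell2_norm (A m))\<^sup>2) summable_on UNIV}"

definition ell22_norm :: "(int \<Rightarrow> 'i \<Rightarrow> real) \<Rightarrow> real" where
  "ell22_norm A = sqrt (\<Sum>\<^sub>\<infinity>m. (1 + \<bar>real_of_int m\<bar>\<^sup>2)\<^sup>2 * (ell2_norm (A m))\<^sup>2)"

definition lattice_norm :: "int ^ 'd \<Rightarrow> real" where
  "lattice_norm n = norm (\<chi> i. real_of_int (n $ i))"

definition dlaplace :: "(int ^ 'd \<Rightarrow> real) \<Rightarrow> int ^ 'd \<Rightarrow> real" where
  "dlaplace u n = (\<Sum>k | lattice_norm (k - n) = 1. u k - u n)"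

definition dnls_gamma :: "nat \<Rightarrow> real" where
  "dnls_gamma p = fact (2 * p + 1) / (fact p * fact (p + 1))"

definition stationary_dnls :: "nat \<Rightarrow> real \<Rightarrow> (int ^ 'd \<Rightarrow> real) \<Rightarrow> bool" where
  "stationary_dnls p \<Omega> a \<longleftrightarrow>
     (\<forall>n. \<Omega> * a n + dnls_gamma p * \<bar>a n\<bar> ^ (2 * p) * a n = dlaplace a n)"

definition dnls_jacobian ::
  "nat \<Rightarrow> real \<Rightarrow> (int ^ 'd \<Rightarrow> real) \<Rightarrow> (int ^ 'd \<Rightarrow> real) \<Rightarrow> int ^ 'd \<Rightarrow> real" where
  "dnls_jacobian p \<Omega> a v n =
     \<Omega> * v n + (1 + 2 * real p) * dnls_gamma p * \<bar>a n\<bar> ^ (2 * p) * v n - dlaplace v n"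

definition fourier_sum :: "(int \<Rightarrow> 'i \<Rightarrow> real) \<Rightarrow> real \<Rightarrow> 'i \<Rightarrow> complex" where
  "fourier_sum A \<tau> n = (\<Sum>\<^sub>\<infinity>m. complex_of_real (A m n) * exp (\<i> * of_int m * of_real \<tau>))"

text \<open>The equation in \<open>\<ell>\<^sup>2(\<int>\<^sup>d)\<close> is written componentwise; for \<open>A \<in> ell22\<close> the Fourier series
  converges absolutely and uniformly, so series and integral agree with the
  \<open>\<ell>\<^sup>2\<close>-valued ones.\<close>

definition breather ::
  "nat \<Rightarrow> real \<Rightarrow> real \<Rightarrow> (int \<Rightarrow> int ^ 'd \<Rightarrow> real) \<Rightarrow> bool" where
  "breather p \<epsilon> \<omega> A \<longleftrightarrow> A \<in> ell22 \<and> (\<forall>m. A (- m) = A m) \<and>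
     (\<forall>(m::nat) n.
        complex_of_real ((1 - (real m)\<^sup>2 * \<omega>\<^sup>2) * A (int m) n)
        + complex_of_real (\<epsilon> / (2 * pi)) *
            integral {- pi..pi}
              (\<lambda>\<tau>. fourier_sum A \<tau> n ^ (1 + 2 * p) * exp (- \<i> * of_nat m * of_real \<tau>))
        = complex_of_real (\<epsilon> * dlaplace (A (int m)) n))"

text \<open>The bounds do not determine \<open>\<omega>\<close>: for \<open>a = 0\<close>, the zero sequence is a breather for every frequency
  within \<open>C * \<epsilon>\<^sup>2\<close> of \<open>1 - \<epsilon> * \<Omega> / 2\<close>. Uniqueness of breathers within these bounds therefore has to
  be understood at a given frequency.\<close>

definition breather_bounds ::
  "real \<Rightarrow> (int ^ 'd \<Rightarrow> real) \<Rightarrow> real \<Rightarrow> real \<Rightarrow> real \<Rightarrow> (int \<Rightarrow> int ^ 'd \<Rightarrow> real) \<Rightarrow> bool" where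
  "breather_bounds \<Omega> a C \<epsilon> \<omega> A \<longleftrightarrow>
     \<bar>\<omega> - 1 + \<epsilon> * \<Omega> / 2\<bar> \<le> C * \<epsilon>\<^sup>2 \<and>
     ell2_norm (A 0) + ell2_norm (\<lambda>n. A 1 n - a n) + (\<Sum>\<^sub>\<infinity>m\<in>{2..}. ell2_norm (A m)) \<le> C * \<epsilon>"

text \<open>Real analyticity: local expansion in a power series converging in \<open>\<real>\<close>, respectively
  in the norm of \<open>ell22\<close>. Both are meant for open \<open>S\<close>. The membership conditions matter:
  \<open>ell22_norm\<close> is not meaningful outside \<open>ell22\<close>.\<close>

definition real_analytic_on :: "(real \<Rightarrow> real) \<Rightarrow> real set \<Rightarrow> bool" where
  "real_analytic_on f S \<longleftrightarrow>
     (\<forall>x\<in>S. \<exists>r>0. \<exists>c :: nat \<Rightarrow> real. \<forall>y. \<bar>y - x\<bar> < r \<longrightarrow> (\<lambda>k. c k * (y - x) ^ k) sums f y)"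

definition ell22_analytic_on :: "(real \<Rightarrow> int \<Rightarrow> 'i \<Rightarrow> real) \<Rightarrow> real set \<Rightarrow> bool" where
  "ell22_analytic_on F S \<longleftrightarrow>
     (\<forall>x\<in>S. \<exists>r>0. \<exists>c :: nat \<Rightarrow> int \<Rightarrow> 'i \<Rightarrow> real. (\<forall>k. c k \<in> ell22) \<and>
        (\<forall>y. \<bar>y - x\<bar> < r \<longrightarrow> F y \<in> ell22 \<and>
           (\<lambda>N. ell22_norm (\<lambda>m n. F y m n - (\<Sum>k<N. c k m n * (y - x) ^ k))) \<longlonglongrightarrow> 0))"

end

theory Submission
  imports Defs "HOL-Analysis.Generalised_Binomial_Theorem"
begin

text \<open>Why the theorem is true. Write \<open>1 - \<omega>\<^sup>2 = \<epsilon> \<theta>\<close>; the branch is sought at \<open>\<theta> = \<Omega>\<close>, that is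
\<open>\<omega> = sqrt (1 - \<epsilon> \<Omega>)\<close>. For \<open>m = \<plusminus>1\<close> the breather equation can be divided by \<open>\<epsilon>\<close> and becomes, up to the
coupling to other harmonics, the stationary dNLS equation: the coefficient \<open>\<gamma>\<^sub>p\<close> is the first Fourier
coefficient of \<open>(2 cos \<tau>)\<close> to the power \<open>2p + 1\<close>. For \<open>\<bar>m\<bar> \<noteq> 1\<close> the factor \<open>1 - m\<^sup>2\<close> is bounded away
from zero and all other terms carry a factor \<open>\<epsilon>\<close>. So for small \<open>\<epsilon>\<close> this is a regular perturbation of
the profile \<open>a\<close>, with the invertible linearization \<open>J\<^sub>\<Omega>\<close> at the main harmonics.

The Jacobian is invertible on \<open>\<ell>\<^sup>2\<close>, not only injective: \<open>\<Omega> - \<Delta>\<close> is bounded below because \<open>\<Omega>\<close> lies outside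
\<open>[-4d, 0]\<close>, multiplication by \<open>\<bar>a\<bar>\<close> to the power \<open>2p\<close> is compact, and a symmetric operator that is bounded
below is onto (\<open>jacobian_invertible\<close>).

The fixed point problem lives in the space of families \<open>V\<close> of Fourier modes that are absolutely
summable in \<open>\<ell>\<^sup>2\<close>. It is a Banach algebra under convolution, and convolution corresponds to pointwise
multiplication of the functions of time. The unknown is \<open>V m = (1 - m\<^sup>2) A m\<close> for \<open>\<bar>m\<bar> \<noteq> 1\<close> and \<open>V m = A m\<close>
otherwise. This division gives the weight required by \<open>ell22\<close>, and it leaves an equation that is
polynomial in both \<open>\<epsilon>\<close> and \<open>V\<close>. A Newton-like step, in which the small harmonics are updated before the
equation at \<open>m = \<plusminus>1\<close> is solved with the inverse Jacobian, is a contraction of a ball about \<open>a\<close> on even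
families, uniformly for small \<open>\<epsilon>\<close> and \<open>\<theta>\<close> near \<open>\<Omega>\<close> (\<open>newton_step_contraction\<close>). This gives existence
with an error of order \<open>\<epsilon>\<close>. It gives uniqueness as well, since the equations for \<open>\<bar>m\<bar> \<noteq> 1\<close> place every
breather within the bounds in that ball (\<open>breather_rescale\<close>), and the bound on the frequency
controls \<open>\<theta> - \<Omega>\<close>.

Analyticity comes from the same contraction. Being polynomial in \<open>\<epsilon>\<close>, the fixed point problem can be
posed for absolutely convergent power series in \<open>s\<close> with \<open>\<epsilon> = x + \<rho> s\<close>, multiplication by \<open>s\<close> being a
shift of coefficients. Its solution is a power series whose values, by uniqueness, are the branch
near \<open>x\<close> (\<open>power_series_fixed_point\<close>).\<close>

section \<open>The Hilbert algebra of square-summable sequences\<close>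

lemma summable_on_nonneg_bounded:
  fixes f :: "'a \<Rightarrow> real"
  assumes "\<And>x. f x \<ge> 0" "\<And>F. finite F \<Longrightarrow> sum f F \<le> B"
  shows "f summable_on UNIV" "infsum f UNIV \<le> B"
proof -
  show *: "f summable_on UNIV"
  proof (rule nonneg_bdd_above_summable_on)
    show "bdd_above (sum f ` {F. F \<subseteq> UNIV \<and> finite F})"
      by (rule bdd_aboveI2[of _ _ B]) (simp add: assms(2))
  qed (rule assms(1))
  show "infsum f UNIV \<le> B"
    by (rule infsum_le_finite_sums[OF *]) (use assms in auto)
qed

lemma summable_on_compare:
  fixes f g :: "'a \<Rightarrow> real"
  assumes "g summable_on UNIV" "\<And>x. 0 \<le> f x" "\<And>x. f x \<le> g x"
  shows "f summable_on UNIV"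
  by (rule summable_on_comparison_test[OF assms(1)]) (rule assms)+

lemma ell2_zero: "(\<lambda>n. 0) \<in> ell2"
  by (simp add: ell2_def)

lemma ell2_add:
  assumes "u \<in> ell2" "v \<in> ell2" shows "(\<lambda>n. u n + v n) \<in> ell2"
proof -
  have "(\<lambda>n. 2 * (u n)\<^sup>2 + 2 * (v n)\<^sup>2) summable_on UNIV"
    using assms by (intro summable_on_add summable_on_cmult_right) (auto simp: ell2_def)
  then show ?thesis unfolding ell2_def mem_Collect_eq
  proof (rule summable_on_compare)
    show "(u n + v n)\<^sup>2 \<le> 2 * (u n)\<^sup>2 + 2 * (v n)\<^sup>2" for n
      using sum_squares_bound[of "u n" "v n"] by (simp add: power2_sum)
  qed simp
qed

lemma ell2_scale: "u \<in> ell2 \<Longrightarrow> (\<lambda>n. c * u n) \<in> ell2"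
  unfolding ell2_def mem_Collect_eq power_mult_distrib by (rule summable_on_cmult_right)

lemma ell2_product_summable:
  assumes "u \<in> ell2" "v \<in> ell2" shows "(\<lambda>n. u n * v n) summable_on UNIV"
proof -
  have "(\<lambda>n. (u n)\<^sup>2 + (v n)\<^sup>2) summable_on UNIV"
    using assms by (intro summable_on_add) (auto simp: ell2_def)
  then have "(\<lambda>n. norm (u n * v n)) summable_on UNIV"
  proof (rule Infinite_Sum.abs_summable_on_comparison_test')
    show "norm (u n * v n) \<le> (u n)\<^sup>2 + (v n)\<^sup>2" for n
      using sum_squares_bound[of "\<bar>u n\<bar>" "\<bar>v n\<bar>"] mult_nonneg_nonneg[of "\<bar>u n\<bar>" "\<bar>v n\<bar>"]
      unfolding real_norm_def abs_mult power2_abs by linarith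
  qed
  then show ?thesis by (rule Infinite_Sum.abs_summable_summable)
qed

typedef 'i l2 = "ell2 :: ('i \<Rightarrow> real) set"
  morphisms l2_fun Abs_l2
  using ell2_zero by blast

setup_lifting type_definition_l2

instantiation l2 :: (type) real_inner
begin
lift_definition zero_l2 :: "'a l2" is "\<lambda>n. 0" by (rule ell2_zero)
lift_definition plus_l2 :: "'a l2 \<Rightarrow> 'a l2 \<Rightarrow> 'a l2" is "\<lambda>u v n. u n + v n" by (rule ell2_add)
lift_definition uminus_l2 :: "'a l2 \<Rightarrow> 'a l2" is "\<lambda>u n. - u n" by (simp add: ell2_def)
lift_definition minus_l2 :: "'a l2 \<Rightarrow> 'a l2 \<Rightarrow> 'a l2" is "\<lambda>u v n. u n - v n"
  using ell2_add[of _ "\<lambda>n. - _ n"] by (simp add: ell2_def)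
lift_definition scaleR_l2 :: "real \<Rightarrow> 'a l2 \<Rightarrow> 'a l2" is "\<lambda>c u n. c * u n" by (rule ell2_scale)
lift_definition inner_l2 :: "'a l2 \<Rightarrow> 'a l2 \<Rightarrow> real" is "\<lambda>u v. \<Sum>\<^sub>\<infinity>n. u n * v n" .
definition norm_l2 :: "'a l2 \<Rightarrow> real" where "norm_l2 u = sqrt (inner u u)"
definition sgn_l2 :: "'a l2 \<Rightarrow> 'a l2" where "sgn_l2 u = inverse (norm u) *\<^sub>R u"
definition dist_l2 :: "'a l2 \<Rightarrow> 'a l2 \<Rightarrow> real" where "dist_l2 u v = norm (u - v)"
definition uniformity_l2 :: "('a l2 \<times> 'a l2) filter"
  where "uniformity_l2 = (INF e\<in>{0<..}. principal {(x, y). dist x y < e})"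
definition open_l2 :: "'a l2 set \<Rightarrow> bool"
  where "open_l2 U = (\<forall>x\<in>U. eventually (\<lambda>(x', y). x' = x \<longrightarrow> y \<in> U) uniformity)"
instance
proof
  fix x y z :: "'a l2" and r s :: real
  show "x + y + z = x + (y + z)" by transfer (simp add: add.assoc)
  show "x + y = y + x" by transfer (simp add: add.commute)
  show "0 + x = x" by transfer simp
  show "- x + x = 0" by transfer simp
  show "x - y = x + - y" by transfer simp
  show "r *\<^sub>R (x + y) = r *\<^sub>R x + r *\<^sub>R y" by transfer (simp add: algebra_simps)
  show "(r + s) *\<^sub>R x = r *\<^sub>R x + s *\<^sub>R x" by transfer (simp add: algebra_simps)
  show "r *\<^sub>R s *\<^sub>R x = (r * s) *\<^sub>R x" by transfer (simp add: algebra_simps)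
  show "1 *\<^sub>R x = x" by transfer simp
  show "dist x y = norm (x - y)" by (fact dist_l2_def)
  show "sgn x = inverse (norm x) *\<^sub>R x" by (fact sgn_l2_def)
  show "uniformity = (INF e\<in>{0<..}. principal {(x, y). dist (x::'a l2) y < e})"
    by (fact uniformity_l2_def)
  show "open U = (\<forall>x\<in>U. \<forall>\<^sub>F (x', y) in uniformity. x' = x \<longrightarrow> y \<in> U)" for U :: "'a l2 set"
    by (fact open_l2_def)
  show "inner x y = inner y x" by transfer (simp add: mult.commute)
  show "inner (x + y) z = inner x z + inner y z"
    by transfer (simp add: distrib_right infsum_add ell2_product_summable)
  show "inner (r *\<^sub>R x) y = r * inner x y"
    by transfer (simp add: mult.assoc infsum_cmult_right')
  show "0 \<le> inner x x"
    by transfer (auto intro: infsum_nonneg)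
  show "norm x = sqrt (inner x x)" by (fact norm_l2_def)
  show "inner x x = 0 \<longleftrightarrow> x = 0"
  proof
    assume "inner x x = 0"
    then have "l2_fun x n * l2_fun x n = 0" for n
      by (intro nonneg_infsum_le_0D[of "\<lambda>n. l2_fun x n * l2_fun x n" UNIV n])
         (auto simp: inner_l2.rep_eq intro: ell2_product_summable l2_fun)
    then show "x = 0" by transfer auto
  qed (simp add: inner_l2.rep_eq zero_l2.rep_eq)
qed
end

lemma l2_norm_eq: "norm u = ell2_norm (l2_fun u)"
  by (simp add: norm_l2_def inner_l2.rep_eq ell2_norm_def power2_eq_square)

lemma l2_finite_sum_le: "finite F \<Longrightarrow> (\<Sum>n\<in>F. (l2_fun u n)\<^sup>2) \<le> (norm u)\<^sup>2"
  using finite_sum_le_infsum[of "\<lambda>n. (l2_fun u n)\<^sup>2" UNIV F] l2_fun[of u]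
  by (simp add: l2_norm_eq ell2_norm_def infsum_nonneg ell2_def)

lemma l2_coord_le: "\<bar>l2_fun u n\<bar> \<le> norm u"
  using l2_finite_sum_le[of "{n}" u] power2_le_iff_abs_le[of "norm u" "l2_fun u n"] by simp

lemma l2I:
  assumes "\<And>F. finite F \<Longrightarrow> (\<Sum>n\<in>F. (f n)\<^sup>2) \<le> B\<^sup>2"
  shows "f \<in> ell2"
  unfolding ell2_def mem_Collect_eq
  by (rule summable_on_nonneg_bounded(1)[OF _ assms]) simp

lemma l2_norm_leI:
  assumes "\<And>F. finite F \<Longrightarrow> (\<Sum>n\<in>F. (l2_fun u n)\<^sup>2) \<le> B\<^sup>2" "B \<ge> 0"
  shows "norm u \<le> B"
proof -
  have "(\<Sum>\<^sub>\<infinity>n. (l2_fun u n)\<^sup>2) \<le> B\<^sup>2"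
    by (rule summable_on_nonneg_bounded(2)[OF _ assms(1)]) simp
  then show ?thesis using assms(2)
    by (simp add: l2_norm_eq ell2_norm_def real_le_lsqrt)
qed

text \<open>Completeness of both sequence spaces used below, with exponents two and one: bounds on finite sums
pass to the pointwise limit.\<close>

lemma summation_norm_cauchy_limit:
  fixes X :: "nat \<Rightarrow> 'i \<Rightarrow> 'b::banach"
  assumes "e > 0"
    and cauchy: "\<And>\<epsilon>. \<epsilon> > 0 \<Longrightarrow> \<exists>N. \<forall>i\<ge>N. \<forall>j\<ge>N. \<forall>F. finite F \<longrightarrow> (\<Sum>n\<in>F. norm (X i n - X j n) ^ e) \<le> \<epsilon> ^ e"
  obtains x where "\<And>\<epsilon>. \<epsilon> > 0 \<Longrightarrow> \<exists>N. \<forall>k\<ge>N. \<forall>F. finite F \<longrightarrow> (\<Sum>n\<in>F. norm (X k n - x n) ^ e) \<le> \<epsilon> ^ e"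
proof -
  have "Cauchy (\<lambda>k. X k n)" for n
  proof (rule metric_CauchyI)
    fix \<epsilon> :: real assume \<epsilon>: "\<epsilon> > 0"
    obtain N where N: "\<forall>i\<ge>N. \<forall>j\<ge>N. \<forall>F. finite F \<longrightarrow> (\<Sum>n\<in>F. norm (X i n - X j n) ^ e) \<le> (\<epsilon>/2) ^ e"
      using cauchy[OF half_gt_zero[OF \<epsilon>]] by blast
    have "dist (X i n) (X j n) < \<epsilon>" if "i \<ge> N" "j \<ge> N" for i j
    proof -
      have "norm (X i n - X j n) ^ e \<le> (\<epsilon>/2) ^ e" using N[rule_format, OF that, of "{n}"] by simp
      then have "norm (X i n - X j n) \<le> \<epsilon>/2" using \<epsilon> \<open>e > 0\<close> by (simp add: power_mono_iff)
      then show ?thesis using \<epsilon> by (simp add: dist_norm)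
    qed
    then show "\<exists>N. \<forall>i\<ge>N. \<forall>j\<ge>N. dist (X i n) (X j n) < \<epsilon>" by blast
  qed
  then have "\<exists>l. (\<lambda>k. X k n) \<longlonglongrightarrow> l" for n
    using Cauchy_convergent convergent_def by blast
  then obtain x where x: "\<And>n. (\<lambda>k. X k n) \<longlonglongrightarrow> x n" by metis
  have "\<exists>N. \<forall>k\<ge>N. \<forall>F. finite F \<longrightarrow> (\<Sum>n\<in>F. norm (X k n - x n) ^ e) \<le> \<epsilon> ^ e" if \<epsilon>: "\<epsilon> > 0" for \<epsilon>
  proof -
    obtain N where N: "\<forall>i\<ge>N. \<forall>j\<ge>N. \<forall>F. finite F \<longrightarrow> (\<Sum>n\<in>F. norm (X i n - X j n) ^ e) \<le> \<epsilon> ^ e"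
      using cauchy[OF \<epsilon>] by blast
    have "(\<Sum>n\<in>F. norm (X k n - x n) ^ e) \<le> \<epsilon> ^ e" if "k \<ge> N" "finite F" for k F
    proof (rule tendsto_upperbound)
      show "(\<lambda>j. \<Sum>n\<in>F. norm (X k n - X j n) ^ e) \<longlonglongrightarrow> (\<Sum>n\<in>F. norm (X k n - x n) ^ e)"
        by (intro tendsto_intros x)
      show "\<forall>\<^sub>F j in sequentially. (\<Sum>n\<in>F. norm (X k n - X j n) ^ e) \<le> \<epsilon> ^ e"
        using N that by (intro eventually_sequentiallyI[of N]) blast
    qed simp
    then show ?thesis by blast
  qed
  then show ?thesis by (rule that)
qed

instance l2 :: (type) banach
proof
  fix X :: "nat \<Rightarrow> 'a l2" assume C: "Cauchy X"
  have "\<exists>N. \<forall>i\<ge>N. \<forall>j\<ge>N. \<forall>F. finite F \<longrightarrow> (\<Sum>n\<in>F. norm (l2_fun (X i) n - l2_fun (X j) n) ^ 2) \<le> \<epsilon>\<^sup>2"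
    if "\<epsilon> > 0" for \<epsilon>
  proof -
    from C that obtain N where N: "\<And>i j. i \<ge> N \<Longrightarrow> j \<ge> N \<Longrightarrow> norm (X i - X j) < \<epsilon>"
      unfolding Cauchy_def dist_norm by meson
    have "(\<Sum>n\<in>F. norm (l2_fun (X i) n - l2_fun (X j) n) ^ 2) \<le> \<epsilon>\<^sup>2" if "i \<ge> N" "j \<ge> N" "finite F" for i j F
      using l2_finite_sum_le[OF that(3), of "X i - X j"] power_mono[OF less_imp_le[OF N[OF that(1,2)]], of 2]
      by (simp add: minus_l2.rep_eq)
    then show ?thesis by blast
  qed
  from summation_norm_cauchy_limit[OF zero_less_numeral this] obtain x where x: "\<And>\<epsilon>. \<epsilon> > 0 \<Longrightarrow>
      \<exists>N. \<forall>k\<ge>N. \<forall>F. finite F \<longrightarrow> (\<Sum>n\<in>F. norm (l2_fun (X k) n - x n) ^ 2) \<le> \<epsilon>\<^sup>2" by blast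
  obtain N where "\<And>F. finite F \<Longrightarrow> (\<Sum>n\<in>F. (l2_fun (X N) n - x n)\<^sup>2) \<le> 1\<^sup>2"
    using x[OF zero_less_one] by (auto simp del: one_power2)
  from ell2_add[OF l2_fun[of "X N"] ell2_scale[OF l2I[OF this], of "-1"]] have x2: "x \<in> ell2" by simp
  have "X \<longlonglongrightarrow> Abs_l2 x"
  proof (rule LIMSEQ_I)
    fix \<epsilon> :: real assume \<epsilon>: "\<epsilon> > 0"
    obtain N where N: "\<forall>k\<ge>N. \<forall>F. finite F \<longrightarrow> (\<Sum>n\<in>F. norm (l2_fun (X k) n - x n) ^ 2) \<le> (\<epsilon>/2)\<^sup>2"
      using x[OF half_gt_zero[OF \<epsilon>]] by blast
    have "norm (X k - Abs_l2 x) \<le> \<epsilon>/2" if "k \<ge> N" for k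
      using N[rule_format, OF that] \<epsilon>
      by (intro l2_norm_leI) (simp_all add: minus_l2.rep_eq Abs_l2_inverse[OF x2])
    moreover have "\<epsilon>/2 < \<epsilon>" using \<epsilon> by simp
    ultimately show "\<exists>N. \<forall>k\<ge>N. norm (X k - Abs_l2 x) < \<epsilon>" using le_less_trans by meson
  qed
  then show "convergent X" by (auto simp: convergent_def)
qed

text \<open>The supremum norm is dominated by the \<open>\<ell>\<^sup>2\<close> norm, so componentwise multiplication makes \<open>\<ell>\<^sup>2\<close> a
Banach algebra. It has no unit on an infinite lattice.\<close>

lemma ell2_mult_bound:
  assumes "finite F"
  shows "(\<Sum>n\<in>F. (l2_fun u n * l2_fun v n)\<^sup>2) \<le> (norm u * norm v)\<^sup>2"
proof -
  have "(\<Sum>n\<in>F. (l2_fun u n * l2_fun v n)\<^sup>2) \<le> (\<Sum>n\<in>F. (norm u)\<^sup>2 * (l2_fun v n)\<^sup>2)"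
  proof (rule sum_mono)
    fix n
    have "(l2_fun u n)\<^sup>2 \<le> (norm u)\<^sup>2"
      using power_mono[OF l2_coord_le[of u n], of 2] by simp
    then show "(l2_fun u n * l2_fun v n)\<^sup>2 \<le> (norm u)\<^sup>2 * (l2_fun v n)\<^sup>2"
      unfolding power_mult_distrib by (rule mult_right_mono) simp
  qed
  also have "\<dots> \<le> (norm u)\<^sup>2 * (norm v)\<^sup>2"
    unfolding sum_distrib_left[symmetric]
    by (intro mult_left_mono l2_finite_sum_le assms) auto
  finally show ?thesis by (simp add: power_mult_distrib)
qed

lemma ell2_mult:
  assumes "u \<in> ell2" "v \<in> ell2" shows "(\<lambda>n. u n * v n) \<in> ell2"
proof -
  have "(\<Sum>n\<in>F. (u n * v n)\<^sup>2) \<le> (norm (Abs_l2 u) * norm (Abs_l2 v))\<^sup>2" if "finite F" for F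
    using ell2_mult_bound[OF that, of "Abs_l2 u" "Abs_l2 v"] by (simp add: assms Abs_l2_inverse)
  then show ?thesis by (rule l2I)
qed

instantiation l2 :: (type) "{real_normed_algebra, comm_ring}"
begin
lift_definition times_l2 :: "'a l2 \<Rightarrow> 'a l2 \<Rightarrow> 'a l2" is "\<lambda>u v n. u n * v n"
  by (rule ell2_mult)
instance
proof
  fix x y z :: "'a l2" and r :: real
  show "x * y * z = x * (y * z)" by transfer (simp add: mult.assoc)
  show "x * y = y * x" by transfer (simp add: mult.commute)
  show "(x + y) * z = x * z + y * z" by transfer (simp add: algebra_simps)
  show "r *\<^sub>R x * y = r *\<^sub>R (x * y)" by transfer (simp add: algebra_simps)
  show "x * r *\<^sub>R y = r *\<^sub>R (x * y)" by transfer (simp add: algebra_simps)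
  show "x * (y + z) = x * y + x * z" by transfer (simp add: algebra_simps)
  show "norm (x * y) \<le> norm x * norm y"
    by (rule l2_norm_leI) (auto simp: times_l2.rep_eq ell2_mult_bound)
qed
end

section \<open>Absolutely summable families\<close>

text \<open>The construction is used twice: with integer indices for the Fourier modes of a periodic function,
and with natural indices and values in the former space for power series in the small parameter.\<close>

typedef (overloaded) ('m, 'a) l1 =
  "{f :: 'm \<Rightarrow> 'a::real_normed_vector. (\<lambda>m. norm (f m)) summable_on UNIV}"
  morphisms coeff Abs_l1
  by (rule exI[of _ "\<lambda>m. 0"]) simp

setup_lifting type_definition_l1

lemma coeff_summable: "(\<lambda>m. norm (coeff f m)) summable_on UNIV"
  using coeff[of f] by simp

instantiation l1 :: (type, real_normed_vector) real_normed_vector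
begin
lift_definition zero_l1 :: "('a, 'b) l1" is "\<lambda>m. 0" by simp
lift_definition plus_l1 :: "('a, 'b) l1 \<Rightarrow> ('a, 'b) l1 \<Rightarrow> ('a, 'b) l1" is "\<lambda>f g m. f m + g m"
proof -
  fix f g :: "'a \<Rightarrow> 'b"
  assume "(\<lambda>m. norm (f m)) summable_on UNIV" "(\<lambda>m. norm (g m)) summable_on UNIV"
  from summable_on_add[OF this] show "(\<lambda>m. norm (f m + g m)) summable_on UNIV"
    by (rule summable_on_compare) (auto intro: norm_triangle_ineq)
qed
lift_definition uminus_l1 :: "('a, 'b) l1 \<Rightarrow> ('a, 'b) l1" is "\<lambda>f m. - f m" by simp
definition minus_l1 :: "('a, 'b) l1 \<Rightarrow> ('a, 'b) l1 \<Rightarrow> ('a, 'b) l1" where "minus_l1 f g = f + - g"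
lift_definition scaleR_l1 :: "real \<Rightarrow> ('a, 'b) l1 \<Rightarrow> ('a, 'b) l1" is "\<lambda>c f m. c *\<^sub>R f m"
  by (simp add: summable_on_cmult_right)
lift_definition norm_l1 :: "('a, 'b) l1 \<Rightarrow> real" is "\<lambda>f. \<Sum>\<^sub>\<infinity>m. norm (f m)" .
definition sgn_l1 :: "('a, 'b) l1 \<Rightarrow> ('a, 'b) l1" where "sgn_l1 u = inverse (norm u) *\<^sub>R u"
definition dist_l1 :: "('a, 'b) l1 \<Rightarrow> ('a, 'b) l1 \<Rightarrow> real" where "dist_l1 u v = norm (u - v)"
definition uniformity_l1 :: "(('a, 'b) l1 \<times> ('a, 'b) l1) filter"
  where "uniformity_l1 = (INF e\<in>{0<..}. principal {(x, y). dist x y < e})"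
definition open_l1 :: "('a, 'b) l1 set \<Rightarrow> bool"
  where "open_l1 U = (\<forall>x\<in>U. eventually (\<lambda>(x', y). x' = x \<longrightarrow> y \<in> U) uniformity)"
instance
proof
  fix x y z :: "('a, 'b) l1" and r s :: real
  show "x + y + z = x + (y + z)" by transfer (simp add: add.assoc)
  show "x + y = y + x" by transfer (simp add: add.commute)
  show "0 + x = x" by transfer simp
  show "- x + x = 0" by transfer simp
  show "x - y = x + - y" by (fact minus_l1_def)
  show "r *\<^sub>R (x + y) = r *\<^sub>R x + r *\<^sub>R y" by transfer (simp add: algebra_simps)
  show "(r + s) *\<^sub>R x = r *\<^sub>R x + s *\<^sub>R x" by transfer (simp add: algebra_simps)
  show "r *\<^sub>R s *\<^sub>R x = (r * s) *\<^sub>R x" by transfer (simp add: algebra_simps)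
  show "1 *\<^sub>R x = x" by transfer simp
  show "dist x y = norm (x - y)" by (fact dist_l1_def)
  show "sgn x = inverse (norm x) *\<^sub>R x" by (fact sgn_l1_def)
  show "uniformity = (INF e\<in>{0<..}. principal {(x, y). dist (x::('a, 'b) l1) y < e})"
    by (fact uniformity_l1_def)
  show "open U = (\<forall>x\<in>U. \<forall>\<^sub>F (x', y) in uniformity. x' = x \<longrightarrow> y \<in> U)" for U :: "('a, 'b) l1 set"
    by (fact open_l1_def)
  show "norm (r *\<^sub>R x) = \<bar>r\<bar> * norm x"
    by transfer (simp add: infsum_cmult_right')
  show "norm (x + y) \<le> norm x + norm y"
  proof -
    have "norm (x + y) \<le> (\<Sum>\<^sub>\<infinity>m. norm (coeff x m) + norm (coeff y m))"
      unfolding norm_l1.rep_eq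
      by (intro infsum_mono coeff_summable summable_on_add)
         (simp add: plus_l1.rep_eq norm_triangle_ineq)
    also have "\<dots> = norm x + norm y"
      unfolding norm_l1.rep_eq by (intro infsum_add coeff_summable)
    finally show ?thesis .
  qed
  show "norm x = 0 \<longleftrightarrow> x = 0"
  proof
    assume "norm x = 0"
    then have "norm (coeff x n) = 0" for n
      by (intro nonneg_infsum_le_0D[of "\<lambda>n. norm (coeff x n)" UNIV n])
         (auto simp: norm_l1.rep_eq coeff_summable)
    then show "x = 0" by transfer auto
  qed (simp add: norm_l1.rep_eq zero_l1.rep_eq)
qed
end

lemma coeff_minus: "coeff (f - g) m = coeff f m - coeff g m"
  unfolding minus_l1_def plus_l1.rep_eq uminus_l1.rep_eq by simp

lemmas coeff_simps [simp] = zero_l1.rep_eq plus_l1.rep_eq uminus_l1.rep_eq coeff_minus scaleR_l1.rep_eq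

lemma l1_eqI: "(\<And>m. coeff f m = coeff g m) \<Longrightarrow> f = g"
  by (rule iffD1[OF coeff_inject]) (rule ext)

lemma l1_finite_sum_le: "finite F \<Longrightarrow> (\<Sum>m\<in>F. norm (coeff f m)) \<le> norm f"
  unfolding norm_l1.rep_eq by (rule finite_sum_le_infsum) (auto simp: coeff_summable)

lemma norm_coeff_le: "norm (coeff f m) \<le> norm f"
  using l1_finite_sum_le[of "{m}" f] by simp

lemma l1_norm_leI:
  "(\<And>F. finite F \<Longrightarrow> (\<Sum>m\<in>F. norm (coeff f m)) \<le> B) \<Longrightarrow> norm f \<le> B"
  unfolding norm_l1.rep_eq by (rule summable_on_nonneg_bounded(2)) auto

lemma bounded_linear_coeff: "bounded_linear (\<lambda>f. coeff f m)"
  by (rule bounded_linear_intro[where K = 1]) (auto simp: norm_coeff_le)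

instance l1 :: (type, banach) banach
proof
  fix X :: "nat \<Rightarrow> ('a, 'b) l1" assume C: "Cauchy X"
  have "\<exists>N. \<forall>i\<ge>N. \<forall>j\<ge>N. \<forall>F. finite F \<longrightarrow> (\<Sum>n\<in>F. norm (coeff (X i) n - coeff (X j) n) ^ 1) \<le> \<epsilon> ^ 1"
    if "\<epsilon> > 0" for \<epsilon>
  proof -
    from C that obtain N where N: "\<And>i j. i \<ge> N \<Longrightarrow> j \<ge> N \<Longrightarrow> norm (X i - X j) < \<epsilon>"
      unfolding Cauchy_def dist_norm by meson
    have "(\<Sum>n\<in>F. norm (coeff (X i) n - coeff (X j) n) ^ 1) \<le> \<epsilon> ^ 1" if "i \<ge> N" "j \<ge> N" "finite F" for i j F
      using l1_finite_sum_le[OF that(3), of "X i - X j"] N[OF that(1,2)] by simp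
    then show ?thesis by blast
  qed
  from summation_norm_cauchy_limit[OF zero_less_one this] obtain x where x: "\<And>\<epsilon>. \<epsilon> > 0 \<Longrightarrow>
      \<exists>N. \<forall>k\<ge>N. \<forall>F. finite F \<longrightarrow> (\<Sum>n\<in>F. norm (coeff (X k) n - x n)) \<le> \<epsilon>"
    by (auto simp only: power_one_right)
  obtain N where N: "\<And>F. finite F \<Longrightarrow> (\<Sum>n\<in>F. norm (coeff (X N) n - x n)) \<le> 1"
    using x[OF zero_less_one] by blast
  have "(\<lambda>n. norm (coeff (X N) n - x n)) summable_on UNIV"
    by (rule summable_on_nonneg_bounded(1)[OF _ N]) auto
  from summable_on_add[OF coeff_summable[of "X N"] this]
  have x2: "(\<lambda>n. norm (x n)) summable_on UNIV"
    by (rule summable_on_compare) (auto intro: norm_triangle_sub[THEN order_trans] simp: norm_minus_commute)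
  have "X \<longlonglongrightarrow> Abs_l1 x"
  proof (rule LIMSEQ_I)
    fix \<epsilon> :: real assume \<epsilon>: "\<epsilon> > 0"
    obtain N where N: "\<forall>k\<ge>N. \<forall>F. finite F \<longrightarrow> (\<Sum>n\<in>F. norm (coeff (X k) n - x n)) \<le> \<epsilon>/2"
      using x[OF half_gt_zero[OF \<epsilon>]] by blast
    have "norm (X k - Abs_l1 x) \<le> \<epsilon>/2" if "k \<ge> N" for k
      using N[rule_format, OF that] by (intro l1_norm_leI) (simp add: Abs_l1_inverse x2)
    moreover have "\<epsilon>/2 < \<epsilon>" using \<epsilon> by simp
    ultimately show "\<exists>N. \<forall>k\<ge>N. norm (X k - Abs_l1 x) < \<epsilon>" using le_less_trans by meson
  qed
  then show "convergent X" by (auto simp: convergent_def)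
qed

lift_definition single :: "'m \<Rightarrow> 'a \<Rightarrow> ('m, 'a::real_normed_vector) l1"
  is "\<lambda>m x k. if k = m then x else 0"
  by (rule finite_nonzero_values_imp_summable_on, rule finite_subset[of _ "{_}"]) auto

lemma coeff_single: "coeff (single m x) k = (if k = m then x else 0)"
  by (simp add: single.rep_eq)

lemma norm_single [simp]: "norm (single m x) = norm x"
proof -
  have "((\<lambda>k. norm (if k = m then x else 0)) has_sum norm x) UNIV"
    by (rule has_sum_finite_neutralI[of "{m}"]) auto
  then show ?thesis by (simp add: norm_l1.rep_eq coeff_single infsumI)
qed

lemma linear_single: "linear (single m)"
  by (rule linearI) (auto intro!: l1_eqI simp: coeff_single)

lemma l1_has_sum_single:
  fixes f :: "('m, 'a::banach) l1"
  shows "((\<lambda>m. single m (coeff f m)) has_sum f) UNIV"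
proof -
  have "(\<lambda>m. single m (coeff f m)) summable_on UNIV"
    by (rule Infinite_Sum.abs_summable_summable) (simp add: coeff_summable)
  then obtain g where g: "((\<lambda>m. single m (coeff f m)) has_sum g) UNIV"
    by (auto simp: summable_on_def)
  have "coeff g k = coeff f k" for k
  proof (rule has_sum_unique)
    show "((\<lambda>m. coeff (single m (coeff f m)) k) has_sum coeff g k) UNIV"
      by (rule has_sum_bounded_linear[OF bounded_linear_coeff g])
    show "((\<lambda>m. coeff (single m (coeff f m)) k) has_sum coeff f k) UNIV"
      by (rule has_sum_finite_neutralI[of "{k}"]) (auto simp: coeff_single)
  qed
  then have "g = f" by (rule l1_eqI)
  with g show ?thesis by simp
qed

text \<open>Finite sums of one-entry families are dense. The algebraic identities below are proved by checking
  them on such families.\<close>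

lemma l1_bounded_linear_eqI:
  fixes F G :: "('m, 'a::banach) l1 \<Rightarrow> 'b::banach"
  assumes "bounded_linear F" "bounded_linear G" "\<And>m x. F (single m x) = G (single m x)"
  shows "F f = G f"
  using has_sum_bounded_linear[OF assms(1) l1_has_sum_single[of f]]
    has_sum_bounded_linear[OF assms(2) l1_has_sum_single[of f]]
  unfolding assms(3) by (rule has_sum_unique)

text \<open>The linear map prescribed on one-entry families by \<open>\<phi>\<close>; every operator below arises in this way.\<close>

definition l1_ext :: "('m \<Rightarrow> 'a::banach \<Rightarrow> 'b::banach) \<Rightarrow> ('m, 'a) l1 \<Rightarrow> 'b"
  where "l1_ext \<phi> f = (\<Sum>\<^sub>\<infinity>m. \<phi> m (coeff f m))"

definition bounded_family :: "real \<Rightarrow> ('m \<Rightarrow> 'a::banach \<Rightarrow> 'b::banach) \<Rightarrow> bool"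
  where "bounded_family C \<phi> \<longleftrightarrow> (\<forall>m. linear (\<phi> m)) \<and> (\<forall>m x. norm (\<phi> m x) \<le> C * norm x)"

lemma bounded_familyI:
  "(\<And>m. linear (\<phi> m)) \<Longrightarrow> (\<And>m x. norm (\<phi> m x) \<le> C * norm x) \<Longrightarrow> bounded_family C \<phi>"
  by (simp add: bounded_family_def)

lemma l1_ext_abs_summable:
  assumes "bounded_family C \<phi>"
  shows "(\<lambda>m. norm (\<phi> m (coeff f m))) summable_on UNIV"
  by (rule Infinite_Sum.abs_summable_on_comparison_test'[OF summable_on_cmult_right[OF coeff_summable[of f], of C]])
     (use assms in \<open>auto simp: bounded_family_def\<close>)

lemma l1_ext_has_sum:
  assumes "bounded_family C \<phi>"
  shows "((\<lambda>m. \<phi> m (coeff f m)) has_sum l1_ext \<phi> f) UNIV"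
  unfolding l1_ext_def
  by (rule has_sum_infsum) (rule Infinite_Sum.abs_summable_summable[OF l1_ext_abs_summable[OF assms]])

lemma l1_ext_bound:
  assumes "bounded_family C \<phi>"
  shows "norm (l1_ext \<phi> f) \<le> C * norm f"
  by (rule norm_infsum_le[OF l1_ext_has_sum[OF assms]
        has_sum_cmult_right[OF has_sum_infsum[OF coeff_summable[of f]], of C, folded norm_l1.rep_eq]])
     (use assms in \<open>auto simp: bounded_family_def\<close>)

lemma bounded_linear_l1_ext:
  assumes "bounded_family C \<phi>"
  shows "bounded_linear (l1_ext \<phi>)"
proof (rule bounded_linear_intro[where K = C])
  have lin: "linear (\<phi> m)" for m using assms by (simp add: bounded_family_def)
  fix f g :: "('a, 'b) l1" and r :: real
  show "l1_ext \<phi> (f + g) = l1_ext \<phi> f + l1_ext \<phi> g"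
    using l1_ext_has_sum[OF assms, of "f + g"]
      has_sum_add[OF l1_ext_has_sum[OF assms, of f] l1_ext_has_sum[OF assms, of g]]
    by (simp add: linear_add[OF lin] has_sum_unique)
  show "l1_ext \<phi> (r *\<^sub>R f) = r *\<^sub>R l1_ext \<phi> f"
    using l1_ext_has_sum[OF assms, of "r *\<^sub>R f"]
      has_sum_bounded_linear[OF bounded_linear_scaleR_right l1_ext_has_sum[OF assms, of f], of r]
    by (simp add: linear_scale[OF lin] has_sum_unique)
  show "norm (l1_ext \<phi> f) \<le> norm f * C"
    using l1_ext_bound[OF assms, of f] by (simp add: mult.commute)
qed

lemma l1_ext_single:
  assumes "bounded_family C \<phi>"
  shows "l1_ext \<phi> (single m x) = \<phi> m x"
proof -
  have "\<phi> k 0 = 0" for k using assms by (simp add: bounded_family_def linear_0)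
  then have "((\<lambda>k. \<phi> k (coeff (single m x) k)) has_sum \<phi> m x) UNIV"
    by (intro has_sum_finite_neutralI[of "{m}"]) (auto simp: coeff_single)
  then show ?thesis by (simp add: l1_ext_def infsumI)
qed

section \<open>Convolution\<close>

text \<open>The product is fixed by the rule that one-entry families multiply by adding indices and multiplying
entries. Defining it through \<open>l1_ext\<close> instead of by a sum over all decompositions of an index reduces
associativity and commutativity to one-entry families.\<close>

definition conv_left :: "'m::ab_semigroup_add \<Rightarrow> 'a::{real_normed_algebra,comm_ring,banach} \<Rightarrow> ('m, 'a) l1 \<Rightarrow> ('m, 'a) l1"
  where "conv_left k x = l1_ext (\<lambda>l y. single (k + l) (x * y))"

lemma bounded_family_conv_left:
  "bounded_family (norm x) (\<lambda>l y. single (k + l) (x * y) :: ('m::ab_semigroup_add, 'a::{real_normed_algebra,comm_ring,banach}) l1)"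
proof (rule bounded_familyI)
  show "linear (\<lambda>y. single (k + l) (x * y) :: ('m, 'a) l1)" for l
    by (rule linearI) (auto simp: distrib_left linear_add[OF linear_single] linear_scale[OF linear_single])
qed (simp add: norm_mult_ineq)

lemma bounded_family_conv:
  "bounded_family (norm g) (\<lambda>k x. conv_left k x g)"
proof (rule bounded_familyI)
  fix k :: 'a
  show "linear (\<lambda>x. conv_left k x g)"
  proof (rule linearI)
    fix x y :: 'b and r :: real
    note sums = l1_ext_has_sum[OF bounded_family_conv_left[of _ k], of _ g]
    show "conv_left k (x + y) g = conv_left k x g + conv_left k y g"
      using has_sum_add[OF sums[of x] sums[of y]] sums[of "x + y"]
      unfolding conv_left_def by (simp add: distrib_right linear_add[OF linear_single] has_sum_unique)
    show "conv_left k (r *\<^sub>R x) g = r *\<^sub>R conv_left k x g"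
      using has_sum_bounded_linear[OF bounded_linear_scaleR_right sums[of x], of r] sums[of "r *\<^sub>R x"]
      unfolding conv_left_def by (simp add: linear_scale[OF linear_single] has_sum_unique)
  qed
  show "norm (conv_left k x g) \<le> norm g * norm x" for x
    unfolding conv_left_def using l1_ext_bound[OF bounded_family_conv_left[of x k], of g] by (simp add: mult.commute)
qed

instantiation l1 :: (ab_semigroup_add, "{real_normed_algebra,comm_ring,banach}") "{real_normed_algebra,comm_ring}"
begin
definition times_l1 :: "('a, 'b) l1 \<Rightarrow> ('a, 'b) l1 \<Rightarrow> ('a, 'b) l1"
  where "times_l1 f g = l1_ext (\<lambda>k x. conv_left k x g) f"
instance
proof
  have left: "bounded_linear (\<lambda>f. f * g)" for g :: "('a, 'b) l1"
    unfolding times_l1_def by (rule bounded_linear_l1_ext[OF bounded_family_conv])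
  have right: "bounded_linear (\<lambda>g. f * g)" for f :: "('a, 'b) l1"
  proof (rule bounded_linear_intro[where K = "norm f"])
    fix g h :: "('a, 'b) l1" and r :: real
    have lin: "linear (conv_left k x)" for k :: 'a and x :: 'b
      unfolding conv_left_def by (rule bounded_linear.linear[OF bounded_linear_l1_ext[OF bounded_family_conv_left]])
    note sums = l1_ext_has_sum[OF bounded_family_conv, of f]
    show "f * (g + h) = f * g + f * h" unfolding times_l1_def
      using has_sum_add[OF sums[of g] sums[of h]] sums[of "g + h"]
      by (simp add: linear_add[OF lin] has_sum_unique)
    show "f * (r *\<^sub>R g) = r *\<^sub>R (f * g)" unfolding times_l1_def
      using has_sum_bounded_linear[OF bounded_linear_scaleR_right sums[of g], of r] sums[of "r *\<^sub>R g"]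
      by (simp add: linear_scale[OF lin] has_sum_unique)
    show "norm (f * g) \<le> norm g * norm f"
      unfolding times_l1_def by (rule l1_ext_bound[OF bounded_family_conv])
  qed
  have single: "single k x * single l y = single (k + l) (x * y)" for k l :: 'a and x y :: 'b
    unfolding times_l1_def
    by (subst l1_ext_single[OF bounded_family_conv], unfold conv_left_def,
        rule l1_ext_single[OF bounded_family_conv_left])
  fix f g h :: "('a, 'b) l1" and r :: real
  show "(f + g) * h = f * h + g * h"
    by (rule linear_add[OF bounded_linear.linear[OF left]])
  show "f * (g + h) = f * g + f * h"
    by (rule linear_add[OF bounded_linear.linear[OF right]])
  show "r *\<^sub>R f * g = r *\<^sub>R (f * g)"
    by (rule linear_scale[OF bounded_linear.linear[OF left]])
  show "f * r *\<^sub>R g = r *\<^sub>R (f * g)"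
    by (rule linear_scale[OF bounded_linear.linear[OF right]])
  show "norm (f * g) \<le> norm f * norm g"
    unfolding times_l1_def using l1_ext_bound[OF bounded_family_conv, of g f] by (simp add: mult.commute)
  show "f * g = g * f"
    by (rule l1_bounded_linear_eqI[OF left right],
        rule l1_bounded_linear_eqI[OF right left])
       (simp add: single add.commute mult.commute)
  note bl = bounded_linear_compose[OF left] bounded_linear_compose[OF right] left right
  show "f * g * h = f * (g * h)"
    by (rule l1_bounded_linear_eqI[OF bl(1)[OF left] left],
        rule l1_bounded_linear_eqI[OF bl(1)[OF right] bl(2)[OF left]],
        rule l1_bounded_linear_eqI[OF right bl(2)[OF right]])
       (simp add: single add.assoc mult.assoc)
qed
end

lemma single_mult_single: "single k x * single l y = single (k + l) (x * y)"
  unfolding times_l1_def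
  by (subst l1_ext_single[OF bounded_family_conv], unfold conv_left_def,
      rule l1_ext_single[OF bounded_family_conv_left])

text \<open>This criterion gives the homomorphism property of all evaluation maps used later: of power series,
  of Fourier series, and of the reflection of modes.\<close>

lemma l1_multiplicativeI:
  fixes F :: "('m::ab_semigroup_add, 'a::{real_normed_algebra,comm_ring,banach}) l1 \<Rightarrow> 'b::{real_normed_algebra,banach}"
  assumes F: "bounded_linear F"
    and "\<And>k l x y. F (single (k + l) (x * y)) = F (single k x) * F (single l y)"
  shows "F (f * g) = F f * F g"
proof (rule l1_bounded_linear_eqI[of "\<lambda>f. F (f * g)" "\<lambda>f. F f * F g"])
  show "bounded_linear (\<lambda>f. F (f * g))" "bounded_linear (\<lambda>f. F f * F g)"
    by (rule bounded_linear_compose[OF F bounded_linear_mult_left]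
        bounded_linear_compose[OF bounded_linear_mult_left F])+
  show "F (single k x * g) = F (single k x) * F g" for k x
  proof (rule l1_bounded_linear_eqI[of "\<lambda>g. F (single k x * g)" "\<lambda>g. F (single k x) * F g"])
    show "bounded_linear (\<lambda>g. F (single k x * g))" "bounded_linear (\<lambda>g. F (single k x) * F g)"
      by (rule bounded_linear_compose[OF F bounded_linear_mult_right]
          bounded_linear_compose[OF bounded_linear_mult_right F])+
  qed (simp add: single_mult_single assms)
qed

section \<open>Invertibility of bounded-below symmetric operators\<close>

text \<open>With \<open>t = 1 / K\<^sup>2\<close> for a bound \<open>K\<close> of \<open>T\<close>, symmetry and the lower bound make \<open>x - t T\<^sup>2 x\<close> a strict contraction, so
\<open>T\<^sup>2 x = y\<close> is solved by a fixed point and \<open>T\<close> is onto.\<close>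

lemma symmetric_bounded_below_invertible:
  fixes T :: "'h::{real_inner,complete_space} \<Rightarrow> 'h"
  assumes T: "bounded_linear T" and sym: "\<And>x y. inner (T x) y = inner x (T y)"
    and c: "c > 0" "\<And>x. c * norm x \<le> norm (T x)"
  obtains G where "bounded_linear G" "\<And>x. G (T x) = x" "\<And>x. T (G x) = x"
proof -
  interpret T: bounded_linear T by (rule T)
  obtain K0 where K0: "\<And>x. norm (T x) \<le> norm x * K0" using T.bounded by blast
  define K where "K = max K0 c"
  have K: "norm (T x) \<le> K * norm x" for x
  proof -
    have "norm x * K0 \<le> norm x * K" by (rule mult_left_mono) (auto simp: K_def)
    then show ?thesis using K0[of x] by (simp add: mult.commute)
  qed
  have Kpos: "K > 0" "c \<le> K" using c by (auto simp: K_def)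
  define t where "t = 1 / K\<^sup>2"
  have t: "t > 0" "t * K\<^sup>2 = 1" using Kpos by (auto simp: t_def)
  have q: "0 \<le> 1 - t * c\<^sup>2" "1 - t * c\<^sup>2 < 1"
    using Kpos c t power_mono[of c K 2] by (auto simp: t_def field_simps)
  have contr: "(norm (d - t *\<^sub>R T (T d)))\<^sup>2 \<le> (1 - t * c\<^sup>2) * (norm d)\<^sup>2" for d
  proof -
    have "(norm (d - t *\<^sub>R T (T d)))\<^sup>2 = (norm d)\<^sup>2 - 2 * t * (norm (T d))\<^sup>2 + t * (t * (norm (T (T d)))\<^sup>2)"
      by (simp add: power2_norm_eq_inner inner_diff_left inner_diff_right inner_commute sym algebra_simps)
    also have "t * (t * (norm (T (T d)))\<^sup>2) \<le> t * (t * (K * norm (T d))\<^sup>2)"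
      using t K by (intro mult_left_mono power_mono) auto
    also have "t * (t * (K * norm (T d))\<^sup>2) = t * ((t * K\<^sup>2) * (norm (T d))\<^sup>2)"
      by (simp add: power_mult_distrib mult_ac)
    also have "\<dots> = t * (norm (T d))\<^sup>2" by (simp add: t)
    finally have "(norm (d - t *\<^sub>R T (T d)))\<^sup>2 \<le> (norm d)\<^sup>2 - t * (norm (T d))\<^sup>2" by simp
    moreover have "t * (c * norm d)\<^sup>2 \<le> t * (norm (T d))\<^sup>2"
      using t c by (intro mult_left_mono power_mono) auto
    ultimately show ?thesis by (simp add: power_mult_distrib algebra_simps)
  qed
  have surj: "\<exists>x. T x = y" for y
  proof -
    define f where "f x = x - t *\<^sub>R (T (T x) - y)" for x
    have "\<exists>!x. f x = x"
    proof (rule banach_fix_type)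
      show "0 \<le> sqrt (1 - t * c\<^sup>2)" "sqrt (1 - t * c\<^sup>2) < 1" using q by auto
      show "\<forall>x. \<forall>y. dist (f x) (f y) \<le> sqrt (1 - t * c\<^sup>2) * dist x y"
      proof (intro allI)
        fix u v
        have "f u - f v = (u - v) - t *\<^sub>R T (T (u - v))"
          by (simp add: f_def T.diff algebra_simps)
        then have "(norm (f u - f v))\<^sup>2 \<le> (1 - t * c\<^sup>2) * (norm (u - v))\<^sup>2"
          using contr[of "u - v"] by simp
        then have "norm (f u - f v) \<le> sqrt ((1 - t * c\<^sup>2) * (norm (u - v))\<^sup>2)"
          by (rule real_le_rsqrt)
        then show "dist (f u) (f v) \<le> sqrt (1 - t * c\<^sup>2) * dist u v"
          by (simp add: dist_norm real_sqrt_mult)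
      qed
    qed
    then obtain x where "f x = x" by blast
    then have "T (T x) = y" using t by (simp add: f_def)
    then show ?thesis by blast
  qed
  define G where "G y = (SOME x. T x = y)" for y
  have TG: "T (G y) = y" for y unfolding G_def by (rule someI_ex[OF surj])
  have inj: "x = y" if "T x = T y" for x y
  proof -
    have "c * norm (x - y) \<le> 0" using c(2)[of "x - y"] that by (simp add: T.diff)
    then show ?thesis using c(1) by (simp add: mult_le_0_iff)
  qed
  have "bounded_linear G"
  proof (rule bounded_linear_intro[where K = "1 / c"])
    show "G (x + y) = G x + G y" for x y by (rule inj) (simp add: TG T.add)
    show "G (r *\<^sub>R x) = r *\<^sub>R G x" for r x by (rule inj) (simp add: TG T.scale)
    show "norm (G x) \<le> norm x * (1 / c)" for x
      using c(2)[of "G x"] c(1) by (simp add: TG field_simps)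
  qed
  moreover have "G (T x) = x" for x by (rule inj) (simp add: TG)
  ultimately show ?thesis using TG that by blast
qed

section \<open>Compact multiplication operators\<close>

definition l2_trunc :: "'i set \<Rightarrow> 'i l2 \<Rightarrow> 'i l2" where
  "l2_trunc F b = Abs_l2 (\<lambda>n. if n \<in> F then l2_fun b n else 0)"

lemma l2_fun_trunc: "l2_fun (l2_trunc F b) n = (if n \<in> F then l2_fun b n else 0)"
proof -
  have "(\<lambda>n. if n \<in> F then l2_fun b n else 0) \<in> ell2"
    unfolding ell2_def mem_Collect_eq
    by (rule summable_on_compare[of "\<lambda>n. (l2_fun b n)\<^sup>2"]) (use l2_fun[of b] in \<open>auto simp: ell2_def\<close>)
  then show ?thesis by (simp add: l2_trunc_def Abs_l2_inverse)
qed

lemma l2_eqI: "(\<And>n. l2_fun u n = l2_fun v n) \<Longrightarrow> u = v"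
  by (rule iffD1[OF l2_fun_inject]) (rule ext)

lemma l2_norm_sq_has_sum: "((\<lambda>n. (l2_fun u n)\<^sup>2) has_sum (norm u)\<^sup>2) UNIV"
proof -
  have "(\<lambda>n. (l2_fun u n)\<^sup>2) summable_on UNIV" using l2_fun[of u] by (simp add: ell2_def)
  moreover have "(norm u)\<^sup>2 = (\<Sum>\<^sub>\<infinity>n. (l2_fun u n)\<^sup>2)"
    by (simp add: l2_norm_eq ell2_norm_def infsum_nonneg)
  ultimately show ?thesis by simp
qed

lemma l2_trunc_approx:
  assumes "\<eta> > 0"
  obtains F where "finite F" "norm (b - l2_trunc F b) \<le> \<eta>"
proof -
  obtain F where F: "finite F" "dist (\<Sum>n\<in>F. (l2_fun b n)\<^sup>2) ((norm b)\<^sup>2) \<le> \<eta>\<^sup>2"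
    using has_sum_finite_approximation[OF l2_norm_sq_has_sum[of b], of "\<eta>\<^sup>2"] assms by auto
  have "((\<lambda>n. if n \<in> F then (l2_fun b n)\<^sup>2 else 0) has_sum (\<Sum>n\<in>F. (l2_fun b n)\<^sup>2)) UNIV"
    by (rule has_sum_finite_neutralI[OF F(1)]) auto
  from has_sum_add[OF l2_norm_sq_has_sum[of b] has_sum_uminusI[OF this]]
  moreover have "(\<lambda>n. (l2_fun b n)\<^sup>2 + - (if n \<in> F then (l2_fun b n)\<^sup>2 else 0)) =
      (\<lambda>n. (l2_fun (b - l2_trunc F b) n)\<^sup>2)"
    by (auto simp: fun_eq_iff minus_l2.rep_eq l2_fun_trunc)
  ultimately have "((\<lambda>n. (l2_fun (b - l2_trunc F b) n)\<^sup>2) has_sum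
      ((norm b)\<^sup>2 - (\<Sum>n\<in>F. (l2_fun b n)\<^sup>2))) UNIV" by simp
  from has_sum_unique[OF l2_norm_sq_has_sum this]
  have "(norm (b - l2_trunc F b))\<^sup>2 \<le> \<eta>\<^sup>2" using F(2) by (simp add: dist_real_def)
  then have "norm (b - l2_trunc F b) \<le> \<eta>" using assms by (rule power2_le_imp_le[OF _ less_imp_le])
  with F(1) show ?thesis by (rule that)
qed

text \<open>Multiplication by a finitely supported sequence has finite rank, so it maps the unit ball into a
compact set.\<close>

lemma trunc_mult_in_compact:
  assumes "finite F"
  shows "\<exists>C. compact C \<and> (\<forall>v::'i l2. norm v \<le> 1 \<longrightarrow> l2_trunc F b * v \<in> C)"
  using assms
proof induction
  case empty
  have "l2_trunc {} b * v = 0" for v :: "'i l2"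
    by (rule l2_eqI) (simp add: times_l2.rep_eq l2_fun_trunc zero_l2.rep_eq)
  then show ?case by (intro exI[of _ "{0}"]) auto
next
  case (insert m F)
  then obtain C where C: "compact C" "\<And>v::'i l2. norm v \<le> 1 \<Longrightarrow> l2_trunc F b * v \<in> C" by blast
  define e :: "'i l2" where "e = l2_trunc {m} b"
  define D where "D = (\<lambda>c. c *\<^sub>R e) ` {-1..1}"
  have "compact D" unfolding D_def by (intro compact_continuous_image continuous_intros) auto
  have "l2_trunc (insert m F) b * v \<in> {x + y | x y. x \<in> C \<and> y \<in> D}" if "norm v \<le> 1" for v
  proof -
    have "l2_trunc (insert m F) b * v = l2_trunc F b * v + l2_fun v m *\<^sub>R e"
      using insert.hyps by (intro l2_eqI)
        (auto simp: times_l2.rep_eq plus_l2.rep_eq scaleR_l2.rep_eq l2_fun_trunc e_def)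
    moreover have "l2_fun v m \<in> {-1..1}" using l2_coord_le[of v m] that by auto
    ultimately show ?thesis using C(2)[OF that] unfolding D_def by blast
  qed
  then show ?case using compact_sums[OF C(1) \<open>compact D\<close>] by blast
qed

text \<open>Adding a compact multiplication operator to an operator that is bounded below keeps it bounded
  below as long as no kernel appears: a normalized sequence along which the sum tends to zero would
  subconverge, first after the compact part and then before it, to an element of the kernel.\<close>

lemma bounded_below_compact_perturbation:
  fixes T :: "'i l2 \<Rightarrow> 'i l2"
  assumes T: "bounded_linear T" and \<delta>: "\<delta> > 0" "\<And>v. \<delta> * norm v \<le> norm (T v)"
    and ker: "\<And>v. T v + b * v = 0 \<Longrightarrow> v = 0"
  obtains c where "c > 0" "\<And>v. c * norm v \<le> norm (T v + b * v)"
proof (rule ccontr)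
  assume "\<not> thesis"
  then have neg: "\<exists>v. norm (T v + b * v) < c * norm v" if "c > 0" for c
    using that \<open>\<And>c. c > 0 \<Longrightarrow> (\<And>v. c * norm v \<le> norm (T v + b * v)) \<Longrightarrow> thesis\<close> by (meson not_le)
  interpret T: bounded_linear T by (rule T)
  define J where "J v = T v + b * v" for v
  have J: "bounded_linear J" unfolding J_def by (intro bounded_linear_add T bounded_linear_mult_right)
  interpret J: bounded_linear J by (rule J)
  have "\<exists>u. norm u = 1 \<and> norm (J u) < 1 / real (Suc k)" for k
  proof -
    obtain v where v: "norm (J v) < 1 / real (Suc k) * norm v"
      using neg[of "1 / real (Suc k)"] by (auto simp: J_def)
    then have "v \<noteq> 0" by auto
    with v have "norm (J (v /\<^sub>R norm v)) < 1 / real (Suc k)"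
      by (simp add: J.scale field_simps)
    with \<open>v \<noteq> 0\<close> show ?thesis by (intro exI[of _ "v /\<^sub>R norm v"]) simp
  qed
  then obtain u where u: "\<And>k. norm (u k) = 1" "\<And>k. norm (J (u k)) < 1 / real (Suc k)" by metis
  obtain F where F: "finite F" "norm (b - l2_trunc F b) \<le> \<delta> / 2"
    using l2_trunc_approx[of "\<delta> / 2"] \<delta>(1) by auto
  define bF where "bF = l2_trunc F b"
  obtain C where C: "compact C" "\<And>v. norm v \<le> 1 \<Longrightarrow> bF * v \<in> C"
    using trunc_mult_in_compact[OF F(1), of b] unfolding bF_def by blast
  have "\<forall>k. bF * u k \<in> C" using C(2) u(1) by simp
  from seq_compactE[OF C(1)[unfolded compact_eq_seq_compact_metric] this]
  obtain w r where r: "strict_mono (r :: nat \<Rightarrow> nat)" and w: "((\<lambda>k. bF * u k) \<circ> r) \<longlonglongrightarrow> w" by blast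
  define T' where "T' v = T v + (b - bF) * v" for v
  have T': "bounded_linear T'" unfolding T'_def by (intro bounded_linear_add T bounded_linear_mult_right)
  interpret T': bounded_linear T' by (rule T')
  have below: "\<delta> / 2 * norm v \<le> norm (T' v)" for v
  proof -
    have "norm ((b - bF) * v) \<le> \<delta> / 2 * norm v"
      using F(2) by (intro order_trans[OF norm_mult_ineq] mult_right_mono) (auto simp: bF_def)
    moreover have "norm (T v) \<le> norm (T' v) + norm ((b - bF) * v)"
      unfolding T'_def using norm_triangle_ineq4[of "T v + (b - bF) * v" "(b - bF) * v"] by simp
    ultimately show ?thesis using \<delta>(2)[of v] by simp
  qed
  have J0: "(\<lambda>k. J (u (r k))) \<longlonglongrightarrow> 0"
  proof -
    have "(\<lambda>k. J (u k)) \<longlonglongrightarrow> 0"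
      by (rule Lim_null_comparison[OF _ LIMSEQ_inverse_real_of_nat])
         (use u(2) in \<open>auto intro!: always_eventually less_imp_le simp: inverse_eq_divide\<close>)
    from LIMSEQ_subseq_LIMSEQ[OF this r] show ?thesis by (simp add: o_def)
  qed
  have "(\<lambda>k. J (u (r k)) - bF * u (r k)) \<longlonglongrightarrow> 0 - w"
    using w by (intro tendsto_diff J0) (simp add: o_def)
  also have "(\<lambda>k. J (u (r k)) - bF * u (r k)) = (\<lambda>k. T' (u (r k)))"
    by (simp add: J_def T'_def algebra_simps fun_eq_iff)
  finally have "Cauchy (\<lambda>k. T' (u (r k)))" by (rule LIMSEQ_imp_Cauchy)
  have "Cauchy (\<lambda>k. u (r k))"
  proof (rule metric_CauchyI)
    fix e :: real assume "e > 0"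
    then have "\<delta> / 2 * e > 0" using \<delta>(1) by simp
    with \<open>Cauchy (\<lambda>k. T' (u (r k)))\<close> obtain N
      where N: "\<And>i j. i \<ge> N \<Longrightarrow> j \<ge> N \<Longrightarrow> dist (T' (u (r i))) (T' (u (r j))) < \<delta> / 2 * e"
      unfolding Cauchy_def by meson
    have "dist (u (r i)) (u (r j)) < e" if "i \<ge> N" "j \<ge> N" for i j
    proof -
      have "\<delta> / 2 * norm (u (r i) - u (r j)) < \<delta> / 2 * e"
        using below[of "u (r i) - u (r j)"] N[OF that] by (simp add: dist_norm T'.diff)
      then show ?thesis using \<delta>(1) by (simp add: dist_norm)
    qed
    then show "\<exists>N. \<forall>i\<ge>N. \<forall>j\<ge>N. dist (u (r i)) (u (r j)) < e" by blast
  qed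
  then obtain x where x: "(\<lambda>k. u (r k)) \<longlonglongrightarrow> x" using Cauchy_convergent convergent_def by blast
  have "norm x = 1" using tendsto_norm[OF x] u(1) by (simp add: LIMSEQ_const_iff)
  have "J x = 0" using LIMSEQ_unique[OF J.tendsto[OF x] J0] .
  then have "x = 0" unfolding J_def by (rule ker)
  with \<open>norm x = 1\<close> show False by simp
qed

section \<open>The discrete Laplacian\<close>

lemma bij_add_const: "bij (\<lambda>n::'g::group_add. n + e)"
  by (rule bij_betw_byWitness[where f' = "\<lambda>n. n - e"]) auto

lift_definition l2_shift :: "'g::ab_group_add \<Rightarrow> 'g l2 \<Rightarrow> 'g l2" is "\<lambda>e u n. u (n + e)"
  unfolding ell2_def mem_Collect_eq by (subst summable_on_reindex_bij_betw[OF bij_add_const])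

lemma norm_l2_shift: "norm (l2_shift e u) = norm u"
  unfolding l2_norm_eq ell2_norm_def l2_shift.rep_eq
  by (subst infsum_reindex_bij_betw[OF bij_add_const, of "\<lambda>n. (l2_fun u n)\<^sup>2"]) simp

lemma bounded_linear_l2_shift: "bounded_linear (l2_shift e)"
proof (rule bounded_linear_intro[where K = 1])
  show "l2_shift e (x + y) = l2_shift e x + l2_shift e y" for x y by transfer simp
  show "l2_shift e (r *\<^sub>R x) = r *\<^sub>R l2_shift e x" for r x by transfer simp
qed (simp add: norm_l2_shift)

lemma inner_l2_shift: "inner (l2_shift e u) v = inner u (l2_shift (- e) v)"
  unfolding inner_l2.rep_eq l2_shift.rep_eq
  using infsum_reindex_bij_betw[OF bij_add_const, of "\<lambda>n. l2_fun u n * l2_fun v (n - e)" e] by simp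

definition unit_steps :: "(int ^ 'd) set" where "unit_steps = {e. lattice_norm e = 1}"

text \<open>An integer vector of Euclidean length one has exactly one nonzero entry, as the squares of its
entries add up to one. Hence there are at most \<open>2d\<close> of them.\<close>

lemma unit_steps_subset: "unit_steps \<subseteq> (\<lambda>(i, s). axis i s) ` (UNIV \<times> {1, -1 :: int})"
proof
  fix e :: "int ^ 'd" assume "e \<in> unit_steps"
  then have "(\<Sum>i\<in>UNIV. (real_of_int (e $ i))\<^sup>2) = 1"
    by (simp add: unit_steps_def lattice_norm_def norm_vec_def L2_set_def)
  then have "real_of_int (\<Sum>i\<in>UNIV. (e $ i)\<^sup>2) = 1" by simp
  then have s: "(\<Sum>i\<in>UNIV. (e $ i)\<^sup>2) = 1" by linarith
  then obtain i where i: "e $ i \<noteq> 0" by (metis (mono_tags, lifting) power_zero_numeral sum.neutral zero_neq_one)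
  have s': "(e $ i)\<^sup>2 + (\<Sum>j\<in>UNIV - {i}. (e $ j)\<^sup>2) = 1"
    using s by (simp add: sum.remove[of UNIV i])
  have nn: "(\<Sum>j\<in>UNIV - {i}. (e $ j)\<^sup>2) \<ge> 0" by (rule sum_nonneg) simp
  have pos: "(e $ i)\<^sup>2 \<ge> 1" using i by (simp add: int_one_le_iff_zero_less)
  have one: "(e $ i)\<^sup>2 = 1" and "(\<Sum>j\<in>UNIV - {i}. (e $ j)\<^sup>2) = 0" using s' nn pos by linarith+
  then have "\<forall>j\<in>UNIV - {i}. (e $ j)\<^sup>2 = 0" by (subst (asm) sum_nonneg_eq_0_iff) auto
  then have "e = axis i (e $ i)" by (auto simp: vec_eq_iff axis_def)
  moreover have "e $ i = 1 \<or> e $ i = -1" using one by (simp add: power2_eq_1_iff)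
  ultimately show "e \<in> (\<lambda>(i, s). axis i s) ` (UNIV \<times> {1, -1 :: int})" by force
qed

lemma card_unit_steps: "card (unit_steps :: (int ^ 'd) set) \<le> 2 * CARD('d)"
proof -
  have "card (unit_steps :: (int ^ 'd) set) \<le> card ((\<lambda>(i, s). axis i s :: int ^ 'd) ` (UNIV \<times> {1, -1 :: int}))"
    by (rule card_mono[OF _ unit_steps_subset]) simp
  also have "\<dots> \<le> card ((UNIV :: 'd set) \<times> {1, -1 :: int})" by (rule card_image_le) simp
  finally show ?thesis by (simp add: card_cartesian_product)
qed

lemma uminus_unit_steps: "e \<in> unit_steps \<longleftrightarrow> - e \<in> unit_steps"
  by (simp add: unit_steps_def lattice_norm_def norm_vec_def)

lemma dlaplace_eq: "dlaplace u n = (\<Sum>e\<in>unit_steps. u (n + e) - u n)"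
  unfolding dlaplace_def
  by (rule sum.reindex_bij_witness[of _ "\<lambda>e. n + e" "\<lambda>k. k - n"]) (auto simp: unit_steps_def)

definition lap :: "(int ^ 'd) l2 \<Rightarrow> (int ^ 'd) l2" where
  "lap u = (\<Sum>e\<in>unit_steps. l2_shift e u - u)"

lemma l2_fun_sum: "l2_fun (\<Sum>i\<in>I. f i) n = (\<Sum>i\<in>I. l2_fun (f i) n)"
  by (induction I rule: infinite_finite_induct) (auto simp: zero_l2.rep_eq plus_l2.rep_eq)

lemma l2_fun_lap: "l2_fun (lap u) n = dlaplace (l2_fun u) n"
  by (simp add: lap_def dlaplace_eq l2_fun_sum minus_l2.rep_eq l2_shift.rep_eq)

lemma bounded_linear_lap: "bounded_linear lap"
  unfolding lap_def by (intro bounded_linear_sum bounded_linear_sub bounded_linear_l2_shift bounded_linear_ident)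

lemma inner_lap: "inner (lap u) v = inner u (lap v)"
proof -
  have "(\<Sum>e\<in>unit_steps. inner (l2_shift e u) v) = (\<Sum>e\<in>unit_steps. inner u (l2_shift e v))"
    by (rule sum.reindex_bij_witness[of _ uminus uminus])
       (auto simp: uminus_unit_steps[symmetric] inner_l2_shift)
  then show ?thesis
    by (simp add: lap_def inner_sum_left inner_sum_right inner_diff_left inner_diff_right sum_subtractf)
qed

text \<open>Outside \<open>[-4d, 0]\<close> the diagonal part of \<open>\<Omega> - \<Delta>\<close> dominates the \<open>2d\<close> neighbour shifts.\<close>

lemma lap_bounded_below:
  assumes "\<Omega> \<notin> {- 4 * real CARD('d)..0}"
  obtains \<delta> where "\<delta> > 0" "\<And>v :: (int ^ 'd) l2. \<delta> * norm v \<le> norm (\<Omega> *\<^sub>R v - lap v)"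
proof
  let ?c = "real (card (unit_steps :: (int ^ 'd) set))"
  have c: "?c \<le> 2 * real CARD('d)" using card_unit_steps[where 'd = 'd] by linarith
  show "\<bar>\<Omega> + ?c\<bar> - ?c > 0" using assms c by auto
  fix v :: "(int ^ 'd) l2"
  have eq: "\<Omega> *\<^sub>R v - lap v = (\<Omega> + ?c) *\<^sub>R v - (\<Sum>e\<in>unit_steps. l2_shift e v)"
    by (simp add: lap_def sum_subtractf scaleR_add_left sum_constant_scaleR)
  have "norm (\<Sum>e\<in>unit_steps. l2_shift e v) \<le> ?c * norm v"
    by (rule order_trans[OF norm_sum]) (simp add: norm_l2_shift)
  then show "(\<bar>\<Omega> + ?c\<bar> - ?c) * norm v \<le> norm (\<Omega> *\<^sub>R v - lap v)"
    unfolding eq left_diff_distrib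
    using norm_triangle_ineq2[of "(\<Omega> + ?c) *\<^sub>R v" "\<Sum>e\<in>unit_steps. l2_shift e v"] by simp
qed

lemma inner_mult_l2: "inner (b * u) v = inner u (b * v :: 'i l2)"
  by (simp add: inner_l2.rep_eq times_l2.rep_eq mult_ac)

text \<open>A trivial kernel suffices for invertibility, since the potential \<open>b\<close> is square summable and hence acts
compactly.\<close>

lemma jacobian_invertible:
  fixes b :: "(int ^ 'd) l2"
  assumes "\<Omega> \<notin> {- 4 * real CARD('d)..0}"
    and ker: "\<And>v. \<Omega> *\<^sub>R v + b * v - lap v = 0 \<Longrightarrow> v = 0"
  obtains G where "bounded_linear G" "\<And>v. G (\<Omega> *\<^sub>R v + b * v - lap v) = v"
    "\<And>v. \<Omega> *\<^sub>R G v + b * G v - lap (G v) = v"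
proof -
  define J where "J v = \<Omega> *\<^sub>R v + b * v - lap v" for v
  have T: "bounded_linear (\<lambda>v. \<Omega> *\<^sub>R v - lap v)"
    by (intro bounded_linear_sub bounded_linear_scaleR_right bounded_linear_lap)
  have J: "bounded_linear J" unfolding J_def
    by (intro bounded_linear_sub bounded_linear_add bounded_linear_scaleR_right bounded_linear_lap bounded_linear_mult_right)
  obtain \<delta> where \<delta>: "\<delta> > 0" "\<And>v :: (int ^ 'd) l2. \<delta> * norm v \<le> norm (\<Omega> *\<^sub>R v - lap v)"
    using lap_bounded_below[OF assms(1)] by blast
  have JT: "J v = (\<Omega> *\<^sub>R v - lap v) + b * v" for v by (simp add: J_def)
  obtain c where c: "c > 0" "\<And>v. c * norm v \<le> norm (J v)"
    using bounded_below_compact_perturbation[OF T \<delta>, of b] ker unfolding JT[symmetric] J_def by metis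
  have sym: "inner (J u) v = inner u (J v)" for u v
    by (simp add: J_def inner_diff_left inner_diff_right inner_add_left inner_add_right inner_lap inner_mult_l2)
  obtain G where "bounded_linear G" "\<And>x. G (J x) = x" "\<And>x. J (G x) = x"
    using symmetric_bounded_below_invertible[OF J sym c] by blast
  then show ?thesis unfolding J_def by (rule that)
qed

section \<open>Strict derivatives\<close>

text \<open>Two free points \<open>A\<close> and \<open>B\<close> near \<open>a\<close>, instead of one, are what a contraction argument needs: the
remainder after linearization has a small Lipschitz constant on a small ball.\<close>

definition strict_deriv :: "('a::real_normed_vector \<Rightarrow> 'b::real_normed_vector) \<Rightarrow> ('a \<Rightarrow> 'b) \<Rightarrow> 'a \<Rightarrow> bool"
  where "strict_deriv f L a \<longleftrightarrow> bounded_linear L \<and>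
    (\<forall>\<eta>>0. \<exists>r>0. \<forall>A\<in>cball a r. \<forall>B\<in>cball a r. norm (f A - f B - L (A - B)) \<le> \<eta> * norm (A - B))"

lemma strict_derivD:
  assumes "strict_deriv f L a" "\<eta> > 0"
  obtains r where "r > 0"
    "\<And>A B. A \<in> cball a r \<Longrightarrow> B \<in> cball a r \<Longrightarrow> norm (f A - f B - L (A - B)) \<le> \<eta> * norm (A - B)"
  using assms unfolding strict_deriv_def by blast

lemma bounded_linear_bound:
  assumes "bounded_linear f"
  obtains K where "K \<ge> 0" "\<And>x. norm (f x) \<le> K * norm x"
  using bounded_linear.nonneg_bounded[OF assms] by (metis mult.commute)

lemma strict_deriv_lipschitz:
  assumes "strict_deriv f L a"
  obtains K r where "K \<ge> 0" "r > 0" "\<And>v. norm (L v) \<le> K * norm v"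
    "\<And>A B. A \<in> cball a r \<Longrightarrow> B \<in> cball a r \<Longrightarrow> norm (f A - f B) \<le> K * norm (A - B)"
proof -
  obtain K where K: "K \<ge> 0" "\<And>x. norm (L x) \<le> K * norm x"
    using assms bounded_linear_bound unfolding strict_deriv_def by blast
  obtain r where r: "r > 0"
    "\<And>A B. A \<in> cball a r \<Longrightarrow> B \<in> cball a r \<Longrightarrow> norm (f A - f B - L (A - B)) \<le> 1 * norm (A - B)"
    using strict_derivD[OF assms zero_less_one] by blast
  show ?thesis
  proof (rule that)
    show "K + 1 \<ge> 0" "r > 0" using K r by auto
    show "norm (L v) \<le> (K + 1) * norm v" for v using K(2)[of v] by (simp add: distrib_right add_increasing2)
    fix A B assume "A \<in> cball a r" "B \<in> cball a r"
    from r(2)[OF this] K(2)[of "A - B"] norm_triangle_ineq[of "f A - f B - L (A - B)" "L (A - B)"]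
    show "norm (f A - f B) \<le> (K + 1) * norm (A - B)" by (simp add: distrib_right)
  qed
qed

lemma strict_deriv_linear: "bounded_linear L \<Longrightarrow> strict_deriv L L a"
  unfolding strict_deriv_def
  by (auto simp: linear_diff[OF bounded_linear.linear] intro!: exI[of _ 1])

lemma strict_deriv_diff_linear:
  assumes f: "strict_deriv f L a" and M: "bounded_linear M"
  shows "strict_deriv (\<lambda>x. f x - M x) (\<lambda>v. L v - M v) a"
proof -
  have eq: "f A - M A - (f B - M B) - (L (A - B) - M (A - B)) = f A - f B - L (A - B)" for A B
    by (simp add: linear_diff[OF bounded_linear.linear[OF M]])
  show ?thesis using f bounded_linear_sub[OF _ M] unfolding strict_deriv_def eq by blast
qed

lemma strict_deriv_mult:
  fixes f g :: "'a::real_normed_vector \<Rightarrow> 'b::real_normed_algebra"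
  assumes f: "strict_deriv f L a" and g: "strict_deriv g M a"
  shows "strict_deriv (\<lambda>x. f x * g x) (\<lambda>v. L v * g a + f a * M v) a"
  unfolding strict_deriv_def
proof (intro conjI allI impI)
  show "bounded_linear (\<lambda>v. L v * g a + f a * M v)"
    using f g by (auto simp: strict_deriv_def intro!: bounded_linear_add
        bounded_linear_compose[OF bounded_linear_mult_left] bounded_linear_compose[OF bounded_linear_mult_right])
  obtain K r1 where K: "K \<ge> 0" "r1 > 0" "\<And>v. norm (L v) \<le> K * norm v"
    "\<And>A B. A \<in> cball a r1 \<Longrightarrow> B \<in> cball a r1 \<Longrightarrow> norm (f A - f B) \<le> K * norm (A - B)"
    using strict_deriv_lipschitz[OF f] by blast
  obtain H r2 where H: "H \<ge> 0" "r2 > 0" "\<And>v. norm (M v) \<le> H * norm v"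
    "\<And>A B. A \<in> cball a r2 \<Longrightarrow> B \<in> cball a r2 \<Longrightarrow> norm (g A - g B) \<le> H * norm (A - B)"
    using strict_deriv_lipschitz[OF g] by blast
  fix \<eta> :: real assume \<eta>: "\<eta> > 0"
  define C where "C = norm (f a) + norm (g a) + K + H + 1"
  have C: "C \<ge> 1" using K(1) H(1) by (simp add: C_def)
  obtain r3 where r3: "r3 > 0" "\<And>A B. A \<in> cball a r3 \<Longrightarrow> B \<in> cball a r3 \<Longrightarrow>
      norm (f A - f B - L (A - B)) \<le> \<eta> / (4 * C) * norm (A - B)"
    using strict_derivD[OF f, of "\<eta> / (4 * C)"] \<eta> C by auto
  obtain r4 where r4: "r4 > 0" "\<And>A B. A \<in> cball a r4 \<Longrightarrow> B \<in> cball a r4 \<Longrightarrow>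
      norm (g A - g B - M (A - B)) \<le> \<eta> / (4 * C) * norm (A - B)"
    using strict_derivD[OF g, of "\<eta> / (4 * C)"] \<eta> C by auto
  define r where "r = min (min r1 r2) (min (min r3 r4) (min 1 (\<eta> / (4 * C\<^sup>2))))"
  have "\<eta> / (4 * C\<^sup>2) > 0" using \<eta> C by simp
  then have r: "r > 0" "r \<le> r1" "r \<le> r2" "r \<le> r3" "r \<le> r4" "r \<le> 1" "r \<le> \<eta> / (4 * C\<^sup>2)"
    using K(2) H(2) r3(1) r4(1) by (simp_all only: r_def min_less_iff_conj min.coboundedI1 min.coboundedI2 order_refl zero_less_one simp_thms)
  have "norm (f A * g A - f B * g B - (L (A - B) * g a + f a * M (A - B))) \<le> \<eta> * norm (A - B)"
    if "A \<in> cball a r" "B \<in> cball a r" for A B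
  proof -
    define d where "d = norm (A - B)"
    have d: "d \<ge> 0" by (simp add: d_def)
    have A: "norm (g A - g a) \<le> H * r"
      using that r H(1,2) by (intro order_trans[OF H(4)] mult_left_mono) (auto simp: dist_norm norm_minus_commute)
    have B: "norm (f B - f a) \<le> K * r"
      using that r K(1,2) by (intro order_trans[OF K(4)] mult_left_mono) (auto simp: dist_norm norm_minus_commute)
    have gA: "norm (g A) \<le> C"
      using norm_triangle_sub[of "g A" "g a"] A mult_left_mono[OF r(6) H(1)] K(1) norm_ge_zero[of "f a"]
      unfolding C_def by linarith
    have fB: "norm (f B) \<le> C"
      using norm_triangle_sub[of "f B" "f a"] B mult_left_mono[OF r(6) K(1)] H(1) norm_ge_zero[of "g a"]
      unfolding C_def by linarith
    have KC: "K \<le> C" "H \<le> C" using K(1) H(1) by (auto simp: C_def)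
    have C2: "C * C * r \<le> \<eta> / 4" using r(7) C by (simp add: field_simps power2_eq_square)
    have t1: "norm ((f A - f B - L (A - B)) * g A) \<le> \<eta> / (4 * C) * d * C"
      using r3(2)[of A B] that r \<eta> C gA by (intro order_trans[OF norm_mult_ineq] mult_mono) (auto simp: d_def)
    have t2: "norm (f B * (g A - g B - M (A - B))) \<le> C * (\<eta> / (4 * C) * d)"
      using r4(2)[of A B] that r \<eta> C fB by (intro order_trans[OF norm_mult_ineq] mult_mono) (auto simp: d_def)
    have t3: "norm (L (A - B) * (g A - g a)) \<le> (C * d) * (C * r)"
    proof (intro order_trans[OF norm_mult_ineq] mult_mono)
      show "norm (L (A - B)) \<le> C * d" using K(3)[of "A - B"] mult_right_mono[OF KC(1) d] by (simp add: d_def)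
      show "norm (g A - g a) \<le> C * r" using A mult_right_mono[OF KC(2) less_imp_le[OF r(1)]] by simp
    qed (use C d in auto)
    have t4: "norm ((f B - f a) * M (A - B)) \<le> (C * r) * (C * d)"
    proof (intro order_trans[OF norm_mult_ineq] mult_mono)
      show "norm (M (A - B)) \<le> C * d" using H(3)[of "A - B"] mult_right_mono[OF KC(2) d] by (simp add: d_def)
      show "norm (f B - f a) \<le> C * r" using B mult_right_mono[OF KC(1) less_imp_le[OF r(1)]] by simp
    qed (use C r in auto)
    have "f A * g A - f B * g B - (L (A - B) * g a + f a * M (A - B)) =
      (f A - f B - L (A - B)) * g A + f B * (g A - g B - M (A - B))
      + L (A - B) * (g A - g a) + (f B - f a) * M (A - B)" by (simp add: algebra_simps)
    also have "norm \<dots> \<le> \<eta> / (4 * C) * d * C + C * (\<eta> / (4 * C) * d) + (C * d) * (C * r) + (C * r) * (C * d)"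
      by (intro norm_triangle_mono t1 t2 t3 t4)
    also have "\<dots> = \<eta> / 2 * d + 2 * (C * C * r) * d" using C by (simp add: algebra_simps)
    also have "\<dots> \<le> \<eta> / 2 * d + 2 * (\<eta> / 4) * d"
      using C2 d by (intro add_left_mono mult_right_mono mult_left_mono) auto
    finally show ?thesis by (simp add: d_def)
  qed
  then show "\<exists>r>0. \<forall>A\<in>cball a r. \<forall>B\<in>cball a r.
      norm (f A * g A - f B * g B - (L (A - B) * g a + f a * M (A - B))) \<le> \<eta> * norm (A - B)"
    using r(1) by blast
qed

text \<open>The algebras below have no unit, so powers start with exponent one:
  \<open>power_Suc_of n x\<close> is \<open>x\<^sup>n\<^sup>+\<^sup>1\<close>.\<close>

primrec power_Suc_of :: "nat \<Rightarrow> 'a::semigroup_mult \<Rightarrow> 'a" where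
  "power_Suc_of 0 x = x"
| "power_Suc_of (Suc n) x = x * power_Suc_of n x"

primrec power_Suc_deriv :: "nat \<Rightarrow> 'a::{real_normed_algebra,comm_ring} \<Rightarrow> 'a \<Rightarrow> 'a" where
  "power_Suc_deriv 0 a v = v"
| "power_Suc_deriv (Suc n) a v = real (n + 2) *\<^sub>R (power_Suc_of n a * v)"

lemma strict_deriv_power_Suc:
  assumes D: "bounded_linear D"
  shows "strict_deriv (\<lambda>x. power_Suc_of n (D x)) (\<lambda>v. power_Suc_deriv n (D a) (D v)) a"
proof (induction n)
  case 0
  show ?case using strict_deriv_linear[OF D] by simp
next
  case (Suc n)
  have "D v * power_Suc_of n (D a) + D a * power_Suc_deriv n (D a) (D v) = power_Suc_deriv (Suc n) (D a) (D v)" for v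
  proof (cases n)
    case 0
    then show ?thesis by (simp add: scaleR_2 mult.commute)
  next
    case (Suc k)
    have "D v * power_Suc_of n (D a) + D a * power_Suc_deriv n (D a) (D v)
        = (1 + real (k + 2)) *\<^sub>R (power_Suc_of n (D a) * D v)"
      unfolding Suc scaleR_add_left by (simp add: mult_ac)
    then show ?thesis using Suc by simp
  qed
  then show ?case using strict_deriv_mult[OF strict_deriv_linear[OF D] Suc.IH] by simp
qed

lemma multiplicative_power_Suc:
  assumes "\<And>x y. h (x * y) = h x * h y"
  shows "h (power_Suc_of n x) = power_Suc_of n (h x)"
  by (induction n) (simp_all add: assms)

section \<open>A preconditioned contraction\<close>

text \<open>The equation splits into a rest part \<open>V = S (- \<theta> M V - R (N V))\<close>, where \<open>S\<close> carries the small parameter,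
and a main part \<open>\<theta> V + N V = 0\<close> under \<open>P\<close>. A step first replaces the rest of \<open>V\<close> by the right-hand side and then
corrects the main part with the approximate inverse \<open>K\<close>. The order matters: \<open>N\<close> couples the main part to
the rest with a constant that is not small, but the rest enters only after it has been multiplied
by \<open>S\<close>. \<open>S\<close> is an operator, so that the small parameter may be a number or a power series.\<close>

definition rest_part where
  "rest_part M R N \<theta> S V = S (- \<theta> *\<^sub>R M V - R (N V))"

definition newton_step where
  "newton_step M R P K N \<theta> S V =
    (let W = P V + rest_part M R N \<theta> S V in W - K (\<theta> *\<^sub>R W + N W))"

text \<open>The maps \<open>F \<theta> S\<close> are symmetrized by \<open>E\<close>; both their contraction property and the distance of their fixed
points from \<open>a\<close> are controlled uniformly in the size \<open>\<sigma>\<close> of \<open>S\<close> and in \<open>\<theta>\<close>.\<close>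

definition uniform_contraction where
  "uniform_contraction F E a \<Omega> r \<sigma>0 C \<longleftrightarrow> (\<forall>\<sigma> \<theta> S.
    bounded_linear S \<and> (\<forall>x. norm (S x) \<le> \<sigma> * norm x) \<and> 0 \<le> \<sigma> \<and> \<sigma> \<le> \<sigma>0 \<and> \<bar>\<theta> - \<Omega>\<bar> \<le> \<sigma>0 \<longrightarrow>
    (\<forall>A\<in>cball a r. \<forall>B\<in>cball a r. norm (F \<theta> S (E A) - F \<theta> S (E B)) \<le> 1/2 * norm (A - B)) \<and>
    norm (F \<theta> S a - a) \<le> C * (\<sigma> + \<bar>\<theta> - \<Omega>\<bar>))"

lemma uniform_contractionD:
  assumes "uniform_contraction F E a \<Omega> r \<sigma>0 C" "bounded_linear S" "\<And>x. norm (S x) \<le> \<sigma> * norm x"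
    "0 \<le> \<sigma>" "\<sigma> \<le> \<sigma>0" "\<bar>\<theta> - \<Omega>\<bar> \<le> \<sigma>0"
  shows "\<And>A B. A \<in> cball a r \<Longrightarrow> B \<in> cball a r \<Longrightarrow> norm (F \<theta> S (E A) - F \<theta> S (E B)) \<le> 1/2 * norm (A - B)"
    and "norm (F \<theta> S a - a) \<le> C * (\<sigma> + \<bar>\<theta> - \<Omega>\<bar>)"
  using assms unfolding uniform_contraction_def by blast+

text \<open>With \<open>W\<close> the updated rest plus \<open>P V\<close>, differences of \<open>W\<close> are the difference \<open>v\<close> of main parts plus a term of
size \<open>\<sigma>\<close>. On \<open>v\<close> the correction with \<open>K\<close> cancels the linear part by \<open>inverse\<close>; what remains is of size
\<open>\<sigma> + \<bar>\<theta> - \<Omega>\<bar>\<close>, or a small multiple of \<open>v\<close> by strict differentiability. The symmetrization \<open>E\<close> is present because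
the inverse exists on even families only: time translations of a solution make the full
linearization degenerate.\<close>

lemma newton_step_contraction:
  fixes N L :: "'b::real_normed_vector \<Rightarrow> 'b"
  assumes M: "bounded_linear M" and R: "bounded_linear R" and K: "bounded_linear K"
    and P: "bounded_linear P" "\<And>x. norm (P x) \<le> norm x" "P a = a"
    and E: "bounded_linear E" "\<And>x. norm (E x) \<le> norm x" "E a = a"
    and N: "strict_deriv N L a"
    and inverse: "\<And>x. K (\<Omega> *\<^sub>R P (E x) + L (P (E x))) = P (E x)"
    and base: "K (\<Omega> *\<^sub>R a + N a) = 0"
  obtains r0 where "r0 > 0" "\<And>r. 0 < r \<Longrightarrow> r \<le> r0 \<Longrightarrow> \<exists>\<sigma>0>0. \<exists>C\<ge>0.
    uniform_contraction (newton_step M R P K N) E a \<Omega> r \<sigma>0 C"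
proof -
  interpret M: bounded_linear M by (rule M)
  interpret R: bounded_linear R by (rule R)
  interpret K: bounded_linear K by (rule K)
  interpret P: bounded_linear P by (rule P(1))
  interpret E: bounded_linear E by (rule E(1))
  have L: "bounded_linear L" using N by (simp add: strict_deriv_def)
  interpret L: bounded_linear L by (rule L)
  obtain m where m: "m \<ge> 0" "\<And>x. norm (M x) \<le> m * norm x" using bounded_linear_bound[OF M] by blast
  obtain rr where rr: "rr \<ge> 0" "\<And>x. norm (R x) \<le> rr * norm x" using bounded_linear_bound[OF R] by blast
  obtain k where k: "k \<ge> 0" "\<And>x. norm (K x) \<le> k * norm x" using bounded_linear_bound[OF K] by blast
  obtain l s where l: "l \<ge> 0" "s > 0" "\<And>v. norm (L v) \<le> l * norm v"
    "\<And>A B. A \<in> cball a s \<Longrightarrow> B \<in> cball a s \<Longrightarrow> norm (N A - N B) \<le> l * norm (A - B)"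
    using strict_deriv_lipschitz[OF N] by blast
  define c where "c = m + rr + k + l + \<bar>\<Omega>\<bar> + 1 + norm a + norm (N a)"
  have c: "c \<ge> 1" "m \<le> c" "rr \<le> c" "k \<le> c" "l \<le> c" "\<bar>\<Omega>\<bar> + 1 \<le> c" "norm a \<le> c" "norm (N a) \<le> c"
    using m rr k l by (auto simp: c_def)
  have le_c: "y \<le> c * norm x" if "y \<le> z * norm x" "z \<le> c" for x :: 'b and y z
    using that mult_right_mono[OF that(2) norm_ge_zero[of x]] by linarith
  note Mc = le_c[OF m(2) c(2)] and Rc = le_c[OF rr(2) c(3)] and Kc = le_c[OF k(2) c(4)] and Lc = le_c[OF l(3) c(5)]
  have Nc: "norm (N A - N B) \<le> c * norm (A - B)" if "A \<in> cball a s" "B \<in> cball a s" for A B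
    by (rule le_c[OF l(4)[OF that] c(5)])
  obtain t where t: "t > 0" "\<And>A B. A \<in> cball a t \<Longrightarrow> B \<in> cball a t \<Longrightarrow>
      norm (N A - N B - L (A - B)) \<le> 1 / (16 * c) * norm (A - B)"
    using strict_derivD[OF N, of "1 / (16 * c)"] c(1) by auto
  define r0 where "r0 = min 1 (min (s / 2) (t / 2))"
  have r0: "r0 > 0" "r0 \<le> 1" "2 * r0 \<le> s" "2 * r0 \<le> t" using l(2) t(1) by (auto simp: r0_def)
  show ?thesis
  proof (rule that[OF r0(1)])
    fix r assume r: "0 < r" "r \<le> r0"
    \<comment> \<open>One constant \<open>c\<close> bounds all operators, and \<open>\<sigma>\<close> occurs with at most five factors \<open>c\<close>; this choice
    bounds every such product by a hundredth of \<open>r\<close>.\<close>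
    define \<sigma>0 where "\<sigma>0 = r / (100 * c ^ 5)"
    have \<sigma>0: "\<sigma>0 > 0" "\<sigma>0 * c ^ 5 = r / 100" using r c(1) by (auto simp: \<sigma>0_def)
    have main: "(\<forall>A\<in>cball a r. \<forall>B\<in>cball a r.
      norm (newton_step M R P K N \<theta> S (E A) - newton_step M R P K N \<theta> S (E B)) \<le> 1/2 * norm (A - B)) \<and>
      norm (newton_step M R P K N \<theta> S a - a) \<le> 12 * c ^ 5 * (\<sigma> + \<bar>\<theta> - \<Omega>\<bar>)"
      if S: "bounded_linear S" and Sb: "\<And>x. norm (S x) \<le> \<sigma> * norm x"
        and \<sigma>: "0 \<le> \<sigma>" "\<sigma> \<le> \<sigma>0" and \<theta>: "\<bar>\<theta> - \<Omega>\<bar> \<le> \<sigma>0" for \<sigma> \<theta> S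
    proof -
      interpret S: bounded_linear S by (rule S)
      have pw: "c ^ i \<le> c ^ 5" if "i \<le> 5" for i using c(1) that by (rule power_increasing[rotated])
      have \<sigma>c: "\<sigma> * c ^ i \<le> r / 100" if "i \<le> 5" for i
        using mult_mono[OF \<sigma>(2) pw[OF that]] \<sigma>0 \<sigma> c(1) by simp
      have \<theta>c: "\<bar>\<theta> - \<Omega>\<bar> * c ^ i \<le> r / 100" if "i \<le> 5" for i
        using mult_mono[OF \<theta> pw[OF that]] \<sigma>0 c(1) by simp
      have r1: "r \<le> 1" "2 * r \<le> s" "2 * r \<le> t" using r r0 by auto
      have "\<bar>\<theta> - \<Omega>\<bar> \<le> 1" using \<theta>c[of 0] r1(1) by simp
      then have absth: "\<bar>\<theta>\<bar> \<le> c" using c(6) by arith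
      define q where "q = rest_part M R N \<theta> S"
      define W where "W V = P V + q V" for V
      define T where "T = newton_step M R P K N \<theta> S"
      have step: "T V = W V - K (\<theta> *\<^sub>R W V + N (W V))" for V
        by (simp add: T_def newton_step_def W_def q_def Let_def)
      have \<theta>sc: "norm (\<theta> *\<^sub>R x) \<le> c * norm x" for x
        using mult_right_mono[OF absth norm_ge_zero[of x]] by simp
      have qb: "norm (q V) \<le> 4 * (\<sigma> * c ^ 3)" if "V \<in> cball a r" for V
      proof -
        have V: "norm V \<le> 2 * c" using norm_triangle_ineq[of "V - a" a] that c r1
          by (simp add: dist_norm norm_minus_commute)
        have "norm (N V - N a) \<le> c * norm (V - a)" using that r1 r by (intro Nc) auto
        also have "\<dots> \<le> c * 1" using that r1 c by (intro mult_left_mono) (auto simp: dist_norm norm_minus_commute)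
        finally have NV: "norm (N V) \<le> 2 * c" using norm_triangle_ineq[of "N V - N a" "N a"] c by simp
        have "norm (- \<theta> *\<^sub>R M V - R (N V)) \<le> norm (\<theta> *\<^sub>R M V) + norm (R (N V))"
          by (metis norm_minus_cancel norm_triangle_ineq4 scaleR_minus_left)
        also have "\<dots> \<le> c * (c * (2 * c)) + c * (2 * c)"
        proof (rule add_mono)
          have c0: "0 \<le> c" using c(1) by simp
          show "norm (\<theta> *\<^sub>R M V) \<le> c * (c * (2 * c))"
            by (rule order_trans[OF \<theta>sc[of "M V"] mult_left_mono[OF order_trans[OF Mc mult_left_mono[OF V c0]] c0]])
          show "norm (R (N V)) \<le> c * (2 * c)"
            by (rule order_trans[OF Rc mult_left_mono[OF NV c0]])
        qed
        also have "\<dots> \<le> 4 * c ^ 3" using power_increasing[of 2 3 c] c(1) by (simp add: power2_eq_square power3_eq_cube)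
        finally have "\<sigma> * norm (- \<theta> *\<^sub>R M V - R (N V)) \<le> \<sigma> * (4 * c ^ 3)" using \<sigma>(1) by (rule mult_left_mono)
        then show ?thesis unfolding q_def rest_part_def using Sb[of "- \<theta> *\<^sub>R M V - R (N V)"] by simp
      qed
      have dq: "norm (q U - q V) \<le> 2 * (\<sigma> * c ^ 2) * norm (U - V)" if "U \<in> cball a r" "V \<in> cball a r" for U V
      proof -
        have "q U - q V = S (- (\<theta> *\<^sub>R M (U - V)) - R (N U - N V))"
          unfolding q_def rest_part_def S.diff[symmetric] by (simp add: M.diff R.diff algebra_simps)
        then have 1: "norm (q U - q V) \<le> \<sigma> * norm (- (\<theta> *\<^sub>R M (U - V)) - R (N U - N V))" using Sb by simp
        have "norm (- (\<theta> *\<^sub>R M (U - V)) - R (N U - N V)) \<le> norm (\<theta> *\<^sub>R M (U - V)) + norm (R (N U - N V))"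
          by (metis norm_minus_cancel norm_triangle_ineq4)
        also have "\<dots> \<le> c * (c * norm (U - V)) + c * (c * norm (U - V))"
        proof (rule add_mono)
          have c0: "0 \<le> c" using c(1) by simp
          show "norm (\<theta> *\<^sub>R M (U - V)) \<le> c * (c * norm (U - V))"
            by (rule order_trans[OF \<theta>sc[of "M (U - V)"] mult_left_mono[OF Mc c0]])
          have "norm (N U - N V) \<le> c * norm (U - V)" using that r1 r by (intro Nc) auto
          then show "norm (R (N U - N V)) \<le> c * (c * norm (U - V))"
            by (rule order_trans[OF Rc mult_left_mono[OF _ c0]])
        qed
        finally have "norm (- (\<theta> *\<^sub>R M (U - V)) - R (N U - N V)) \<le> 2 * (c * (c * norm (U - V)))" by simp
        from order_trans[OF 1 mult_left_mono[OF this \<sigma>(1)]]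
        show ?thesis by (simp add: power2_eq_square mult_ac)
      qed
      have Ein: "E A \<in> cball a r" if "A \<in> cball a r" for A
        using that E(2)[of "A - a"] E(3) by (simp add: dist_norm norm_minus_commute E.diff)
      have Wball: "W V \<in> cball a (2 * r)" if "V \<in> cball a r" for V
      proof -
        have "W V - a = P (V - a) + q V" by (simp add: W_def P.diff P(3))
        then have "norm (W V - a) \<le> norm (V - a) + 4 * (\<sigma> * c ^ 3)"
          using norm_triangle_ineq[of "P (V - a)" "q V"] P(2)[of "V - a"] qb[OF that] by simp
        moreover have "norm (V - a) \<le> r" using that by (simp add: dist_norm norm_minus_commute)
        ultimately have "norm (W V - a) \<le> 2 * r" using \<sigma>c[of 3] r(1) by simp
        then show ?thesis by (simp add: dist_norm norm_minus_commute)
      qed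
      have contr: "norm (T (E A) - T (E B)) \<le> 1/2 * norm (A - B)"
        if A: "A \<in> cball a r" and B: "B \<in> cball a r" for A B
      proof -
        define \<delta> where "\<delta> = norm (A - B)"
        have \<delta>: "\<delta> \<ge> 0" by (simp add: \<delta>_def)
        define v where "v = P (E (A - B))"
        define x where "x = q (E A) - q (E B)"
        have v: "norm v \<le> \<delta>" unfolding v_def \<delta>_def using P(2) E(2) order_trans by blast
        have EAB: "norm (E A - E B) \<le> \<delta>" using E(2)[of "A - B"] by (simp add: \<delta>_def E.diff)
        have x: "norm x \<le> 2 * (\<sigma> * c ^ 2) * \<delta>"
          using dq[OF Ein[OF A] Ein[OF B]] mult_left_mono[OF EAB, of "2 * (\<sigma> * c ^ 2)"] \<sigma>(1) by (simp add: x_def)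
        have small: "\<sigma> * c ^ 2 \<le> 1 / 100" "\<sigma> * c ^ 4 \<le> 1 / 100" "\<bar>\<theta> - \<Omega>\<bar> * c \<le> 1 / 100"
          using \<sigma>c[of 2] \<sigma>c[of 4] \<theta>c[of 1] r1 by auto
        have dW: "W (E A) - W (E B) = v + x" by (simp add: W_def v_def x_def P.diff E.diff)
        have vx: "norm (v + x) \<le> 2 * \<delta>"
          using norm_triangle_ineq[of v x] v x mult_right_mono[OF small(1) \<delta>] \<delta> by linarith
        define e where "e = N (W (E A)) - N (W (E B)) - L (v + x)"
        have e: "norm e \<le> 1 / (16 * c) * (2 * \<delta>)"
        proof -
          have "norm e \<le> 1 / (16 * c) * norm (v + x)"
            unfolding e_def dW[symmetric] using Wball[OF Ein[OF A]] Wball[OF Ein[OF B]] r1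
            by (intro t(2)) auto
          also have "\<dots> \<le> 1 / (16 * c) * (2 * \<delta>)" using vx c(1) by (intro mult_left_mono) auto
          finally show ?thesis .
        qed
        have "T (E A) - T (E B)
          = (v + x) - K (\<theta> *\<^sub>R (v + x) + (e + L (v + x)))"
        proof -
          have "T (E A) - T (E B)
            = (W (E A) - W (E B)) - K (\<theta> *\<^sub>R (W (E A) - W (E B)) + (N (W (E A)) - N (W (E B))))"
            unfolding step by (simp add: K.diff K.add K.scale algebra_simps)
          then show ?thesis unfolding dW by (simp add: e_def)
        qed
        also have "\<dots> = x - K ((\<theta> - \<Omega>) *\<^sub>R v + \<theta> *\<^sub>R x + L x + e)"
        proof -
          have "\<theta> *\<^sub>R (v + x) + (e + L (v + x)) =
              (\<Omega> *\<^sub>R v + L v) + ((\<theta> - \<Omega>) *\<^sub>R v + \<theta> *\<^sub>R x + L x + e)"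
            by (simp add: L.add algebra_simps)
          then show ?thesis
            using inverse[of "A - B"] unfolding v_def[symmetric] by (simp only: K.add) simp
        qed
        also have "norm \<dots> \<le> norm x + c * (\<bar>\<theta> - \<Omega>\<bar> * \<delta> + c * norm x + c * norm x + norm e)"
        proof -
          have "norm ((\<theta> - \<Omega>) *\<^sub>R v + \<theta> *\<^sub>R x + L x + e) \<le> \<bar>\<theta> - \<Omega>\<bar> * \<delta> + c * norm x + c * norm x + norm e"
            using v by (intro norm_triangle_mono \<theta>sc Lc order_refl) (auto intro: mult_left_mono)
          then have "norm (K ((\<theta> - \<Omega>) *\<^sub>R v + \<theta> *\<^sub>R x + L x + e)) \<le> c * (\<bar>\<theta> - \<Omega>\<bar> * \<delta> + c * norm x + c * norm x + norm e)"
            using c(1) by (intro order_trans[OF Kc] mult_left_mono) auto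
          then show ?thesis using norm_triangle_ineq4 order_trans add_left_mono by meson
        qed
        also have "\<dots> = norm x + (\<bar>\<theta> - \<Omega>\<bar> * c) * \<delta> + 2 * c ^ 2 * norm x + c * norm e"
          by (simp add: algebra_simps power2_eq_square)
        also have "\<dots> \<le> 2 * (1/100) * \<delta> + (1/100) * \<delta> + 4 * (1/100) * \<delta> + \<delta> / 8"
        proof (intro add_mono)
          show "norm x \<le> 2 * (1/100) * \<delta>" using x mult_right_mono[OF small(1) \<delta>] by linarith
          show "\<bar>\<theta> - \<Omega>\<bar> * c * \<delta> \<le> (1/100) * \<delta>" by (rule mult_right_mono[OF small(3) \<delta>])
          have "2 * c ^ 2 * norm x \<le> 2 * c ^ 2 * (2 * (\<sigma> * c ^ 2) * \<delta>)" using x by (rule mult_left_mono) simp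
          also have "\<dots> = 4 * (\<sigma> * c ^ 4) * \<delta>" by (simp add: algebra_simps flip: power_add)
          also have "\<dots> \<le> 4 * (1/100) * \<delta>" using small(2) \<delta> by (intro mult_right_mono mult_left_mono) auto
          finally show "2 * c ^ 2 * norm x \<le> 4 * (1/100) * \<delta>" .
          have "c * norm e \<le> c * (1 / (16 * c) * (2 * \<delta>))" using e c(1) by (intro mult_left_mono) auto
          then show "c * norm e \<le> \<delta> / 8" using c(1) by simp
        qed
        also have "\<dots> \<le> 1/2 * \<delta>" using \<delta> by simp
        finally show ?thesis by (simp add: \<delta>_def)
      qed
      have base_est: "norm (T a - a) \<le> 12 * c ^ 5 * (\<sigma> + \<bar>\<theta> - \<Omega>\<bar>)"
      proof -
        have a_in: "a \<in> cball a r" using r by simp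
        have Wa: "W a = a + q a" by (simp add: W_def P(3))
        have "T a - a = q a - K (\<theta> *\<^sub>R (a + q a) + N (W a))"
          unfolding step Wa by simp
        also have "\<dots> = q a - (K (\<theta> *\<^sub>R (a + q a) + N (W a)) - K (\<Omega> *\<^sub>R a + N a))"
          by (simp add: base)
        also have "\<dots> = q a - K ((\<theta> - \<Omega>) *\<^sub>R a + \<theta> *\<^sub>R q a + (N (W a) - N a))"
          unfolding K.diff[symmetric] by (simp add: algebra_simps)
        also have "norm \<dots> \<le> norm (q a) + c * (\<bar>\<theta> - \<Omega>\<bar> * c + c * norm (q a) + c * norm (q a))"
        proof -
          have "norm (N (W a) - N a) \<le> c * norm (W a - a)"
            using Wball[OF a_in] r1 r by (intro Nc) auto
          then have "norm ((\<theta> - \<Omega>) *\<^sub>R a + \<theta> *\<^sub>R q a + (N (W a) - N a)) \<le> \<bar>\<theta> - \<Omega>\<bar> * c + c * norm (q a) + c * norm (q a)"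
            using c(7) by (intro norm_triangle_mono \<theta>sc) (auto intro: mult_left_mono simp: Wa)
          then have "norm (K ((\<theta> - \<Omega>) *\<^sub>R a + \<theta> *\<^sub>R q a + (N (W a) - N a))) \<le> c * (\<bar>\<theta> - \<Omega>\<bar> * c + c * norm (q a) + c * norm (q a))"
            using c(1) by (intro order_trans[OF Kc] mult_left_mono) auto
          then show ?thesis using norm_triangle_ineq4 order_trans add_left_mono by meson
        qed
        also have "\<dots> = norm (q a) + c ^ 2 * \<bar>\<theta> - \<Omega>\<bar> + 2 * c ^ 2 * norm (q a)"
          by (simp add: algebra_simps power2_eq_square)
        also have "\<dots> \<le> 4 * (\<sigma> * c ^ 3) + c ^ 2 * \<bar>\<theta> - \<Omega>\<bar> + 2 * c ^ 2 * (4 * (\<sigma> * c ^ 3))"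
          using qb[OF a_in] by (intro add_mono mult_left_mono) auto
        also have "\<dots> = 4 * \<sigma> * c ^ 3 + c ^ 2 * \<bar>\<theta> - \<Omega>\<bar> + 8 * \<sigma> * c ^ 5"
          by (simp add: algebra_simps flip: power_add)
        also have "\<dots> \<le> 4 * \<sigma> * c ^ 5 + c ^ 5 * \<bar>\<theta> - \<Omega>\<bar> + 8 * \<sigma> * c ^ 5"
          using \<sigma>(1) by (intro add_mono mult_left_mono mult_right_mono pw) auto
        also have "\<dots> \<le> 12 * c ^ 5 * (\<sigma> + \<bar>\<theta> - \<Omega>\<bar>)"
          using mult_nonneg_nonneg[of "c ^ 5" "\<bar>\<theta> - \<Omega>\<bar>"] c(1) by (simp add: algebra_simps)
        finally show ?thesis .
      qed
      from contr base_est show ?thesis unfolding T_def by blast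
    qed
    have "uniform_contraction (newton_step M R P K N) E a \<Omega> r \<sigma>0 (12 * c ^ 5)"
      unfolding uniform_contraction_def by (intro allI impI, elim conjE, rule main) auto
    then show "\<exists>\<sigma>0>0. \<exists>C\<ge>0. uniform_contraction (newton_step M R P K N) E a \<Omega> r \<sigma>0 C"
      using \<sigma>0(1) c(1) by (intro exI[of _ \<sigma>0] conjI exI[of _ "12 * c ^ 5"]) auto
  qed
qed

section \<open>Operators on summable families\<close>

definition l1_map :: "('m \<Rightarrow> 'a::banach \<Rightarrow> 'b::banach) \<Rightarrow> ('m, 'a) l1 \<Rightarrow> ('m, 'b) l1"
  where "l1_map \<phi> = l1_ext (\<lambda>m x. single m (\<phi> m x))"

lemma bounded_family_single:
  assumes "bounded_family C \<phi>"
  shows "bounded_family C (\<lambda>m x. single (h m) (\<phi> m x))"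
proof (rule bounded_familyI)
  show "linear (\<lambda>x. single (h m) (\<phi> m x))" for m
    using assms linear_compose[OF _ linear_single, of "\<phi> m" "h m"]
    by (simp add: bounded_family_def o_def)
qed (use assms in \<open>simp add: bounded_family_def\<close>)

lemma bounded_family_bounded_linear:
  assumes "bounded_family C (\<phi> :: 'm \<Rightarrow> 'a::banach \<Rightarrow> 'b::banach)"
  shows "bounded_linear (\<phi> m)"
proof -
  have "linear (\<phi> m)" "\<And>x. norm (\<phi> m x) \<le> norm x * C"
    using assms by (auto simp: bounded_family_def mult.commute)
  then show ?thesis by (auto simp: bounded_linear_def bounded_linear_axioms_def)
qed

lemma bounded_family_const:
  assumes "bounded_linear f"
  obtains C where "bounded_family C (\<lambda>m. f)"
proof -
  obtain C where "\<And>x. norm (f x) \<le> C * norm x" using bounded_linear_bound[OF assms] by blast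
  then have "bounded_family C (\<lambda>m. f)" by (intro bounded_familyI bounded_linear.linear[OF assms])
  then show ?thesis by (rule that)
qed

lemma
  assumes "bounded_family C \<phi>"
  shows bounded_linear_l1_map: "bounded_linear (l1_map \<phi>)"
    and l1_map_bound: "norm (l1_map \<phi> f) \<le> C * norm f"
    and l1_map_single: "l1_map \<phi> (single m x) = single m (\<phi> m x)"
    and coeff_l1_map: "coeff (l1_map \<phi> f) m = \<phi> m (coeff f m)"
proof -
  note bf = bounded_family_single[OF assms, of "\<lambda>m. m"]
  show bl: "bounded_linear (l1_map \<phi>)"
    unfolding l1_map_def by (rule bounded_linear_l1_ext[OF bf])
  show "norm (l1_map \<phi> f) \<le> C * norm f"
    unfolding l1_map_def by (rule l1_ext_bound[OF bf])
  show single: "l1_map \<phi> (single m x) = single m (\<phi> m x)" for m x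
    unfolding l1_map_def by (rule l1_ext_single[OF bf])
  note \<phi> = bounded_family_bounded_linear[OF assms, of m]
  show "coeff (l1_map \<phi> f) m = \<phi> m (coeff f m)"
  proof (rule l1_bounded_linear_eqI[of "\<lambda>f. coeff (l1_map \<phi> f) m" "\<lambda>f. \<phi> m (coeff f m)"])
    show "bounded_linear (\<lambda>f. coeff (l1_map \<phi> f) m)"
      by (rule bounded_linear_compose[OF bounded_linear_coeff bl])
    show "bounded_linear (\<lambda>f. \<phi> m (coeff f m))"
      by (rule bounded_linear_compose[OF \<phi> bounded_linear_coeff])
    show "coeff (l1_map \<phi> (single k x)) m = \<phi> m (coeff (single k x) m)" for k x
      using linear_0[OF bounded_linear.linear[OF \<phi>]] by (simp add: single coeff_single)
  qed
qed

definition l1_lift :: "('a::banach \<Rightarrow> 'b::banach) \<Rightarrow> ('m, 'a) l1 \<Rightarrow> ('m, 'b) l1"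
  where "l1_lift f = l1_map (\<lambda>m. f)"

lemma bounded_linear_l1_lift:
  assumes "bounded_linear (f :: 'a::banach \<Rightarrow> 'b::banach)"
  shows "bounded_linear (l1_lift f :: ('m, 'a) l1 \<Rightarrow> ('m, 'b) l1)"
proof -
  obtain C where C: "bounded_family C (\<lambda>m::'m. f)" using bounded_family_const[OF assms] by blast
  show ?thesis unfolding l1_lift_def by (rule bounded_linear_l1_map[OF C])
qed

lemma l1_lift_single:
  fixes m :: 'm
  assumes "bounded_linear f"
  shows "l1_lift f (single m x) = single m (f x)"
proof -
  obtain C where C: "bounded_family C (\<lambda>m::'m. f)" using bounded_family_const[OF assms] by blast
  show ?thesis unfolding l1_lift_def by (rule l1_map_single[OF C])
qed

lemma coeff_l1_lift:
  fixes m :: 'm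
  assumes "bounded_linear f"
  shows "coeff (l1_lift f g) m = f (coeff g m)"
proof -
  obtain C where C: "bounded_family C (\<lambda>m::'m. f)" using bounded_family_const[OF assms] by blast
  show ?thesis unfolding l1_lift_def by (rule coeff_l1_map[OF C])
qed

lemma l1_lift_nonexpansive:
  assumes "bounded_linear f" "\<And>x. norm (f x) \<le> norm x"
  shows "norm (l1_lift f g) \<le> norm g"
proof -
  have "bounded_family 1 (\<lambda>m. f)"
    using assms by (intro bounded_familyI bounded_linear.linear) auto
  from l1_map_bound[OF this] show ?thesis by (simp add: l1_lift_def)
qed

definition diag :: "('m \<Rightarrow> real) \<Rightarrow> ('m, 'a::banach) l1 \<Rightarrow> ('m, 'a) l1"
  where "diag \<mu> = l1_map (\<lambda>m x. \<mu> m *\<^sub>R x)"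

lemma bounded_family_diag:
  assumes "\<And>m. \<bar>\<mu> m\<bar> \<le> C"
  shows "bounded_family C (\<lambda>m (x :: 'a :: banach). \<mu> m *\<^sub>R x)"
proof (rule bounded_familyI)
  show "linear (\<lambda>x::'a. \<mu> m *\<^sub>R x)" for m by (rule linear_scale_self)
  show "norm (\<mu> m *\<^sub>R x) \<le> C * norm x" for m and x :: 'a
    using mult_right_mono[OF assms[of m] norm_ge_zero[of x]] by simp
qed

lemmas bounded_linear_diag = bounded_linear_l1_map[OF bounded_family_diag, folded diag_def]
  and diag_bound = l1_map_bound[OF bounded_family_diag, folded diag_def]
  and coeff_diag = coeff_l1_map[OF bounded_family_diag, folded diag_def]

lemma bounded_family_ident: "bounded_family 1 (\<lambda>m x. x)"
  by (rule bounded_familyI) (auto intro: linear_ident)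

definition reflect :: "('m::ab_group_add, 'a::banach) l1 \<Rightarrow> ('m, 'a) l1"
  where "reflect = l1_ext (\<lambda>m x. single (- m) x)"

lemma bounded_linear_reflect: "bounded_linear reflect"
  unfolding reflect_def by (rule bounded_linear_l1_ext[OF bounded_family_single[OF bounded_family_ident]])

lemma reflect_single: "reflect (single m x) = single (- m) x"
  unfolding reflect_def by (rule l1_ext_single[OF bounded_family_single[OF bounded_family_ident]])

lemma norm_reflect_le: "norm (reflect f) \<le> norm f"
  using l1_ext_bound[OF bounded_family_single[OF bounded_family_ident], of uminus f]
  by (simp add: reflect_def)

lemma coeff_reflect: "coeff (reflect f) m = coeff f (- m)"
  by (rule l1_bounded_linear_eqI[of "\<lambda>f. coeff (reflect f) m" "\<lambda>f. coeff f (- m)"])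
     (auto intro: bounded_linear_compose[OF bounded_linear_coeff bounded_linear_reflect] bounded_linear_coeff
       simp: reflect_single coeff_single)

lemma reflect_mult:
  fixes f g :: "('m::ab_group_add, 'a::{real_normed_algebra,comm_ring,banach}) l1"
  shows "reflect (f * g) = reflect f * reflect g"
  by (rule l1_multiplicativeI[OF bounded_linear_reflect]) (simp add: reflect_single single_mult_single)

text \<open>Even functions of time are the families fixed by \<open>reflect\<close>, and \<open>even_part\<close> projects onto them.\<close>

definition even_part :: "('m::ab_group_add, 'a::banach) l1 \<Rightarrow> ('m, 'a) l1"
  where "even_part f = (1/2) *\<^sub>R (f + reflect f)"

lemma bounded_linear_even_part: "bounded_linear even_part"
  unfolding even_part_def
  by (intro bounded_linear_compose[OF bounded_linear_scaleR_right] bounded_linear_add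
      bounded_linear_ident bounded_linear_reflect)

lemma norm_even_part_le: "norm (even_part f) \<le> norm f"
  using norm_triangle_ineq[of f "reflect f"] norm_reflect_le[of f] by (simp add: even_part_def)

lemma coeff_even_part: "coeff (even_part f) m = (1/2) *\<^sub>R (coeff f m + coeff f (- m))"
  by (simp add: even_part_def coeff_reflect)

lemma reflect_even_part: "reflect (even_part f) = even_part f"
  by (rule l1_eqI) (simp add: coeff_reflect coeff_even_part add.commute)

lemma even_part_id: "reflect f = f \<Longrightarrow> even_part f = f"
  by (simp add: even_part_def flip: scaleR_2)

lemma coeff_single_mult:
  fixes f :: "('m::ab_group_add, 'a::{real_normed_algebra,comm_ring,banach}) l1"
  shows "coeff (single l x * f) m = x * coeff f (m - l)"
proof (rule l1_bounded_linear_eqI[of "\<lambda>f. coeff (single l x * f) m" "\<lambda>f. x * coeff f (m - l)"])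
  show "bounded_linear (\<lambda>f. coeff (single l x * f) m)"
    by (rule bounded_linear_compose[OF bounded_linear_coeff bounded_linear_mult_right])
  show "bounded_linear (\<lambda>f. x * coeff f (m - l))"
    by (rule bounded_linear_compose[OF bounded_linear_mult_right bounded_linear_coeff])
  show "coeff (single l x * single k y) m = x * coeff (single k y) (m - l)" for k y
    by (auto simp: single_mult_single coeff_single)
qed

section \<open>Absolutely convergent power series\<close>

text \<open>A family \<open>f\<close> indexed by the natural numbers is read as the power series with coefficients \<open>f\<close>, which
converges absolutely for \<open>\<bar>s\<bar> \<le> 1\<close>. Evaluation at \<open>s\<close> is an algebra homomorphism and turns the shift into
multiplication by \<open>s\<close>.\<close>

definition ps_shift :: "(nat, 'a::banach) l1 \<Rightarrow> (nat, 'a) l1"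
  where "ps_shift = l1_ext (\<lambda>k x. single (Suc k) x)"

definition ps_eval :: "real \<Rightarrow> (nat, 'a::banach) l1 \<Rightarrow> 'a"
  where "ps_eval s = l1_ext (\<lambda>k x. s ^ k *\<^sub>R x)"

lemma bounded_linear_ps_shift: "bounded_linear ps_shift"
  unfolding ps_shift_def by (rule bounded_linear_l1_ext[OF bounded_family_single[OF bounded_family_ident]])

lemma ps_shift_single: "ps_shift (single m x) = single (Suc m) x"
  unfolding ps_shift_def by (rule l1_ext_single[OF bounded_family_single[OF bounded_family_ident]])

lemma norm_ps_shift_le: "norm (ps_shift f) \<le> norm f"
  using l1_ext_bound[OF bounded_family_single[OF bounded_family_ident], of Suc f]
  by (simp add: ps_shift_def)

lemma bounded_family_ps_eval:
  assumes "\<bar>s\<bar> \<le> 1"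
  shows "bounded_family 1 (\<lambda>k (x::'a::banach). s ^ k *\<^sub>R x)"
proof (rule bounded_familyI)
  show "linear (\<lambda>x::'a. s ^ k *\<^sub>R x)" for k by (rule linear_scale_self)
  show "norm (s ^ k *\<^sub>R x) \<le> 1 * norm x" for k and x :: 'a
    using assms by (simp add: power_abs power_le_one mult_left_le_one_le)
qed

context
  fixes s :: real
  assumes s: "\<bar>s\<bar> \<le> 1"
begin

lemma bounded_linear_ps_eval: "bounded_linear (ps_eval s)"
  unfolding ps_eval_def by (rule bounded_linear_l1_ext[OF bounded_family_ps_eval[OF s]])

lemma norm_ps_eval_le: "norm (ps_eval s f) \<le> norm f"
  using l1_ext_bound[OF bounded_family_ps_eval[OF s], of f] by (simp add: ps_eval_def)

lemma ps_eval_single: "ps_eval s (single k x) = s ^ k *\<^sub>R x"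
  unfolding ps_eval_def by (rule l1_ext_single[OF bounded_family_ps_eval[OF s]])

lemma ps_eval_sums: "(\<lambda>k. s ^ k *\<^sub>R coeff f k) sums ps_eval s f"
  unfolding ps_eval_def by (rule has_sum_imp_sums[OF l1_ext_has_sum[OF bounded_family_ps_eval[OF s]]])

lemma ps_eval_mult:
  fixes f g :: "(nat, 'a::{real_normed_algebra,comm_ring,banach}) l1"
  shows "ps_eval s (f * g) = ps_eval s f * ps_eval s g"
  by (rule l1_multiplicativeI[OF bounded_linear_ps_eval]) (simp add: ps_eval_single power_add)

lemma ps_eval_lift:
  assumes "bounded_linear h"
  shows "ps_eval s (l1_lift h f) = h (ps_eval s f)"
  by (rule l1_bounded_linear_eqI[of "\<lambda>f. ps_eval s (l1_lift h f)" "\<lambda>f. h (ps_eval s f)"])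
     (auto intro: bounded_linear_compose[OF bounded_linear_ps_eval bounded_linear_l1_lift[OF assms]]
       bounded_linear_compose[OF assms bounded_linear_ps_eval]
       simp: ps_eval_single l1_lift_single[OF assms] linear_scale[OF bounded_linear.linear[OF assms]])

lemma ps_eval_shift: "ps_eval s (ps_shift f) = s *\<^sub>R ps_eval s f"
  by (rule l1_bounded_linear_eqI[of "\<lambda>f. ps_eval s (ps_shift f)" "\<lambda>f. s *\<^sub>R ps_eval s f"])
     (auto intro: bounded_linear_compose[OF bounded_linear_ps_eval bounded_linear_ps_shift]
       bounded_linear_compose[OF bounded_linear_scaleR_right bounded_linear_ps_eval]
       simp: ps_eval_single ps_shift_single)

end

section \<open>Fourier series and Fourier coefficients\<close>

definition fourier_at :: "real \<Rightarrow> 'i \<Rightarrow> (int, 'i l2) l1 \<Rightarrow> complex"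
  where "fourier_at \<tau> n = l1_ext (\<lambda>m x. complex_of_real (l2_fun x n) * exp (\<i> * of_int m * of_real \<tau>))"

definition modes :: "(int, 'i l2) l1 \<Rightarrow> int \<Rightarrow> 'i \<Rightarrow> real"
  where "modes Z m n = l2_fun (coeff Z m) n"

lemma fourier_sum_modes: "fourier_sum (modes Z) \<tau> n = fourier_at \<tau> n Z"
  by (simp add: fourier_sum_def fourier_at_def l1_ext_def modes_def)

lemma norm_exp_mode: "norm (exp (\<i> * of_int m * of_real \<tau>)) = 1"
  using norm_exp_i_times[of "of_int m * \<tau>"] by (simp add: mult.assoc)

lemma bounded_family_fourier:
  "bounded_family 1 (\<lambda>m (x::'i l2). complex_of_real (l2_fun x n) * exp (\<i> * of_int m * of_real \<tau>))"
proof (rule bounded_familyI)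
  show "linear (\<lambda>x::'i l2. complex_of_real (l2_fun x n) * exp (\<i> * of_int m * of_real \<tau>))" for m
    by (rule linearI) (simp_all add: plus_l2.rep_eq scaleR_l2.rep_eq distrib_right scaleR_conv_of_real)
  show "norm (complex_of_real (l2_fun x n) * exp (\<i> * of_int m * of_real \<tau>)) \<le> 1 * norm x" for m and x :: "'i l2"
    by (simp add: norm_mult norm_exp_mode l2_coord_le)
qed

lemma bounded_linear_fourier_at: "bounded_linear (fourier_at \<tau> n)"
  unfolding fourier_at_def by (rule bounded_linear_l1_ext[OF bounded_family_fourier])

lemma fourier_at_single:
  "fourier_at \<tau> n (single m x) = complex_of_real (l2_fun x n) * exp (\<i> * of_int m * of_real \<tau>)"
  unfolding fourier_at_def by (rule l1_ext_single[OF bounded_family_fourier])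

lemma norm_fourier_at_le: "norm (fourier_at \<tau> n Z) \<le> norm Z"
  using l1_ext_bound[OF bounded_family_fourier, of n \<tau> Z] by (simp add: fourier_at_def)

text \<open>Convolution of modes is multiplication of functions of time: it holds for single modes because
exponentials multiply by adding frequencies.\<close>

lemma fourier_at_mult: "fourier_at \<tau> n (f * g) = fourier_at \<tau> n f * fourier_at \<tau> n g"
  by (rule l1_multiplicativeI[OF bounded_linear_fourier_at])
     (simp add: fourier_at_single times_l2.rep_eq distrib_left distrib_right exp_add)

lemma power_Suc_of_eq_power: "power_Suc_of k (z :: 'a::monoid_mult) = z ^ Suc k"
  by (induction k) simp_all

lemma fourier_at_power: "fourier_at \<tau> n Z ^ Suc k = fourier_at \<tau> n (power_Suc_of k Z)"
  unfolding power_Suc_of_eq_power[symmetric]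
  by (rule multiplicative_power_Suc[symmetric]) (rule fourier_at_mult)

lemma continuous_fourier_at: "continuous_on S (\<lambda>\<tau>. fourier_at \<tau> n Z)"
proof -
  have "uniform_limit S (\<lambda>F \<tau>. \<Sum>m\<in>F. complex_of_real (l2_fun (coeff Z m) n) * exp (\<i> * of_int m * of_real \<tau>))
    (\<lambda>\<tau>. \<Sum>\<^sub>\<infinity>m. complex_of_real (l2_fun (coeff Z m) n) * exp (\<i> * of_int m * of_real \<tau>))
    (finite_subsets_at_top UNIV)"
    by (rule Weierstrass_m_test_general[OF _ coeff_summable[of Z]])
       (simp add: norm_mult norm_exp_mode l2_coord_le)
  then have "continuous_on S (\<lambda>\<tau>. \<Sum>\<^sub>\<infinity>m. complex_of_real (l2_fun (coeff Z m) n) * exp (\<i> * of_int m * of_real \<tau>))"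
    by (rule uniform_limit_theorem[rotated]) (auto intro!: always_eventually continuous_intros)
  then show ?thesis by (simp add: fourier_at_def l1_ext_def)
qed

lemma integral_exp_mode:
  "((\<lambda>\<tau>. exp (\<i> * of_int j * of_real \<tau>)) has_integral (if j = 0 then 2 * pi else 0)) {- pi..pi}"
proof (cases "j = 0")
  case True
  then show ?thesis using has_integral_const_real[of "1::complex" "-pi" pi] by (simp add: scaleR_conv_of_real)
next
  case False
  define F where "F \<tau> = exp (\<i> * of_int j * of_real \<tau>) / (\<i> * of_int j)" for \<tau> :: real
  have "((\<lambda>\<tau>. exp (\<i> * of_int j * of_real \<tau>)) has_integral (F pi - F (- pi))) {- pi..pi}"
  proof (rule fundamental_theorem_of_calculus)
    fix x :: real
    have "((\<lambda>z. exp (\<i> * of_int j * z) / (\<i> * of_int j)) has_field_derivative exp (\<i> * of_int j * of_real x)) (at (of_real x))"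
      using False by (auto intro!: derivative_eq_intros)
    then show "(F has_vector_derivative exp (\<i> * of_int j * of_real x)) (at x within {- pi..pi})"
      unfolding F_def by (intro has_vector_derivative_real_field)
  qed simp
  moreover have "exp (\<i> * of_int j * of_real pi) = exp (\<i> * of_int j * of_real (- pi))"
    by (subst exp_eq) (auto intro!: exI[of _ j])
  ultimately show ?thesis using False by (simp add: F_def)
qed

text \<open>Both sides are bounded linear in \<open>Z\<close>, which reduces the claim to the orthogonality of the exponentials.\<close>

lemma fourier_coefficient:
  "integral {- pi..pi} (\<lambda>\<tau>. fourier_at \<tau> n Z * exp (- \<i> * of_int m * of_real \<tau>)) =
    complex_of_real (2 * pi * l2_fun (coeff Z m) n)"
proof -
  define I where "I Z = integral {- pi..pi} (\<lambda>\<tau>. fourier_at \<tau> n Z * exp (- \<i> * of_int m * of_real \<tau>))"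
    for Z :: "(int, 'a l2) l1"
  have int: "(\<lambda>\<tau>. fourier_at \<tau> n Z * exp (- \<i> * of_int m * of_real \<tau>)) integrable_on {- pi..pi}"
    for Z :: "(int, 'a l2) l1"
    by (intro integrable_continuous_real continuous_intros continuous_fourier_at)
  have "I Z = (\<lambda>Z. complex_of_real (2 * pi * l2_fun (coeff Z m) n)) Z"
  proof (rule l1_bounded_linear_eqI)
    show "bounded_linear I"
    proof (rule bounded_linear_intro[where K = "2 * pi"])
      fix f g :: "(int, 'a l2) l1" and r :: real
      show "I (f + g) = I f + I g"
        unfolding I_def integral_add[OF int int, symmetric]
        by (simp add: linear_add[OF bounded_linear.linear[OF bounded_linear_fourier_at]] distrib_right)
      show "I (r *\<^sub>R f) = r *\<^sub>R I f"
        unfolding I_def integral_cmul[symmetric]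
        by (simp add: linear_scale[OF bounded_linear.linear[OF bounded_linear_fourier_at]])
      have "norm (I f) \<le> norm f * (pi - (- pi))"
        unfolding I_def using norm_exp_mode[of "- m"]
        by (intro integral_bound continuous_intros continuous_fourier_at)
           (auto simp: norm_mult norm_fourier_at_le)
      then show "norm (I f) \<le> norm f * (2 * pi)" by simp
    qed
    have "bounded_linear (\<lambda>x. complex_of_real (2 * pi * l2_fun x n))"
    proof (rule bounded_linear_intro[where K = "2 * pi"])
      show "norm (complex_of_real (2 * pi * l2_fun x n)) \<le> norm x * (2 * pi)" for x :: "'a l2"
        using l2_coord_le[of x n] by (simp add: norm_mult abs_mult)
    qed (simp_all add: plus_l2.rep_eq scaleR_l2.rep_eq algebra_simps scaleR_conv_of_real)
    from bounded_linear_compose[OF this bounded_linear_coeff]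
    show "bounded_linear (\<lambda>Z :: (int, 'a l2) l1. complex_of_real (2 * pi * l2_fun (coeff Z m) n))" .
    fix k and x :: "'a l2"
    have "((\<lambda>\<tau>. complex_of_real (l2_fun x n) * exp (\<i> * of_int (k - m) * of_real \<tau>)) has_integral
      (complex_of_real (l2_fun x n) * (if k - m = 0 then 2 * pi else 0))) {- pi..pi}"
      by (rule has_integral_mult_right[OF integral_exp_mode])
    moreover have "complex_of_real (l2_fun x n) * exp (\<i> * of_int (k - m) * of_real \<tau>) =
      fourier_at \<tau> n (single k x) * exp (- \<i> * of_int m * of_real \<tau>)" for \<tau>
      unfolding fourier_at_single mult.assoc exp_add[symmetric] by (simp add: algebra_simps)
    ultimately show "I (single k x) = complex_of_real (2 * pi * l2_fun (coeff (single k x) m) n)"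
      unfolding I_def by (auto simp: coeff_single zero_l2.rep_eq dest!: integral_unique)
  qed
  then show ?thesis by (simp add: I_def)
qed

section \<open>Fixed points of contractions of a ball\<close>

lemma half_contraction_unique:
  assumes "\<And>A B. A \<in> U \<Longrightarrow> B \<in> U \<Longrightarrow> norm (f A - f B) \<le> 1/2 * norm (A - B)"
    and "A \<in> U" "B \<in> U" "f A = A" "f B = B"
  shows "A = B"
  using assms(1)[OF assms(2,3)] assms(4,5) by simp

lemma half_contraction_fixed_point:
  fixes f :: "'b::banach \<Rightarrow> 'b"
  assumes contr: "\<And>A B. A \<in> cball a r \<Longrightarrow> B \<in> cball a r \<Longrightarrow> norm (f A - f B) \<le> 1/2 * norm (A - B)"
    and "r > 0" and start: "norm (f a - a) \<le> r / 2"
  obtains V where "V \<in> cball a r" "f V = V" "norm (V - a) \<le> 2 * norm (f a - a)"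
proof -
  have est: "norm (f V - a) \<le> 1/2 * norm (V - a) + norm (f a - a)" if "V \<in> cball a r" for V
    using contr[OF that, of a] \<open>r > 0\<close> norm_triangle_ineq[of "f V - f a" "f a - a"] by simp
  have "\<exists>!V\<in>cball a r. f V = V"
  proof (rule Banach_fix[where c = "1/2"])
    show "complete (cball a r)" by (simp add: complete_eq_closed)
    show "f ` cball a r \<subseteq> cball a r"
    proof
      fix W assume "W \<in> f ` cball a r"
      then obtain V where V: "V \<in> cball a r" "W = f V" by blast
      have "norm (V - a) \<le> r" using V(1) by (simp add: dist_norm norm_minus_commute)
      then have "norm (W - a) \<le> r" using est[OF V(1)] start V(2) by simp
      then show "W \<in> cball a r" by (simp add: dist_norm norm_minus_commute)
    qed
  qed (use \<open>r > 0\<close> contr in \<open>auto simp: dist_norm\<close>)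
  then obtain V where V: "V \<in> cball a r" "f V = V" by blast
  moreover have "norm (V - a) \<le> 2 * norm (f a - a)" using est[OF V(1)] V(2) by simp
  ultimately show ?thesis by (rule that)
qed

section \<open>Fourier coefficients of powers of the cosine\<close>

text \<open>The Fourier coefficients of \<open>(2 cos \<tau>)\<close> to the power \<open>k\<close>: multiplication by \<open>2 cos \<tau>\<close> adds the two
neighbouring coefficients. They are binomial coefficients.\<close>

primrec cos_power_coeff :: "nat \<Rightarrow> int \<Rightarrow> real" where
  "cos_power_coeff 0 m = (if m = 0 then 1 else 0)"
| "cos_power_coeff (Suc k) m = cos_power_coeff k (m - 1) + cos_power_coeff k (m + 1)"

lemma cos_power_coeff_eq_0: "m > int k \<Longrightarrow> cos_power_coeff k m = 0"
  by (induction k arbitrary: m) auto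

lemma cos_power_coeff_choose: "cos_power_coeff k (int k - 2 * int j) = real (k choose j)"
proof (induction k arbitrary: j)
  case 0
  show ?case by (cases j) auto
next
  case (Suc k)
  have 1: "cos_power_coeff k (int (Suc k) - 2 * int j - 1) = real (k choose j)"
    using Suc.IH[of j] by (simp add: algebra_simps)
  show ?case
  proof (cases j)
    case 0
    then show ?thesis using 1 cos_power_coeff_eq_0[of k "int k + 2"] by (simp add: add.commute)
  next
    case j: (Suc i)
    have "int (Suc k) - 2 * int j + 1 = int k - 2 * int i" using j by simp
    then have "cos_power_coeff k (int (Suc k) - 2 * int j + 1) = real (k choose i)" by (simp only: Suc.IH)
    then show ?thesis using 1 j by simp
  qed
qed

lemma cos_power_coeff_uminus: "cos_power_coeff k (- m) = cos_power_coeff k m"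
proof (induction k arbitrary: m)
  case (Suc k)
  have "- m - 1 = - (m + 1)" "- m + 1 = - (m - 1)" by simp_all
  then have "cos_power_coeff k (- m - 1) = cos_power_coeff k (m + 1)" "cos_power_coeff k (- m + 1) = cos_power_coeff k (m - 1)"
    using Suc.IH[of "m + 1"] Suc.IH[of "m - 1"] by metis+
  then show ?case by simp
qed simp

lemma cos_power_coeff_gamma:
  assumes "\<bar>m\<bar> = 1"
  shows "cos_power_coeff (2 * p + 1) m = dnls_gamma p"
proof -
  have "cos_power_coeff (2 * p + 1) 1 = real ((2 * p + 1) choose p)"
    using cos_power_coeff_choose[of "2 * p + 1" p] by simp
  also have "\<dots> = dnls_gamma p" by (simp add: dnls_gamma_def binomial_fact add.commute)
  finally have "cos_power_coeff (2 * p + 1) 1 = dnls_gamma p" .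
  moreover have "m = 1 \<or> m = -1" using assms by linarith
  ultimately show ?thesis using cos_power_coeff_uminus[of "2 * p + 1" 1] by auto
qed

definition two_modes :: "'a::real_normed_vector \<Rightarrow> (int, 'a) l1"
  where "two_modes x = single 1 x + single (- 1) x"

lemma coeff_two_modes: "coeff (two_modes x) m = (if \<bar>m\<bar> = 1 then x else 0)"
  by (auto simp: two_modes_def coeff_single)

lemma coeff_two_modes_mult:
  fixes f :: "(int, 'a::{real_normed_algebra,comm_ring,banach}) l1"
  shows "coeff (two_modes x * f) m = x * (coeff f (m - 1) + coeff f (m + 1))"
  by (simp add: two_modes_def distrib_right coeff_single_mult distrib_left)

lemma coeff_power_two_modes:
  fixes x :: "'a::{real_normed_algebra,comm_ring,banach}"
  shows "coeff (power_Suc_of n (two_modes x)) m = cos_power_coeff (Suc n) m *\<^sub>R power_Suc_of n x"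
proof (induction n arbitrary: m)
  case 0
  have "m = 1 \<or> m = - 1 \<or> \<bar>m\<bar> \<noteq> 1" by linarith
  then show ?case by (auto simp: coeff_two_modes)
next
  case (Suc n)
  show ?case
    unfolding power_Suc_of.simps(2) coeff_two_modes_mult Suc.IH cos_power_coeff.simps(2)[of "Suc n"]
    by (simp only: scaleR_add_left distrib_left mult_scaleR_right)
qed

section \<open>The breather problem as a fixed point problem\<close>

text \<open>With \<open>A m = mode_weight m V m\<close> and \<open>\<omega>\<^sup>2 = 1 - \<epsilon> \<theta>\<close>, the linear factor of the breather equation off the main
harmonics becomes \<open>(1 - m\<^sup>2 \<omega>\<^sup>2) A m = (1 + \<epsilon> \<theta> freq_shift m) V m\<close>. Both multipliers are bounded.\<close>

definition mode_weight :: "int \<Rightarrow> real" where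
  "mode_weight m = (if \<bar>m\<bar> = 1 then 1 else 1 / (1 - (real_of_int m)\<^sup>2))"

definition freq_shift :: "int \<Rightarrow> real" where
  "freq_shift m = (if \<bar>m\<bar> = 1 then 0 else (real_of_int m)\<^sup>2 / (1 - (real_of_int m)\<^sup>2))"

lemma mode_cases:
  fixes m :: int
  obtains "m = 0" | "\<bar>m\<bar> = 1" | "(real_of_int m)\<^sup>2 \<ge> 4"
proof (cases "m = 0 \<or> \<bar>m\<bar> = 1")
  case False
  then have "\<bar>m\<bar> \<ge> 2" by linarith
  then have "\<bar>real_of_int m\<bar> \<ge> 2" by linarith
  from power_mono[OF this, of 2] show ?thesis using that(3) by simp
qed (use that in auto)

lemma abs_mode_weight_le: "\<bar>mode_weight m\<bar> \<le> 1"
  by (cases m rule: mode_cases) (auto simp: mode_weight_def abs_if field_simps)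

lemma abs_mode_weight_weighted: "(1 + (real_of_int m)\<^sup>2) * \<bar>mode_weight m\<bar> \<le> 2"
proof (cases m rule: mode_cases)
  case 2
  then have "(real_of_int m)\<^sup>2 = 1" by (metis of_int_1 of_int_abs power2_abs power_one)
  then show ?thesis using 2 by (simp add: mode_weight_def)
qed (auto simp: mode_weight_def abs_if field_simps)

lemma abs_freq_shift_le: "\<bar>freq_shift m\<bar> \<le> 2"
  by (cases m rule: mode_cases) (auto simp: freq_shift_def abs_if field_simps)

abbreviation "weightD \<equiv> diag mode_weight"
abbreviation "shiftM \<equiv> diag freq_shift"
abbreviation "restR \<equiv> diag (\<lambda>m::int. if \<bar>m\<bar> = 1 then 0 else 1)"
abbreviation "mainP \<equiv> diag (\<lambda>m::int. if \<bar>m\<bar> = 1 then 1 else 0)"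

lemma bounded_linear_weightD: "bounded_linear weightD"
  by (rule bounded_linear_diag) (rule abs_mode_weight_le)

lemma bounded_linear_shiftM: "bounded_linear shiftM"
  by (rule bounded_linear_diag) (rule abs_freq_shift_le)

lemma bounded_linear_restR: "bounded_linear restR" and bounded_linear_mainP: "bounded_linear mainP"
  by (rule bounded_linear_diag[where C = 1], simp)+

lemma coeff_weightD: "coeff (weightD f) m = mode_weight m *\<^sub>R coeff f m"
  by (rule coeff_diag) (rule abs_mode_weight_le)

lemma coeff_shiftM: "coeff (shiftM f) m = freq_shift m *\<^sub>R coeff f m"
  by (rule coeff_diag) (rule abs_freq_shift_le)

lemma coeff_restR: "coeff (restR f) m = (if \<bar>m\<bar> = 1 then 0 else coeff f m)"
  by (subst coeff_diag[where C = 1]) auto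

lemma coeff_mainP: "coeff (mainP f) m = (if \<bar>m\<bar> = 1 then coeff f m else 0)"
  by (subst coeff_diag[where C = 1]) auto

lemma norm_mainP_le: "norm (mainP f) \<le> norm f"
proof -
  have "norm (mainP f) \<le> 1 * norm f" by (rule diag_bound) simp
  then show ?thesis by simp
qed

lemma norm_weightD_le: "norm (weightD f) \<le> norm f"
proof -
  have "norm (weightD f) \<le> 1 * norm f" by (rule diag_bound) (rule abs_mode_weight_le)
  then show ?thesis by simp
qed

lemma weightD_two_modes: "weightD (two_modes x) = two_modes x"
  by (rule l1_eqI) (simp add: coeff_weightD coeff_two_modes mode_weight_def)

lemma mainP_two_modes: "mainP (two_modes x) = two_modes x"
  by (rule l1_eqI) (simp add: coeff_mainP coeff_two_modes)

lemma even_part_two_modes: "even_part (two_modes x) = two_modes x"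
  by (rule l1_eqI) (simp add: coeff_even_part coeff_two_modes flip: scaleR_2)

lemma mainP_even_part: "mainP (even_part f) = two_modes (coeff (even_part f) 1)"
proof (rule l1_eqI)
  fix m :: int
  have "m = 1 \<or> m = - 1" if "\<bar>m\<bar> = 1" using that by linarith
  then show "coeff (mainP (even_part f)) m = coeff (two_modes (coeff (even_part f) 1)) m"
    by (auto simp: coeff_mainP coeff_two_modes coeff_even_part add.commute)
qed

text \<open>A profile solving the stationary equation together with the inverse \<open>G\<close> of its Jacobian. The factor
\<open>2p + 1\<close> times \<open>\<gamma>\<^sub>p\<close> multiplies the power \<open>2p\<close> of \<open>a\<close>, which is \<open>power_Suc_of (2 * p - 1) a\<close>.\<close>

locale dnls_profile =
  fixes p :: nat and \<Omega> :: real and a :: "(int ^ 'd) l2" and G :: "(int ^ 'd) l2 \<Rightarrow> (int ^ 'd) l2"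
  assumes p: "p \<ge> 1" and G: "bounded_linear G"
    and G_left: "\<And>v. G (\<Omega> *\<^sub>R v + ((2 * real p + 1) * dnls_gamma p) *\<^sub>R power_Suc_of (2 * p - 1) a * v - lap v) = v"
    and G_right: "\<And>v. \<Omega> *\<^sub>R G v + ((2 * real p + 1) * dnls_gamma p) *\<^sub>R power_Suc_of (2 * p - 1) a * G v - lap (G v) = v"
    and profile: "\<Omega> *\<^sub>R a + dnls_gamma p *\<^sub>R power_Suc_of (2 * p) a - lap a = 0"
begin

abbreviation "base \<equiv> two_modes a"

definition nonlin :: "(int, (int ^ 'd) l2) l1 \<Rightarrow> (int, (int ^ 'd) l2) l1" where
  "nonlin V = power_Suc_of (2 * p) (weightD V) - l1_lift lap (weightD V)"

definition dnonlin :: "(int, (int ^ 'd) l2) l1 \<Rightarrow> (int, (int ^ 'd) l2) l1" where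
  "dnonlin v = power_Suc_deriv (2 * p) base (weightD v) - l1_lift lap (weightD v)"

definition solveK :: "(int, (int ^ 'd) l2) l1 \<Rightarrow> (int, (int ^ 'd) l2) l1" where
  "solveK = l1_map (\<lambda>m x. if \<bar>m\<bar> = 1 then G x else 0)"

definition step :: "real \<Rightarrow> real \<Rightarrow> (int, (int ^ 'd) l2) l1 \<Rightarrow> (int, (int ^ 'd) l2) l1" where
  "step \<epsilon> \<theta> = newton_step shiftM restR mainP solveK nonlin \<theta> ((*\<^sub>R) \<epsilon>)"

lemma bounded_linear_liftlap: "bounded_linear (l1_lift lap :: (int, (int ^ 'd) l2) l1 \<Rightarrow> _)"
  by (rule bounded_linear_l1_lift[OF bounded_linear_lap])

lemma coeff_liftlap: "coeff (l1_lift lap f) m = lap (coeff f m)"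
  by (rule coeff_l1_lift[OF bounded_linear_lap])

lemma bounded_family_solveK:
  obtains C where "bounded_family C (\<lambda>(m::int) x. if \<bar>m\<bar> = 1 then G x else 0)"
proof -
  obtain C where C: "C \<ge> 0" "\<And>x. norm (G x) \<le> C * norm x" using bounded_linear_bound[OF G] by blast
  have "bounded_family C (\<lambda>(m::int) x. if \<bar>m\<bar> = 1 then G x else 0)"
  proof (rule bounded_familyI)
    show "linear (\<lambda>x. if \<bar>m\<bar> = 1 then G x else 0)" for m :: int
      using bounded_linear.linear[OF G] by (cases "\<bar>m\<bar> = 1") (auto simp: linear_zero)
  qed (use C in auto)
  then show ?thesis by (rule that)
qed

lemma bounded_linear_solveK: "bounded_linear solveK"
  by (rule bounded_family_solveK) (simp add: solveK_def bounded_linear_l1_map)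

lemma coeff_solveK: "coeff (solveK f) m = (if \<bar>m\<bar> = 1 then G (coeff f m) else 0)"
  by (rule bounded_family_solveK) (simp add: solveK_def coeff_l1_map)

lemma G_eq_0: "G v = 0 \<Longrightarrow> v = 0"
  using G_right[of v] by (simp add: linear_0[OF bounded_linear.linear[OF bounded_linear_lap]])

lemma G_0: "G 0 = 0"
  by (rule linear_0[OF bounded_linear.linear[OF G]])

lemma strict_deriv_nonlin: "strict_deriv nonlin dnonlin base"
proof -
  note D = bounded_linear_weightD
  from strict_deriv_diff_linear[OF strict_deriv_power_Suc[OF D, of "2 * p" base]
      bounded_linear_compose[OF bounded_linear_liftlap D]]
  show ?thesis unfolding nonlin_def[abs_def] dnonlin_def[abs_def] weightD_two_modes .
qed

lemma coeff_nonlin_base: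
  assumes "\<bar>m\<bar> = 1"
  shows "coeff (nonlin base) m = dnls_gamma p *\<^sub>R power_Suc_of (2 * p) a - lap a"
  using assms cos_power_coeff_gamma[OF assms, of p]
  by (simp add: nonlin_def weightD_two_modes coeff_power_two_modes coeff_liftlap coeff_two_modes)

lemma solveK_base: "solveK (\<Omega> *\<^sub>R base + nonlin base) = 0"
proof (rule l1_eqI)
  fix m :: int
  show "coeff (solveK (\<Omega> *\<^sub>R base + nonlin base)) m = coeff 0 m"
    using profile by (auto simp: coeff_solveK coeff_nonlin_base coeff_two_modes G_0 add_diff_eq)
qed

text \<open>The derivative of \<open>U\<close> to the power \<open>2p + 1\<close> at \<open>2 a cos \<tau>\<close> in the direction \<open>2 w cos \<tau>\<close> is \<open>2p + 1\<close> times \<open>w\<close>, \<open>a\<close> to the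
power \<open>2p\<close> and the power \<open>2p + 1\<close> of \<open>2 cos \<tau>\<close>, so its main harmonic again has the coefficient \<open>\<gamma>\<^sub>p\<close>.
This is where the Jacobian of the stationary equation appears.\<close>

lemma solveK_inverse: "solveK (\<Omega> *\<^sub>R mainP (even_part x) + dnonlin (mainP (even_part x))) = mainP (even_part x)"
proof -
  define w where "w = coeff (even_part x) 1"
  obtain n where n: "2 * p = Suc n" using p by (cases "2 * p") auto
  have nr: "2 * real p = 1 + real n" using arg_cong[OF n, of real] by simp
  have m: "coeff (dnonlin (two_modes w)) m =
      ((2 * real p + 1) * dnls_gamma p) *\<^sub>R power_Suc_of (2 * p - 1) a * w - lap w" if "\<bar>m\<bar> = 1" for m
  proof -
    have "cos_power_coeff (2 * p + 1) m = cos_power_coeff (Suc n) (m - 1) + cos_power_coeff (Suc n) (m + 1)"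
      unfolding n by simp
    then have "coeff (power_Suc_of n base * two_modes w) m = cos_power_coeff (2 * p + 1) m *\<^sub>R (power_Suc_of n a * w)"
      unfolding mult.commute[of "power_Suc_of n base"] coeff_two_modes_mult coeff_power_two_modes mult.commute[of _ w]
      by (simp only: distrib_left scaleR_add_left mult_scaleR_right)
    then have "coeff (power_Suc_deriv (2 * p) base (two_modes w)) m
        = ((2 * real p + 1) * dnls_gamma p) *\<^sub>R power_Suc_of (2 * p - 1) a * w"
      using n unfolding cos_power_coeff_gamma[OF that]
      by (simp add: n mult.commute[of w] mult.commute[of "dnls_gamma p"] nr)
    then show ?thesis
      using that by (simp add: dnonlin_def weightD_two_modes coeff_liftlap coeff_two_modes)
  qed
  have "solveK (\<Omega> *\<^sub>R two_modes w + dnonlin (two_modes w)) = two_modes w"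
    by (rule l1_eqI) (use G_left[of w] in \<open>simp add: coeff_solveK coeff_two_modes m add_diff_eq\<close>)
  then show ?thesis by (simp add: mainP_even_part w_def)
qed

lemmas step_contraction =
  newton_step_contraction[OF bounded_linear_shiftM bounded_linear_restR bounded_linear_solveK
    bounded_linear_mainP norm_mainP_le mainP_two_modes
    bounded_linear_even_part norm_even_part_le even_part_two_modes
    strict_deriv_nonlin solveK_inverse solveK_base]

subsection \<open>Even fixed points\<close>

lemma reflect_diag:
  assumes "\<And>m::int. \<bar>\<mu> m\<bar> \<le> C" "\<And>m. \<mu> (- m) = \<mu> m"
  shows "reflect (diag \<mu> f) = diag \<mu> (reflect f)"
  by (rule l1_eqI) (simp add: coeff_reflect coeff_diag[OF assms(1)] assms(2))

lemma reflect_power: "reflect (power_Suc_of k f) = power_Suc_of k (reflect f)"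
  for f :: "(int, (int ^ 'd) l2) l1"
  by (rule multiplicative_power_Suc) (rule reflect_mult)

lemma reflect_liftlap: "reflect (l1_lift lap f) = l1_lift lap (reflect f)"
  for f :: "(int, (int ^ 'd) l2) l1"
  by (rule l1_eqI) (simp add: coeff_reflect coeff_liftlap)

lemma reflect_weightD: "reflect (weightD f) = weightD (reflect f)"
  for f :: "(int, (int ^ 'd) l2) l1"
  by (rule reflect_diag[OF abs_mode_weight_le]) (simp add: mode_weight_def)

lemma reflect_nonlin: "reflect (nonlin f) = nonlin (reflect f)"
  by (simp add: nonlin_def linear_diff[OF bounded_linear.linear[OF bounded_linear_reflect]]
      reflect_power reflect_weightD reflect_liftlap)

text \<open>The equation is invariant under time reversal.\<close>

lemma reflect_step: "reflect (step \<epsilon> \<theta> V) = step \<epsilon> \<theta> (reflect V)"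
proof -
  interpret r: bounded_linear "reflect :: (int, (int ^ 'd) l2) l1 \<Rightarrow> _" by (rule bounded_linear_reflect)
  have K: "reflect (solveK f) = solveK (reflect f)" for f
    by (rule l1_eqI) (simp add: coeff_reflect coeff_solveK)
  have M: "reflect (shiftM f) = shiftM (reflect f)" for f :: "(int, (int ^ 'd) l2) l1"
    by (rule reflect_diag[OF abs_freq_shift_le]) (simp add: freq_shift_def)
  have R: "reflect (restR f) = restR (reflect f)" and P: "reflect (mainP f) = mainP (reflect f)"
    for f :: "(int, (int ^ 'd) l2) l1"
    by (rule reflect_diag[of _ 1]; simp)+
  show ?thesis
    by (simp add: step_def newton_step_def rest_part_def Let_def r.diff r.add r.scale r.neg K reflect_nonlin P M R)
qed

text \<open>The step was made contracting by symmetrizing its argument. By time reversal its values at even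
families are even, so a fixed point of the symmetrized step is a fixed point of the step itself.\<close>

lemma fixed_point_even:
  assumes "step \<epsilon> \<theta> (even_part V) = V"
  shows "reflect V = V" "step \<epsilon> \<theta> V = V"
proof -
  show *: "reflect V = V"
    using reflect_step[of \<epsilon> \<theta> "even_part V"] assms by (simp add: reflect_even_part)
  show "step \<epsilon> \<theta> V = V" using assms by (simp add: even_part_id[OF *])
qed

text \<open>At a fixed point the intermediate \<open>W\<close> equals \<open>V\<close>, because \<open>solveK\<close> only changes the main harmonics; the
correction then vanishes, and injectivity of \<open>G\<close> gives the main equation.\<close>

lemma step_fixed_point_iff:
  "step \<epsilon> \<theta> V = V \<longleftrightarrow>
    (\<forall>m. \<bar>m\<bar> \<noteq> 1 \<longrightarrow> coeff V m + (\<epsilon> * \<theta> * freq_shift m) *\<^sub>R coeff V m + \<epsilon> *\<^sub>R coeff (nonlin V) m = 0) \<and>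
    (\<forall>m. \<bar>m\<bar> = 1 \<longrightarrow> \<theta> *\<^sub>R coeff V m + coeff (nonlin V) m = 0)" (is "_ \<longleftrightarrow> ?rest \<and> ?main")
proof -
  define q where "q = rest_part shiftM restR nonlin \<theta> ((*\<^sub>R) \<epsilon>) V"
  define W where "W = mainP V + q"
  have step: "step \<epsilon> \<theta> V = W - solveK (\<theta> *\<^sub>R W + nonlin W)"
    by (simp add: step_def newton_step_def W_def q_def Let_def)
  have q: "coeff q m = (if \<bar>m\<bar> = 1 then 0 else
      - ((\<epsilon> * \<theta> * freq_shift m) *\<^sub>R coeff V m + \<epsilon> *\<^sub>R coeff (nonlin V) m))" for m
    by (simp add: q_def rest_part_def coeff_shiftM coeff_restR freq_shift_def scaleR_diff_right scaleR_add_right)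
  have cW: "coeff W m = (if \<bar>m\<bar> = 1 then coeff V m else coeff q m)" for m
    by (simp add: W_def coeff_mainP q)
  have rest: "?rest
      \<longleftrightarrow> (\<forall>m. \<bar>m\<bar> \<noteq> 1 \<longrightarrow> coeff q m = coeff V m)"
    by (auto simp: q add.assoc add_eq_0_iff2 eq_neg_iff_add_eq_0)
  show ?thesis
  proof
    assume fp: "step \<epsilon> \<theta> V = V"
    have qV: "coeff q m = coeff V m" if "\<bar>m\<bar> \<noteq> 1" for m
    proof -
      have "coeff V m = coeff W m - coeff (solveK (\<theta> *\<^sub>R W + nonlin W)) m"
        using arg_cong[OF fp, of "\<lambda>f. coeff f m"] by (simp add: step)
      then show ?thesis using that by (simp add: cW coeff_solveK)
    qed
    have "W = V" by (rule l1_eqI) (simp add: cW qV)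
    have "\<theta> *\<^sub>R coeff V m + coeff (nonlin V) m = 0" if "\<bar>m\<bar> = 1" for m
    proof -
      have "solveK (\<theta> *\<^sub>R V + nonlin V) = 0" using fp unfolding step \<open>W = V\<close> by simp
      from arg_cong[OF this, of "\<lambda>f. coeff f m"]
      have "G (\<theta> *\<^sub>R coeff V m + coeff (nonlin V) m) = 0"
        using that by (simp add: coeff_solveK)
      then show ?thesis by (rule G_eq_0)
    qed
    with qV rest show "?rest \<and> ?main" by blast
  next
    assume eqs: "?rest \<and> ?main"
    then have "W = V" using rest by (intro l1_eqI) (simp add: cW)
    moreover have "solveK (\<theta> *\<^sub>R V + nonlin V) = 0"
      using eqs by (intro l1_eqI) (simp add: coeff_solveK G_0)
    ultimately show "step \<epsilon> \<theta> V = V" by (simp add: step)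
  qed
qed

subsection \<open>Power series in the parameter\<close>

text \<open>The same problem with power series as unknowns: operators act on each coefficient, and the product
is the Cauchy product.\<close>

definition ps_nonlin :: "(nat, (int, (int ^ 'd) l2) l1) l1 \<Rightarrow> (nat, (int, (int ^ 'd) l2) l1) l1" where
  "ps_nonlin V = power_Suc_of (2 * p) (l1_lift weightD V) - l1_lift (l1_lift lap) (l1_lift weightD V)"

definition ps_dnonlin :: "(nat, (int, (int ^ 'd) l2) l1) l1 \<Rightarrow> (nat, (int, (int ^ 'd) l2) l1) l1" where
  "ps_dnonlin v = power_Suc_deriv (2 * p) (single 0 base) (l1_lift weightD v)
     - l1_lift (l1_lift lap) (l1_lift weightD v)"

definition ps_step where
  "ps_step = newton_step (l1_lift shiftM) (l1_lift restR) (l1_lift mainP) (l1_lift solveK) ps_nonlin"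

lemma strict_deriv_ps_nonlin: "strict_deriv ps_nonlin ps_dnonlin (single 0 base)"
proof -
  note D = bounded_linear_l1_lift[OF bounded_linear_weightD]
  from strict_deriv_diff_linear[OF strict_deriv_power_Suc[OF D, of "2 * p" "single 0 base"]
      bounded_linear_compose[OF bounded_linear_l1_lift[OF bounded_linear_liftlap] D]]
  show ?thesis
    unfolding ps_nonlin_def[abs_def] ps_dnonlin_def[abs_def] l1_lift_single[OF bounded_linear_weightD]
      weightD_two_modes .
qed

lemma power_Suc_of_single_0: "power_Suc_of n (single (0::nat) x) = single 0 (power_Suc_of n x)"
  by (induction n) (simp_all add: single_mult_single)

lemma power_Suc_deriv_single: "power_Suc_deriv n (single (0::nat) x) (single k y) = single k (power_Suc_deriv n x y)"
  by (cases n) (simp_all add: power_Suc_of_single_0 single_mult_single linear_scale[OF linear_single])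

lemma ps_nonlin_single: "ps_nonlin (single 0 V) = single 0 (nonlin V)"
  by (simp add: ps_nonlin_def nonlin_def l1_lift_single bounded_linear_weightD bounded_linear_liftlap
      power_Suc_of_single_0 linear_diff[OF linear_single])

lemma ps_dnonlin_single: "ps_dnonlin (single k v) = single k (dnonlin v)"
  by (simp add: ps_dnonlin_def dnonlin_def l1_lift_single bounded_linear_weightD bounded_linear_liftlap
      power_Suc_deriv_single linear_diff[OF linear_single])

lemmas lift_single_simps = l1_lift_single[OF bounded_linear_mainP] l1_lift_single[OF bounded_linear_even_part]
  l1_lift_single[OF bounded_linear_solveK]

text \<open>The linearization at a constant power series acts on each coefficient separately, so the inverse
of the original problem lifts.\<close>

lemma ps_inverse:
  "l1_lift solveK (\<Omega> *\<^sub>R l1_lift mainP (l1_lift even_part x) + ps_dnonlin (l1_lift mainP (l1_lift even_part x)))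
    = l1_lift mainP (l1_lift even_part x)"
proof (rule l1_bounded_linear_eqI[of "\<lambda>x. l1_lift solveK (\<Omega> *\<^sub>R l1_lift mainP (l1_lift even_part x) + ps_dnonlin (l1_lift mainP (l1_lift even_part x)))"
      "\<lambda>x. l1_lift mainP (l1_lift even_part x)"])
  note PE = bounded_linear_compose[OF bounded_linear_l1_lift[OF bounded_linear_mainP] bounded_linear_l1_lift[OF bounded_linear_even_part]]
  show "bounded_linear (\<lambda>x :: (nat, (int, (int ^ 'd) l2) l1) l1. l1_lift mainP (l1_lift even_part x))" by (rule PE)
  have "bounded_linear ps_dnonlin" using strict_deriv_ps_nonlin by (simp add: strict_deriv_def)
  from bounded_linear_compose[OF bounded_linear_l1_lift[OF bounded_linear_solveK]
      bounded_linear_add[OF bounded_linear_compose[OF bounded_linear_scaleR_right PE] bounded_linear_compose[OF this PE]]]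
  show "bounded_linear (\<lambda>x. l1_lift solveK (\<Omega> *\<^sub>R l1_lift mainP (l1_lift even_part x) + ps_dnonlin (l1_lift mainP (l1_lift even_part x))))" .
  show "l1_lift solveK (\<Omega> *\<^sub>R l1_lift mainP (l1_lift even_part (single m x)) + ps_dnonlin (l1_lift mainP (l1_lift even_part (single m x))))
    = l1_lift mainP (l1_lift even_part (single m x))" for m x
    by (simp add: lift_single_simps ps_dnonlin_single solveK_inverse
        flip: linear_scale[OF linear_single] linear_add[OF linear_single])
qed

lemma ps_base: "l1_lift solveK (\<Omega> *\<^sub>R single 0 base + ps_nonlin (single 0 base)) = 0"
  by (simp add: lift_single_simps ps_nonlin_single solveK_base linear_0[OF linear_single]
        flip: linear_scale[OF linear_single] linear_add[OF linear_single])

lemma ps_mainP_base: "l1_lift mainP (single 0 base) = single 0 base"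
  and ps_even_part_base: "l1_lift even_part (single 0 base) = single 0 base"
  by (simp_all add: lift_single_simps mainP_two_modes even_part_two_modes)

lemmas ps_step_contraction =
  newton_step_contraction[OF bounded_linear_l1_lift[OF bounded_linear_shiftM]
    bounded_linear_l1_lift[OF bounded_linear_restR] bounded_linear_l1_lift[OF bounded_linear_solveK]
    bounded_linear_l1_lift[OF bounded_linear_mainP] l1_lift_nonexpansive[OF bounded_linear_mainP norm_mainP_le]
    ps_mainP_base
    bounded_linear_l1_lift[OF bounded_linear_even_part]
    l1_lift_nonexpansive[OF bounded_linear_even_part norm_even_part_le]
    ps_even_part_base
    strict_deriv_ps_nonlin ps_inverse ps_base, folded ps_step_def]

text \<open>Evaluation at \<open>s\<close> commutes with all ingredients of the step, so it maps fixed points to fixed points.\<close>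

lemma ps_eval_step:
  assumes s: "\<bar>s\<bar> \<le> 1" and S: "\<And>f. ps_eval s (S f) = \<epsilon> *\<^sub>R ps_eval s f"
  shows "ps_eval s (ps_step \<theta> S V) = step \<epsilon> \<theta> (ps_eval s V)"
proof -
  interpret e: bounded_linear "ps_eval s :: (nat, (int, (int ^ 'd) l2) l1) l1 \<Rightarrow> _"
    by (rule bounded_linear_ps_eval[OF s])
  note lift = ps_eval_lift[OF s]
  have N: "ps_eval s (ps_nonlin f) = nonlin (ps_eval s f)" for f
    by (simp add: ps_nonlin_def nonlin_def e.diff lift bounded_linear_weightD bounded_linear_liftlap
        multiplicative_power_Suc[of "ps_eval s", OF ps_eval_mult[OF s]])
  show ?thesis
    by (simp add: ps_step_def step_def newton_step_def rest_part_def Let_def e.diff e.add e.scale e.neg N S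
        lift bounded_linear_solveK bounded_linear_mainP bounded_linear_restR bounded_linear_shiftM)
qed

end

section \<open>Summable families indexed by the integers\<close>

lemma modes_eq: "modes Z m = l2_fun (coeff Z m)"
  by (simp add: modes_def fun_eq_iff)

lemma ell2_norm_modes: "ell2_norm (modes Z m) = norm (coeff Z m)"
  by (simp add: modes_eq l2_norm_eq)

lemma coeff_summable_on: "(\<lambda>m. norm (coeff f m)) summable_on S"
  by (rule summable_on_subset_banach[OF coeff_summable]) simp

lemma infsum_nonneg_modes:
  fixes f :: "(int, 'a::real_normed_vector) l1"
  shows "(\<Sum>\<^sub>\<infinity>m\<in>{0..}. norm (coeff f m)) = norm (coeff f 0) + norm (coeff f 1) + (\<Sum>\<^sub>\<infinity>m\<in>{2..}. norm (coeff f m))"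
proof -
  have "{0::int..} = {0, 1} \<union> {2..}" by auto
  then have "(\<Sum>\<^sub>\<infinity>m\<in>{0..}. norm (coeff f m)) =
      (\<Sum>\<^sub>\<infinity>m\<in>{0, 1}. norm (coeff f m)) + (\<Sum>\<^sub>\<infinity>m\<in>{2..}. norm (coeff f m))"
    by (simp only:) (rule infsum_Un_disjoint, auto intro: coeff_summable_on)
  then show ?thesis by simp
qed

lemma nonneg_modes_le_norm:
  fixes f :: "(int, 'a::real_normed_vector) l1"
  shows "norm (coeff f 0) + norm (coeff f 1) + (\<Sum>\<^sub>\<infinity>m\<in>{2..}. norm (coeff f m)) \<le> norm f"
  unfolding infsum_nonneg_modes[symmetric] norm_l1.rep_eq
  by (rule infsum_mono2) (auto intro: coeff_summable_on)

text \<open>For even families the nonnegative modes, which are the ones measured by \<open>breather_bounds\<close>, control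
the whole norm.\<close>

lemma norm_even_le:
  fixes f :: "(int, 'a::banach) l1"
  assumes "reflect f = f"
  shows "norm f \<le> 2 * (norm (coeff f 0) + norm (coeff f 1) + (\<Sum>\<^sub>\<infinity>m\<in>{2..}. norm (coeff f m)))"
proof -
  have ev: "coeff f (- m) = coeff f m" for m using coeff_reflect[of f m] assms by simp
  have U: "(UNIV :: int set) = {0..} \<union> {..<0}" by auto
  have "norm f = (\<Sum>\<^sub>\<infinity>m\<in>{0..}. norm (coeff f m)) + (\<Sum>\<^sub>\<infinity>m\<in>{..<0}. norm (coeff f m))"
    unfolding norm_l1.rep_eq U by (rule infsum_Un_disjoint) (auto intro: coeff_summable_on)
  also have "(\<Sum>\<^sub>\<infinity>m\<in>{..<0}. norm (coeff f m)) = (\<Sum>\<^sub>\<infinity>m\<in>{0<..}. norm (coeff f m))"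
    by (rule infsum_reindex_bij_witness[of _ uminus uminus]) (auto simp: ev)
  also have "\<dots> \<le> (\<Sum>\<^sub>\<infinity>m\<in>{0..}. norm (coeff f m))"
    by (rule infsum_mono2) (auto intro: coeff_summable_on)
  finally show ?thesis by (simp add: infsum_nonneg_modes)
qed

lemma summable_on_int_inverse_weight: "(\<lambda>m::int. 1 / (1 + (real_of_int m)\<^sup>2)) summable_on UNIV"
proof -
  define g where "g m = 1 / (1 + (real_of_int m)\<^sup>2)" for m
  have "summable (\<lambda>n. 2 * inverse (real (Suc n) ^ 2))"
    by (intro summable_mult iffD2[OF summable_Suc_iff] inverse_power_summable) simp
  then have "summable (\<lambda>n. g (int n))"
  proof (rule summable_comparison_test')
    fix n :: nat
    have "(real (Suc n))\<^sup>2 \<le> 2 * (1 + (real n)\<^sup>2)"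
      using sum_squares_bound[of "real n" 1] by (simp add: power2_eq_square algebra_simps)
    then show "norm (g (int n)) \<le> 2 * inverse (real (Suc n) ^ 2)"
      by (simp add: g_def field_simps add_pos_nonneg)
  qed
  then have nat: "(\<lambda>n. g (int n)) summable_on UNIV"
    by (rule summable_nonneg_imp_summable_on) (simp add: g_def)
  have "g summable_on range int"
    using nat by (subst summable_on_reindex) (auto simp: o_def)
  moreover have "g summable_on range (\<lambda>n. - int n)"
    using nat by (subst summable_on_reindex) (auto simp: o_def g_def inj_on_def)
  ultimately have "g summable_on (range int \<union> range (\<lambda>n. - int n))"
    by (rule summable_on_union)
  also have "range int \<union> range (\<lambda>n. - int n) = UNIV"
    by (auto simp: image_iff) (metis int_cases2)
  finally show ?thesis by (simp add: g_def)
qed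

text \<open>The weight in \<open>ell22\<close> dominates \<open>1 + m\<^sup>2\<close>, whose inverse is summable, so the modes are absolutely summable.\<close>

lemma ell22_modes:
  assumes "B \<in> ell22"
  obtains Z where "modes Z = B"
proof -
  have B: "\<And>m. B m \<in> ell2" "(\<lambda>m. (1 + \<bar>real_of_int m\<bar>\<^sup>2)\<^sup>2 * (ell2_norm (B m))\<^sup>2) summable_on UNIV"
    using assms by (auto simp: ell22_def)
  have "(\<lambda>m. norm (Abs_l2 (B m))) summable_on UNIV"
  proof (rule summable_on_compare[OF summable_on_add[OF B(2) summable_on_int_inverse_weight]])
    fix m :: int
    define w where "w = 1 + (real_of_int m)\<^sup>2"
    define x where "x = norm (Abs_l2 (B m))"
    have w: "w \<ge> 1" by (simp add: w_def)
    have "x \<le> w\<^sup>2 * x\<^sup>2 + 1 / w"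
    proof (cases "x \<le> 1 / w")
      case False
      then have "1 < w * x" using w by (simp add: field_simps)
      then have "w * x \<le> (w * x) * (w * x)" by (simp add: mult_le_cancel_left1 order.strict_trans[OF zero_less_one])
      moreover have "x \<le> w * x" using w by (simp add: mult_le_cancel_right1 x_def)
      ultimately have "x \<le> w\<^sup>2 * x\<^sup>2" by (simp add: power2_eq_square mult_ac)
      then show ?thesis using w by (simp add: add_increasing2)
    qed (simp add: add_increasing)
    then show "norm (Abs_l2 (B m)) \<le> (1 + \<bar>real_of_int m\<bar>\<^sup>2)\<^sup>2 * (ell2_norm (B m))\<^sup>2 + 1 / (1 + (real_of_int m)\<^sup>2)"
      by (simp add: w_def x_def l2_norm_eq Abs_l2_inverse[OF B(1)])
  qed simp
  then have "coeff (Abs_l1 (\<lambda>m. Abs_l2 (B m))) = (\<lambda>m. Abs_l2 (B m))"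
    by (simp add: Abs_l1_inverse)
  then have "modes (Abs_l1 (\<lambda>m. Abs_l2 (B m))) = B"
    by (simp add: fun_eq_iff modes_def Abs_l2_inverse[OF B(1)])
  then show ?thesis by (rule that)
qed

text \<open>The division by \<open>1 - m\<^sup>2\<close> compensates the weight \<open>1 + m\<^sup>2\<close> up to a factor two, and square sums are bounded
by squares of sums.\<close>

lemma
  shows ell22_weightD: "modes (weightD V) \<in> ell22"
    and ell22_norm_weightD: "ell22_norm (modes (weightD V)) \<le> 2 * norm V"
proof -
  define h where "h m = (1 + \<bar>real_of_int m\<bar>\<^sup>2)\<^sup>2 * (ell2_norm (modes (weightD V) m))\<^sup>2" for m
  have hle: "h m \<le> (2 * norm V) * (2 * norm (coeff V m))" for m
  proof -
    have "(1 + \<bar>real_of_int m\<bar>\<^sup>2) * ell2_norm (modes (weightD V) m)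
        = ((1 + (real_of_int m)\<^sup>2) * \<bar>mode_weight m\<bar>) * norm (coeff V m)"
      by (simp add: ell2_norm_modes coeff_weightD)
    also have "\<dots> \<le> 2 * norm (coeff V m)"
      by (rule mult_right_mono[OF abs_mode_weight_weighted]) simp
    finally have "(1 + \<bar>real_of_int m\<bar>\<^sup>2) * ell2_norm (modes (weightD V) m) \<le> 2 * norm (coeff V m)" .
    moreover have "0 \<le> (1 + \<bar>real_of_int m\<bar>\<^sup>2) * ell2_norm (modes (weightD V) m)"
      by (simp add: ell2_norm_modes)
    ultimately have "h m \<le> (2 * norm (coeff V m))\<^sup>2"
      unfolding h_def power_mult_distrib[symmetric] by (rule power_mono)
    also have "\<dots> \<le> (2 * norm V) * (2 * norm (coeff V m))"
      unfolding power2_eq_square by (intro mult_right_mono mult_left_mono norm_coeff_le) auto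
    finally show ?thesis .
  qed
  have h0: "h m \<ge> 0" for m by (simp add: h_def)
  have fin: "sum h F \<le> (2 * norm V)\<^sup>2" if "finite F" for F
  proof -
    have "sum h F \<le> (\<Sum>m\<in>F. (2 * norm V) * (2 * norm (coeff V m)))" by (rule sum_mono) (rule hle)
    also have "\<dots> = (2 * norm V) * (2 * (\<Sum>m\<in>F. norm (coeff V m)))" by (simp add: sum_distrib_left)
    also have "\<dots> \<le> (2 * norm V) * (2 * norm V)"
      by (intro mult_left_mono l1_finite_sum_le that) auto
    finally show ?thesis by (simp add: power2_eq_square)
  qed
  note * = summable_on_nonneg_bounded[OF h0 fin]
  show "modes (weightD V) \<in> ell22"
    using *(1) unfolding h_def[abs_def] by (simp add: ell22_def modes_eq l2_fun)
  show "ell22_norm (modes (weightD V)) \<le> 2 * norm V"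
    unfolding ell22_norm_def using *(2) by (intro real_le_lsqrt) (auto simp: h_def[abs_def])
qed

lemma ell22_norm_nonneg: "ell22_norm A \<ge> 0"
  by (simp add: ell22_norm_def infsum_nonneg)

lemma norm_power_Suc_of_le: "norm (power_Suc_of n x) \<le> norm x ^ Suc n"
  for x :: "'a::{real_normed_algebra,comm_ring}"
proof (induction n)
  case (Suc n)
  show ?case
    using mult_left_mono[OF Suc.IH norm_ge_zero[of x]] norm_mult_ineq[of x "power_Suc_of n x"] by simp
qed simp

section \<open>Breathers as fixed points\<close>

text \<open>The Fourier integral of the power is a mode of the convolution power, so the breather equation is
a system of equations in \<open>\<ell>\<^sup>2\<close>.\<close>

lemma breather_modes_iff:
  fixes Z :: "(int, (int ^ 'd) l2) l1"
  assumes "modes Z \<in> ell22" "reflect Z = Z"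
  shows "breather p \<epsilon> \<omega> (modes Z) \<longleftrightarrow>
    (\<forall>m::nat. (1 - (real m)\<^sup>2 * \<omega>\<^sup>2) *\<^sub>R coeff Z (int m) + \<epsilon> *\<^sub>R coeff (power_Suc_of (2 * p) Z) (int m)
      = \<epsilon> *\<^sub>R lap (coeff Z (int m)))"
proof -
  have ev: "modes Z (- m) = modes Z m" for m
    using coeff_reflect[of Z m] assms(2) by (simp add: modes_eq)
  have int: "integral {- pi..pi} (\<lambda>\<tau>. fourier_sum (modes Z) \<tau> n ^ (1 + 2 * p) * exp (- \<i> * of_nat m * of_real \<tau>))
      = complex_of_real (2 * pi * l2_fun (coeff (power_Suc_of (2 * p) Z) (int m)) n)" for m n
    using fourier_coefficient[of n "power_Suc_of (2 * p) Z" "int m"]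
    by (simp add: fourier_sum_modes flip: fourier_at_power)
  have "complex_of_real ((1 - (real m)\<^sup>2 * \<omega>\<^sup>2) * modes Z (int m) n)
        + complex_of_real (\<epsilon> / (2 * pi)) * complex_of_real (2 * pi * l2_fun (coeff (power_Suc_of (2 * p) Z) (int m)) n)
        = complex_of_real (\<epsilon> * dlaplace (modes Z (int m)) n) \<longleftrightarrow>
      l2_fun ((1 - (real m)\<^sup>2 * \<omega>\<^sup>2) *\<^sub>R coeff Z (int m) + \<epsilon> *\<^sub>R coeff (power_Suc_of (2 * p) Z) (int m)) n
      = l2_fun (\<epsilon> *\<^sub>R lap (coeff Z (int m))) n" for m n
    unfolding of_real_mult[symmetric] of_real_add[symmetric] of_real_eq_iff
    by (simp add: plus_l2.rep_eq scaleR_l2.rep_eq l2_fun_lap modes_eq)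
  then show ?thesis
    unfolding breather_def int using assms(1) ev by (auto simp: l2_fun_inject[symmetric] fun_eq_iff)
qed

lemma mode_weight_mult:
  "\<bar>m\<bar> \<noteq> 1 \<Longrightarrow> (1 - (real_of_int m)\<^sup>2) * mode_weight m = 1"
  "\<bar>m\<bar> \<noteq> 1 \<Longrightarrow> (real_of_int m)\<^sup>2 * mode_weight m = freq_shift m"
proof -
  assume m: "\<bar>m\<bar> \<noteq> 1"
  then have "(real_of_int m)\<^sup>2 \<noteq> 1" by (cases m rule: mode_cases) auto
  with m show "(1 - (real_of_int m)\<^sup>2) * mode_weight m = 1"
    "(real_of_int m)\<^sup>2 * mode_weight m = freq_shift m"
    by (auto simp: mode_weight_def freq_shift_def)
qed

context dnls_profile
begin

text \<open>The breather equation mentions nonnegative modes only; evenness supplies the others. At \<open>m = 1\<close> it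
is \<open>\<epsilon>\<close> times the main equation.\<close>

lemma breather_iff_fixed_point:
  assumes "\<epsilon> \<noteq> 0" "\<omega>\<^sup>2 = 1 - \<epsilon> * \<theta>" "reflect V = V"
  shows "breather p \<epsilon> \<omega> (modes (weightD V)) \<longleftrightarrow> step \<epsilon> \<theta> V = V"
proof -
  have evD: "reflect (weightD V) = weightD V" by (simp add: reflect_weightD assms(3))
  have evV: "coeff V (- m) = coeff V m" for m using coeff_reflect[of V m] assms(3) by simp
  have evN: "coeff (nonlin V) (- m) = coeff (nonlin V) m" for m
    using coeff_reflect[of "nonlin V" m] reflect_nonlin[of V] assms(3) by simp
  define rest where "rest m \<longleftrightarrow>
    coeff V m + (\<epsilon> * \<theta> * freq_shift m) *\<^sub>R coeff V m + \<epsilon> *\<^sub>R coeff (nonlin V) m = 0" for m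
  define main where "main m \<longleftrightarrow> \<theta> *\<^sub>R coeff V m + coeff (nonlin V) m = 0" for m
  have freq: "freq_shift (- m) = freq_shift m" for m by (simp add: freq_shift_def)
  have ev: "rest (- m) \<longleftrightarrow> rest m" "main (- m) \<longleftrightarrow> main m" for m
    by (simp_all add: rest_def main_def evV evN freq)
  have N: "coeff (nonlin V) m = coeff (power_Suc_of (2 * p) (weightD V)) m - lap (coeff (weightD V) m)" for m
    by (simp add: nonlin_def coeff_liftlap)
  have eq: "(1 - (real m)\<^sup>2 * \<omega>\<^sup>2) *\<^sub>R coeff (weightD V) (int m)
        + \<epsilon> *\<^sub>R coeff (power_Suc_of (2 * p) (weightD V)) (int m) = \<epsilon> *\<^sub>R lap (coeff (weightD V) (int m))
      \<longleftrightarrow> (if int m = 1 then main (int m) else rest (int m))" for m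
  proof (cases "int m = 1")
    case True
    then have m: "m = 1" by simp
    have "(1 - (real m)\<^sup>2 * \<omega>\<^sup>2) *\<^sub>R coeff (weightD V) (int m)
        + \<epsilon> *\<^sub>R coeff (power_Suc_of (2 * p) (weightD V)) (int m) - \<epsilon> *\<^sub>R lap (coeff (weightD V) (int m))
      = \<epsilon> *\<^sub>R (\<theta> *\<^sub>R coeff V (int m) + coeff (nonlin V) (int m))"
      unfolding N m by (simp add: assms(2) coeff_weightD mode_weight_def algebra_simps)
    then show ?thesis using True assms(1) by (auto simp: main_def)
  next
    case False
    then have m: "\<bar>int m\<bar> \<noteq> 1" by simp
    have "(1 - (real m)\<^sup>2 * \<omega>\<^sup>2) * mode_weight (int m) =
      (1 - (real_of_int (int m))\<^sup>2) * mode_weight (int m) + \<epsilon> * \<theta> * ((real_of_int (int m))\<^sup>2 * mode_weight (int m))"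
      unfolding assms(2) by (simp add: algebra_simps)
    also have "\<dots> = 1 + \<epsilon> * \<theta> * freq_shift (int m)" by (simp only: mode_weight_mult[OF m])
    finally have "(1 - (real m)\<^sup>2 * \<omega>\<^sup>2) *\<^sub>R coeff (weightD V) (int m) = (1 + \<epsilon> * \<theta> * freq_shift (int m)) *\<^sub>R coeff V (int m)"
      by (simp add: coeff_weightD)
    then have "(1 - (real m)\<^sup>2 * \<omega>\<^sup>2) *\<^sub>R coeff (weightD V) (int m)
        + \<epsilon> *\<^sub>R coeff (power_Suc_of (2 * p) (weightD V)) (int m) - \<epsilon> *\<^sub>R lap (coeff (weightD V) (int m))
      = coeff V (int m) + (\<epsilon> * \<theta> * freq_shift (int m)) *\<^sub>R coeff V (int m) + \<epsilon> *\<^sub>R coeff (nonlin V) (int m)"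
      unfolding N by (simp add: scaleR_add_left scaleR_diff_right)
    then show ?thesis using False by (auto simp: rest_def)
  qed
  have "step \<epsilon> \<theta> V = V \<longleftrightarrow> (\<forall>m. \<bar>m\<bar> \<noteq> 1 \<longrightarrow> rest m) \<and> (\<forall>m. \<bar>m\<bar> = 1 \<longrightarrow> main m)"
    unfolding step_fixed_point_iff rest_def main_def ..
  also have "\<dots> \<longleftrightarrow> (\<forall>m. if \<bar>m\<bar> = 1 then main m else rest m)" by auto
  also have "\<dots> \<longleftrightarrow> (\<forall>m::nat. if int m = 1 then main (int m) else rest (int m))" (is "?l \<longleftrightarrow> ?r")
  proof (intro iffI allI)
    fix m :: int assume ?r
    from this[rule_format, of "nat \<bar>m\<bar>"] show "if \<bar>m\<bar> = 1 then main m else rest m"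
      using ev by (cases "m \<ge> 0") auto
  next
    fix m :: nat assume ?l
    from this[rule_format, of "int m"] show "if int m = 1 then main (int m) else rest (int m)" by simp
  qed
  finally show ?thesis
    unfolding breather_modes_iff[OF ell22_weightD evD] eq by simp
qed

text \<open>A breather determines the rescaled unknown, and the equations away from the main harmonics bound
  it in the unweighted norm.\<close>

lemma breather_rescale:
  assumes \<epsilon>: "\<epsilon> > 0" and \<theta>: "\<epsilon> * \<bar>\<theta>\<bar> \<le> 1/4" and \<omega>: "\<omega>\<^sup>2 = 1 - \<epsilon> * \<theta>"
    and Z: "breather p \<epsilon> \<omega> (modes Z)"
  obtains V where "weightD V = Z" "reflect V = V" "step \<epsilon> \<theta> V = V"
    "norm (V - base) \<le> norm (Z - base) + 2 * \<epsilon> * norm (power_Suc_of (2 * p) Z - l1_lift lap Z)"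
proof -
  have ev: "coeff Z (- m) = coeff Z m" for m
    using Z unfolding breather_def by (intro l2_eqI) (metis modes_eq)
  have rZ: "reflect Z = Z" by (rule l1_eqI) (simp add: coeff_reflect ev)
  define F where "F = power_Suc_of (2 * p) Z - l1_lift lap Z"
  have rF: "reflect F = F"
    by (simp add: F_def linear_diff[OF bounded_linear.linear[OF bounded_linear_reflect]]
        reflect_power reflect_liftlap rZ)
  have evF: "coeff F (- m) = coeff F m" for m using coeff_reflect[of F m] rF by simp
  define f where "f m = (if \<bar>m\<bar> = 1 then coeff Z m else (1 - (real_of_int m)\<^sup>2) *\<^sub>R coeff Z m)" for m
  have evf: "f (- m) = f m" for m by (simp add: f_def ev)
  have bd: "norm (f m) \<le> 2 * \<epsilon> * norm (coeff F m)" if "\<bar>m\<bar> \<noteq> 1" "m \<ge> 0" for m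
  proof -
    define k where "k = nat m"
    have k: "m = int k" using that by (simp add: k_def)
    have "(1 - (real k)\<^sup>2 * \<omega>\<^sup>2) *\<^sub>R coeff Z (int k) + \<epsilon> *\<^sub>R coeff (power_Suc_of (2 * p) Z) (int k)
      = \<epsilon> *\<^sub>R lap (coeff Z (int k))"
      using Z breather_modes_iff[OF _ rZ] unfolding breather_def by blast
    then have 1: "(1 - (real_of_int m)\<^sup>2 * \<omega>\<^sup>2) *\<^sub>R coeff Z m = - (\<epsilon> *\<^sub>R coeff F m)"
      by (simp add: F_def k coeff_liftlap scaleR_diff_right eq_diff_eq diff_eq_eq algebra_simps)
    have c: "1 - (real_of_int m)\<^sup>2 * \<omega>\<^sup>2 = (1 + \<epsilon> * \<theta> * freq_shift m) * (1 - (real_of_int m)\<^sup>2)"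
    proof -
      have "(real_of_int m)\<^sup>2 \<noteq> 1" using that(1) by (cases m rule: mode_cases) auto
      then show ?thesis using that(1) unfolding \<omega> freq_shift_def by (simp add: field_simps)
    qed
    have fm: "(1 + \<epsilon> * \<theta> * freq_shift m) *\<^sub>R f m = - (\<epsilon> *\<^sub>R coeff F m)"
      using 1 that(1) unfolding c f_def by simp
    have "\<bar>\<epsilon> * \<theta> * freq_shift m\<bar> \<le> 1/4 * 2"
      unfolding abs_mult using \<theta> \<epsilon> abs_freq_shift_le[of m] by (intro mult_mono) auto
    then have "1/2 \<le> \<bar>1 + \<epsilon> * \<theta> * freq_shift m\<bar>" by linarith
    then have "1/2 * norm (f m) \<le> \<bar>1 + \<epsilon> * \<theta> * freq_shift m\<bar> * norm (f m)" by (rule mult_right_mono) simp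
    also have "\<dots> = norm ((1 + \<epsilon> * \<theta> * freq_shift m) *\<^sub>R f m)" by simp
    also have "\<dots> = \<epsilon> * norm (coeff F m)" unfolding fm using \<epsilon> by simp
    finally show ?thesis by simp
  qed
  have bound: "norm (f m) \<le> 2 * \<epsilon> * norm (coeff F m)" if "\<bar>m\<bar> \<noteq> 1" for m
    using bd[of m] bd[of "- m"] evf[of m] evF[of m] that by (cases "m \<ge> 0") auto
  have "(\<lambda>m. norm (f m)) summable_on UNIV"
  proof (rule summable_on_compare[OF summable_on_add[OF coeff_summable[of Z] summable_on_cmult_right[OF coeff_summable[of F], of "2 * \<epsilon>"]]])
    show "norm (f m) \<le> norm (coeff Z m) + 2 * \<epsilon> * norm (coeff F m)" for m
    proof (cases "\<bar>m\<bar> = 1")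
      case True
      then show ?thesis using \<epsilon> by (simp add: f_def)
    next
      case False
      then show ?thesis using bound[OF False] by (simp add: add_increasing)
    qed
  qed simp
  then have coeffV: "coeff (Abs_l1 f) = f" by (simp add: Abs_l1_inverse)
  define V where "V = Abs_l1 f"
  have V: "coeff V m = f m" for m by (simp add: V_def coeffV)
  have D: "weightD V = Z"
  proof (rule l1_eqI)
    show "coeff (weightD V) m = coeff Z m" for m
      using mode_weight_mult(1)[of m] by (auto simp: coeff_weightD V f_def mode_weight_def mult.commute)
  qed
  have rV: "reflect V = V" by (rule l1_eqI) (simp add: coeff_reflect V evf)
  have fp: "step \<epsilon> \<theta> V = V"
    using breather_iff_fixed_point[OF _ \<omega> rV] \<epsilon> Z D by simp
  have "norm (V - base) \<le> norm (Z - base) + 2 * \<epsilon> * norm F"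
  proof (rule l1_norm_leI)
    fix S :: "int set" assume "finite S"
    have "norm (coeff (V - base) m) \<le> norm (coeff (Z - base) m) + 2 * \<epsilon> * norm (coeff F m)" for m
    proof (cases "\<bar>m\<bar> = 1")
      case True
      then show ?thesis using \<epsilon> by (simp add: V f_def)
    next
      case False
      then show ?thesis using bound[OF False] by (simp add: V coeff_two_modes add_increasing)
    qed
    then have "(\<Sum>m\<in>S. norm (coeff (V - base) m)) \<le> (\<Sum>m\<in>S. norm (coeff (Z - base) m) + 2 * \<epsilon> * norm (coeff F m))"
      by (rule sum_mono)
    also have "\<dots> = (\<Sum>m\<in>S. norm (coeff (Z - base) m)) + 2 * \<epsilon> * (\<Sum>m\<in>S. norm (coeff F m))"
      by (simp add: sum.distrib sum_distrib_left)
    also have "\<dots> \<le> norm (Z - base) + 2 * \<epsilon> * norm F"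
      using \<epsilon> by (intro add_mono mult_left_mono l1_finite_sum_le \<open>finite S\<close>) auto
    finally show "(\<Sum>m\<in>S. norm (coeff (V - base) m)) \<le> norm (Z - base) + 2 * \<epsilon> * norm F" .
  qed
  then show ?thesis using that D rV fp by (simp add: F_def)
qed

lemma nonlin_bounded_near_base:
  obtains C where "C \<ge> 0"
    "\<And>Z. norm (Z - base) \<le> 1 \<Longrightarrow> norm (power_Suc_of (2 * p) Z - l1_lift lap Z) \<le> C"
proof -
  obtain l where l: "l \<ge> 0" "\<And>Z. norm (l1_lift lap Z :: (int, (int ^ 'd) l2) l1) \<le> l * norm Z"
    using bounded_linear_bound[OF bounded_linear_liftlap] by blast
  define b where "b = norm base + 1"
  have "norm (power_Suc_of (2 * p) Z - l1_lift lap Z) \<le> b ^ Suc (2 * p) + l * b" if "norm (Z - base) \<le> 1" for Z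
  proof -
    have b: "norm Z \<le> b" using norm_triangle_sub[of Z base] that by (simp add: b_def)
    have "norm (power_Suc_of (2 * p) Z) \<le> b ^ Suc (2 * p)"
      by (rule order_trans[OF norm_power_Suc_of_le power_mono[OF b]]) simp
    moreover have "norm (l1_lift lap Z) \<le> l * b" by (rule order_trans[OF l(2) mult_left_mono[OF b l(1)]])
    ultimately show ?thesis using norm_triangle_ineq4[of "power_Suc_of (2 * p) Z" "l1_lift lap Z"] by linarith
  qed
  moreover have "b ^ Suc (2 * p) + l * b \<ge> 0" using l(1) by (simp add: b_def)
  ultimately show ?thesis using that by blast
qed

lemma step_contraction_near_base:
  obtains r \<sigma> C where "r > 0" "\<sigma> > 0" "C \<ge> 0"
    "\<And>\<epsilon> \<theta> A B. 0 \<le> \<epsilon> \<Longrightarrow> \<epsilon> \<le> \<sigma> \<Longrightarrow> \<bar>\<theta> - \<Omega>\<bar> \<le> \<sigma> \<Longrightarrow> A \<in> cball base r \<Longrightarrow> B \<in> cball base r \<Longrightarrow>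
      norm (step \<epsilon> \<theta> (even_part A) - step \<epsilon> \<theta> (even_part B)) \<le> 1/2 * norm (A - B)"
    "\<And>\<epsilon>. 0 \<le> \<epsilon> \<Longrightarrow> \<epsilon> \<le> \<sigma> \<Longrightarrow> norm (step \<epsilon> \<Omega> base - base) \<le> C * \<epsilon>"
proof -
  obtain r \<sigma> C where *: "r > 0" "\<sigma> > 0" "C \<ge> 0"
    "uniform_contraction (newton_step shiftM restR mainP solveK nonlin) even_part base \<Omega> r \<sigma> C"
    using step_contraction by (metis order_refl)
  have S: "bounded_linear ((*\<^sub>R) \<epsilon> :: (int, (int ^ 'd) l2) l1 \<Rightarrow> _)"
    "\<And>x :: (int, (int ^ 'd) l2) l1. norm (\<epsilon> *\<^sub>R x) \<le> \<epsilon> * norm x" if "0 \<le> \<epsilon>" for \<epsilon>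
    using that by (auto intro: bounded_linear_scaleR_right)
  show ?thesis
  proof (rule that[OF *(1-3)])
    show "norm (step \<epsilon> \<theta> (even_part A) - step \<epsilon> \<theta> (even_part B)) \<le> 1/2 * norm (A - B)"
      if "0 \<le> \<epsilon>" "\<epsilon> \<le> \<sigma>" "\<bar>\<theta> - \<Omega>\<bar> \<le> \<sigma>" "A \<in> cball base r" "B \<in> cball base r" for \<epsilon> \<theta> A B
      unfolding step_def by (rule uniform_contractionD(1)[OF *(4) S[OF that(1)] that])
    show "norm (step \<epsilon> \<Omega> base - base) \<le> C * \<epsilon>" if "0 \<le> \<epsilon>" "\<epsilon> \<le> \<sigma>" for \<epsilon>
    proof -
      have "norm (step \<epsilon> \<Omega> base - base) \<le> C * (\<epsilon> + \<bar>\<Omega> - \<Omega>\<bar>)"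
        unfolding step_def using *(2) by (intro uniform_contractionD(2)[OF *(4) S[OF that(1)] that]) simp
      then show ?thesis by simp
    qed
  qed
qed

text \<open>The solution of the lifted fixed point problem is the power series of a branch of fixed points
  around any centre \<open>x\<close>.\<close>

lemma power_series_fixed_point:
  assumes "r1 > 0"
  obtains \<sigma> where "\<sigma> > 0" "\<And>x \<rho>. 0 \<le> x \<Longrightarrow> 0 \<le> \<rho> \<Longrightarrow> x + \<rho> \<le> \<sigma> \<Longrightarrow>
    \<exists>W. \<forall>s. \<bar>s\<bar> \<le> 1 \<longrightarrow> ps_eval s W \<in> cball base r1 \<and>
      step (x + \<rho> * s) \<Omega> (even_part (ps_eval s W)) = ps_eval s W"
proof -
  obtain r0 where r0: "r0 > 0" "\<And>r. 0 < r \<Longrightarrow> r \<le> r0 \<Longrightarrow> \<exists>\<sigma>0>0. \<exists>C\<ge>0.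
      uniform_contraction ps_step (l1_lift even_part) (single 0 base) \<Omega> r \<sigma>0 C"
    using ps_step_contraction by blast
  define r where "r = min r0 r1"
  have r: "r > 0" "r \<le> r0" "r \<le> r1" using r0(1) assms by (auto simp: r_def)
  obtain \<sigma>0 C where C: "\<sigma>0 > 0" "C \<ge> 0"
      "uniform_contraction ps_step (l1_lift even_part) (single 0 base) \<Omega> r \<sigma>0 C"
    using r0(2)[OF r(1,2)] by blast
  define \<sigma> where "\<sigma> = min \<sigma>0 (r / (2 * (C + 1)))"
  have \<sigma>: "\<sigma> > 0" "\<sigma> \<le> \<sigma>0" "C * \<sigma> \<le> r / 2"
  proof -
    show "\<sigma> > 0" "\<sigma> \<le> \<sigma>0" using C r by (auto simp: \<sigma>_def)
    have "C * \<sigma> \<le> C * (r / (2 * (C + 1)))" using C by (intro mult_left_mono) (auto simp: \<sigma>_def)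
    also have "\<dots> \<le> r / 2" using C r by (simp add: field_simps)
    finally show "C * \<sigma> \<le> r / 2" .
  qed
  have "\<exists>W. \<forall>s. \<bar>s\<bar> \<le> 1 \<longrightarrow> ps_eval s W \<in> cball base r1 \<and>
      step (x + \<rho> * s) \<Omega> (even_part (ps_eval s W)) = ps_eval s W"
    if x: "0 \<le> x" and \<rho>: "0 \<le> \<rho>" and le: "x + \<rho> \<le> \<sigma>" for x \<rho>
  proof -
    define S where "S f = x *\<^sub>R f + \<rho> *\<^sub>R ps_shift f" for f :: "(nat, (int, (int ^ 'd) l2) l1) l1"
    have S: "bounded_linear S" unfolding S_def
      by (intro bounded_linear_add bounded_linear_scaleR_right
          bounded_linear_compose[OF bounded_linear_scaleR_right bounded_linear_ps_shift])
    have Sb: "norm (S f) \<le> (x + \<rho>) * norm f" for f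
    proof -
      have "norm (S f) \<le> norm (x *\<^sub>R f) + norm (\<rho> *\<^sub>R ps_shift f)" unfolding S_def by (rule norm_triangle_ineq)
      also have "\<dots> \<le> x * norm f + \<rho> * norm f"
        using x \<rho> norm_ps_shift_le[of f] by (simp add: mult_left_mono)
      finally show ?thesis by (simp add: distrib_right)
    qed
    define T where "T V = ps_step \<Omega> S (l1_lift even_part V)" for V
    have side: "0 \<le> x + \<rho>" "x + \<rho> \<le> \<sigma>0" "\<bar>\<Omega> - \<Omega>\<bar> \<le> \<sigma>0" using x \<rho> le \<sigma>(2) C(1) by auto
    note contr = uniform_contractionD(1)[OF C(3) S Sb side, folded T_def]
    have start: "norm (T (single 0 base) - single 0 base) \<le> C * (x + \<rho>)"
      using uniform_contractionD(2)[OF C(3) S Sb side] by (simp add: T_def ps_even_part_base)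
    have "C * (x + \<rho>) \<le> r / 2" using mult_left_mono[OF le C(2)] \<sigma>(3) by linarith
    with start have "norm (T (single 0 base) - single 0 base) \<le> r / 2" by linarith
    from half_contraction_fixed_point[OF contr r(1) this]
    obtain W where W: "W \<in> cball (single 0 base) r" "T W = W" by blast
    have "ps_eval s W \<in> cball base r1 \<and> step (x + \<rho> * s) \<Omega> (even_part (ps_eval s W)) = ps_eval s W"
      if s: "\<bar>s\<bar> \<le> 1" for s
    proof
      have "base - ps_eval s W = ps_eval s (single 0 base - W)"
        by (simp add: linear_diff[OF bounded_linear.linear[OF bounded_linear_ps_eval[OF s]]] ps_eval_single[OF s])
      also have "norm \<dots> \<le> norm (single 0 base - W)" by (rule norm_ps_eval_le[OF s])
      also have "\<dots> \<le> r1" using W(1) r(3) by (simp add: dist_norm)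
      finally show "ps_eval s W \<in> cball base r1" by (simp add: dist_norm)
      have "ps_eval s (S f) = (x + \<rho> * s) *\<^sub>R ps_eval s f" for f
        unfolding S_def
        by (simp add: linear_add[OF bounded_linear.linear[OF bounded_linear_ps_eval[OF s]]]
            linear_scale[OF bounded_linear.linear[OF bounded_linear_ps_eval[OF s]]] ps_eval_shift[OF s] scaleR_add_left)
      from ps_eval_step[OF s this, of \<Omega> "l1_lift even_part W"]
      show "step (x + \<rho> * s) \<Omega> (even_part (ps_eval s W)) = ps_eval s W"
        using W(2) by (simp add: T_def ps_eval_lift[OF s bounded_linear_even_part])
    qed
    then show ?thesis by blast
  qed
  with \<sigma>(1) show ?thesis by (rule that)
qed

end

section \<open>The frequency\<close>

text \<open>Around \<open>x\<close> this is the binomial series of \<open>(b + z)\<close> to the power one half with \<open>b = 1 - x \<Omega>\<close> and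
\<open>z = - (y - x) \<Omega>\<close>.\<close>

lemma real_analytic_sqrt:
  assumes "\<And>x. x \<in> S \<Longrightarrow> x * \<Omega> < 1"
  shows "real_analytic_on (\<lambda>x. sqrt (1 - x * \<Omega>)) S"
  unfolding real_analytic_on_def
proof
  fix x assume "x \<in> S"
  define b where "b = 1 - x * \<Omega>"
  have b: "b > 0" using assms[OF \<open>x \<in> S\<close>] by (simp add: b_def)
  define c where "c k = (((1/2::real) gchoose k) * b powr (1/2 - real k)) * (- \<Omega>) ^ k" for k
  have "(\<lambda>k. c k * (y - x) ^ k) sums sqrt (1 - y * \<Omega>)" if "\<bar>y - x\<bar> < b / (\<bar>\<Omega>\<bar> + 1)" for y
  proof -
    have "\<bar>- (y - x) * \<Omega>\<bar> \<le> \<bar>y - x\<bar> * (\<bar>\<Omega>\<bar> + 1)" by (simp add: abs_mult abs_minus_commute mult_left_mono)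
    also have "\<dots> < b" using that by (simp add: field_simps)
    finally have lt: "\<bar>- (y - x) * \<Omega>\<bar> < b" .
    then have "- (y - x) * \<Omega> + b > 0" by linarith
    moreover have "- (y - x) * \<Omega> + b = 1 - y * \<Omega>" by (simp add: b_def algebra_simps)
    moreover have "((1/2::real) gchoose k) * (- (y - x) * \<Omega>) ^ k * b powr (1/2 - real k) = c k * (y - x) ^ k" for k
    proof -
      have "- (y - x) * \<Omega> = (- \<Omega>) * (y - x)" by (simp add: algebra_simps)
      then show ?thesis by (simp only: c_def power_mult_distrib mult_ac)
    qed
    ultimately show ?thesis using gen_binomial_real'[OF lt, of "1/2"] by (simp add: powr_half_sqrt)
  qed
  moreover have "b / (\<bar>\<Omega>\<bar> + 1) > 0" using b by simp
  ultimately show "\<exists>r>0. \<exists>c. \<forall>y. \<bar>y - x\<bar> < r \<longrightarrow> (\<lambda>k. c k * (y - x) ^ k) sums sqrt (1 - y * \<Omega>)" by blast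
qed

lemma sqrt_expansion_bound:
  fixes t :: real
  assumes "\<bar>t\<bar> \<le> 1/2"
  shows "\<bar>sqrt (1 - t) - 1 + t / 2\<bar> \<le> t\<^sup>2"
proof -
  define s where "s = sqrt (1 - t)"
  have s: "s * s = 1 - t" "s \<ge> 0" using assms by (auto simp: s_def)
  have pos: "3/4 \<le> s + (1 - t / 2)" using s(2) assms by linarith
  have "(s - 1 + t / 2) * (s + (1 - t / 2)) = s * s - (1 - t / 2) * (1 - t / 2)" by (simp add: field_simps)
  also have "\<dots> = - (t\<^sup>2 / 4)" unfolding s(1) by (simp add: power2_eq_square algebra_simps)
  finally have eq: "(s - 1 + t / 2) * (s + (1 - t / 2)) = - (t\<^sup>2 / 4)" .
  have "\<bar>s - 1 + t / 2\<bar> * (3/4) \<le> \<bar>s - 1 + t / 2\<bar> * \<bar>s + (1 - t / 2)\<bar>"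
    using pos by (intro mult_left_mono) auto
  also have "\<dots> = t\<^sup>2 / 4" unfolding abs_mult[symmetric] eq by simp
  also have "\<dots> \<le> t\<^sup>2 * (3/4)" by simp
  finally show ?thesis unfolding s_def[symmetric] by (rule mult_right_le_imp_le) simp
qed

text \<open>Breathers of any frequency within the bounds solve the fixed point problem with a parameter \<open>\<theta>\<close>
close to \<open>\<Omega>\<close>.\<close>

lemma frequency_parameter_bound:
  fixes \<nu> \<epsilon> \<Omega> C :: real
  assumes "\<bar>\<nu> - 1 + \<epsilon> * \<Omega> / 2\<bar> \<le> C * \<epsilon>\<^sup>2" and \<epsilon>: "0 < \<epsilon>" "\<epsilon> \<le> 1" and C: "C \<ge> 0"
  shows "\<bar>(1 - \<nu>\<^sup>2) / \<epsilon> - \<Omega>\<bar> \<le> (2 * C + (\<bar>\<Omega>\<bar> / 2 + C)\<^sup>2) * \<epsilon>"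
proof -
  define \<delta> where "\<delta> = \<nu> - 1 + \<epsilon> * \<Omega> / 2"
  define h where "h = \<epsilon> * \<Omega> / 2 - \<delta>"
  have \<delta>: "\<bar>\<delta>\<bar> \<le> C * \<epsilon>\<^sup>2" using assms(1) by (simp add: \<delta>_def)
  have "\<epsilon>\<^sup>2 \<le> \<epsilon>" using \<epsilon> power_decreasing[of 1 2 \<epsilon>] by simp
  then have "C * \<epsilon>\<^sup>2 \<le> C * \<epsilon>" using C by (rule mult_left_mono)
  then have "\<bar>h\<bar> \<le> \<epsilon> * \<bar>\<Omega>\<bar> / 2 + C * \<epsilon>"
    using \<delta> \<epsilon> abs_triangle_ineq4[of "\<epsilon> * \<Omega> / 2" \<delta>] by (simp add: h_def abs_mult)
  then have "\<bar>h\<bar> \<le> (\<bar>\<Omega>\<bar> / 2 + C) * \<epsilon>" by (simp add: algebra_simps)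
  then have "h\<^sup>2 \<le> ((\<bar>\<Omega>\<bar> / 2 + C) * \<epsilon>)\<^sup>2" using power_mono[of "\<bar>h\<bar>" _ 2] by simp
  then have h2: "h\<^sup>2 \<le> ((\<bar>\<Omega>\<bar> / 2 + C)\<^sup>2 * \<epsilon>) * \<epsilon>" by (simp add: power_mult_distrib power2_eq_square mult_ac)
  have "\<nu> = 1 - h" by (simp add: h_def \<delta>_def)
  then have "1 - \<nu>\<^sup>2 = 2 * h - h\<^sup>2" by (simp only: power2_eq_square) (simp add: algebra_simps)
  moreover have "2 * h = \<epsilon> * \<Omega> - 2 * \<delta>" by (simp add: h_def)
  ultimately have "1 - \<nu>\<^sup>2 - \<epsilon> * \<Omega> = - 2 * \<delta> - h\<^sup>2" by simp
  then have "\<bar>1 - \<nu>\<^sup>2 - \<epsilon> * \<Omega>\<bar> \<le> 2 * (C * \<epsilon>\<^sup>2) + ((\<bar>\<Omega>\<bar> / 2 + C)\<^sup>2 * \<epsilon>) * \<epsilon>"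
    using \<delta> h2 zero_le_power2[of h] by linarith
  also have "\<dots> = ((2 * C + (\<bar>\<Omega>\<bar> / 2 + C)\<^sup>2) * \<epsilon>) * \<epsilon>" by (simp add: power2_eq_square algebra_simps)
  finally have "\<bar>1 - \<nu>\<^sup>2 - \<epsilon> * \<Omega>\<bar> / \<epsilon> \<le> (2 * C + (\<bar>\<Omega>\<bar> / 2 + C)\<^sup>2) * \<epsilon>"
    using \<epsilon> by (simp add: divide_le_eq)
  moreover have "(1 - \<nu>\<^sup>2) / \<epsilon> - \<Omega> = (1 - \<nu>\<^sup>2 - \<epsilon> * \<Omega>) / \<epsilon>" using \<epsilon> by (simp add: field_simps)
  ultimately show ?thesis using \<epsilon> by (simp add: abs_divide)
qed

section \<open>The breather branch\<close>

lemma modes_weightD_partial_sum: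
  assumes "\<rho> \<noteq> 0"
  shows "modes (weightD V) m n - (\<Sum>k<N. modes (weightD ((1 / \<rho> ^ k) *\<^sub>R c k)) m n * (z * \<rho>) ^ k)
    = modes (weightD (V - (\<Sum>k<N. z ^ k *\<^sub>R c k))) m n"
proof -
  interpret w: bounded_linear "weightD :: (int, 'a l2) l1 \<Rightarrow> _" by (rule bounded_linear_weightD)
  interpret c: bounded_linear "\<lambda>f :: (int, 'a l2) l1. coeff f m" by (rule bounded_linear_coeff)
  show ?thesis
    using assms by (simp add: modes_def w.diff w.sum w.scale c.diff c.sum c.scale minus_l2.rep_eq
        l2_fun_sum scaleR_l2.rep_eq power_mult_distrib mult.commute)
qed

text \<open>The radius of the power series in \<open>s\<close> is one at every centre, so one common scale \<open>\<rho>\<close> serves the whole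
interval. Division by \<open>1 - m\<^sup>2\<close> turns convergence of its partial sums into convergence in \<open>ell22\<close>.\<close>

lemma ell22_analytic_on_power_series:
  assumes "\<rho> > 0"
    and series: "\<And>x. x \<in> {0<..<\<rho>} \<Longrightarrow> \<exists>W. \<forall>s. \<bar>s\<bar> \<le> 1 \<longrightarrow> x + \<rho> * s \<in> {0<..<\<rho>} \<longrightarrow> V (x + \<rho> * s) = ps_eval s W"
  shows "ell22_analytic_on (\<lambda>x. modes (weightD (V x))) {0<..<\<rho>}"
  unfolding ell22_analytic_on_def
proof
  fix x assume x: "x \<in> {0<..<\<rho>}"
  define d where "d = min x (\<rho> - x)"
  have d: "d > 0" using x by (simp add: d_def)
  obtain W where W: "\<And>s. \<bar>s\<bar> \<le> 1 \<Longrightarrow> x + \<rho> * s \<in> {0<..<\<rho>} \<Longrightarrow> V (x + \<rho> * s) = ps_eval s W"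
    using series[OF x] by blast
  define c where "c k = modes (weightD ((1 / \<rho> ^ k) *\<^sub>R coeff W k))" for k
  have "(\<lambda>N. ell22_norm (\<lambda>m n. modes (weightD (V y)) m n - (\<Sum>k<N. c k m n * (y - x) ^ k))) \<longlonglongrightarrow> 0"
    if "\<bar>y - x\<bar> < d" for y
  proof -
    define s where "s = (y - x) / \<rho>"
    have s: "\<bar>s\<bar> \<le> 1" "x + \<rho> * s = y" "y - x = s * \<rho>"
      using that x \<open>\<rho> > 0\<close> by (auto simp: s_def d_def field_simps)
    define R where "R N = V y - (\<Sum>k<N. s ^ k *\<^sub>R coeff W k)" for N
    have "y \<in> {0<..<\<rho>}" using that by (auto simp: d_def)
    then have "V y = ps_eval s W" using W[OF s(1)] s(2) by simp
    then have "(\<lambda>N. \<Sum>k<N. s ^ k *\<^sub>R coeff W k) \<longlonglongrightarrow> V y"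
      using ps_eval_sums[OF s(1), of W] by (simp add: sums_def)
    then have "(\<lambda>N. 2 * norm (R N)) \<longlonglongrightarrow> 2 * norm (V y - V y)"
      unfolding R_def by (intro tendsto_intros)
    then have lim: "(\<lambda>N. 2 * norm (R N)) \<longlonglongrightarrow> 0" by simp
    have eq: "(\<lambda>m n. modes (weightD (V y)) m n - (\<Sum>k<N. c k m n * (y - x) ^ k)) = modes (weightD (R N))" for N
      unfolding R_def c_def s(3) using \<open>\<rho> > 0\<close> by (intro ext modes_weightD_partial_sum) simp
    show ?thesis
      unfolding eq by (rule tendsto_sandwich[OF _ _ tendsto_const lim])
        (auto intro: always_eventually ell22_norm_nonneg ell22_norm_weightD)
  qed
  moreover have "\<forall>k. c k \<in> ell22" by (simp add: c_def ell22_weightD)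
  ultimately show "\<exists>d>0. \<exists>c. (\<forall>k. c k \<in> ell22) \<and> (\<forall>y. \<bar>y - x\<bar> < d \<longrightarrow> modes (weightD (V y)) \<in> ell22 \<and>
      (\<lambda>N. ell22_norm (\<lambda>m n. modes (weightD (V y)) m n - (\<Sum>k<N. c k m n * (y - x) ^ k))) \<longlonglongrightarrow> 0)"
    using d ell22_weightD by blast
qed

context dnls_profile
begin

lemma breather_distance:
  "ell2_norm (modes Z 0) + ell2_norm (\<lambda>n. modes Z 1 n - l2_fun a n) + (\<Sum>\<^sub>\<infinity>m\<in>{2..}. ell2_norm (modes Z m))
    = norm (coeff (Z - base) 0) + norm (coeff (Z - base) 1) + (\<Sum>\<^sub>\<infinity>m\<in>{2..}. norm (coeff (Z - base) m))"
proof -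
  have "(\<lambda>n. modes Z 1 n - l2_fun a n) = l2_fun (coeff Z 1 - a)"
    by (simp add: fun_eq_iff modes_def minus_l2.rep_eq)
  then have "ell2_norm (\<lambda>n. modes Z 1 n - l2_fun a n) = norm (coeff Z 1 - a)" by (simp add: l2_norm_eq)
  moreover have "(\<Sum>\<^sub>\<infinity>m\<in>{2..}. ell2_norm (modes Z m)) = (\<Sum>\<^sub>\<infinity>m\<in>{2..}. norm (coeff (Z - base) m))"
    by (rule infsum_cong) (simp add: ell2_norm_modes coeff_two_modes)
  ultimately show ?thesis by (simp add: ell2_norm_modes coeff_two_modes)
qed

text \<open>Existence and the bounds come from the contraction at \<open>\<theta> = \<Omega>\<close>, analyticity from power series solutions,
and uniqueness from the contraction at the \<open>\<theta>\<close> given by the common frequency of both breathers.\<close>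

lemma breather_branch:
  "\<exists>\<epsilon>\<^sub>0>0. \<exists>C\<^sub>0>0. \<exists>(\<omega> :: real \<Rightarrow> real) (A :: real \<Rightarrow> int \<Rightarrow> int ^ 'd \<Rightarrow> real).
    real_analytic_on \<omega> {0<..<\<epsilon>\<^sub>0} \<and>
    ell22_analytic_on A {0<..<\<epsilon>\<^sub>0} \<and>
    (\<forall>\<epsilon>\<in>{0<..<\<epsilon>\<^sub>0}.
      breather p \<epsilon> (\<omega> \<epsilon>) (A \<epsilon>) \<and> breather_bounds \<Omega> (l2_fun a) C\<^sub>0 \<epsilon> (\<omega> \<epsilon>) (A \<epsilon>)) \<and>
    (\<forall>\<epsilon>\<in>{0<..<\<epsilon>\<^sub>0}. \<forall>\<nu> B B'.
      breather p \<epsilon> \<nu> B \<and> breather_bounds \<Omega> (l2_fun a) C\<^sub>0 \<epsilon> \<nu> B \<and>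
      breather p \<epsilon> \<nu> B' \<and> breather_bounds \<Omega> (l2_fun a) C\<^sub>0 \<epsilon> \<nu> B' \<longrightarrow> B = B')"
proof -
  obtain r \<sigma> C where r: "r > 0" and \<sigma>: "\<sigma> > 0" and C: "C \<ge> 0"
    and contr: "\<And>\<epsilon> \<theta> A B. 0 \<le> \<epsilon> \<Longrightarrow> \<epsilon> \<le> \<sigma> \<Longrightarrow> \<bar>\<theta> - \<Omega>\<bar> \<le> \<sigma> \<Longrightarrow> A \<in> cball base r \<Longrightarrow> B \<in> cball base r \<Longrightarrow>
      norm (step \<epsilon> \<theta> (even_part A) - step \<epsilon> \<theta> (even_part B)) \<le> 1/2 * norm (A - B)"
    and start: "\<And>\<epsilon>. 0 \<le> \<epsilon> \<Longrightarrow> \<epsilon> \<le> \<sigma> \<Longrightarrow> norm (step \<epsilon> \<Omega> base - base) \<le> C * \<epsilon>"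
    using step_contraction_near_base by blast
  obtain \<tau> where \<tau>: "\<tau> > 0" and series: "\<And>x \<rho>. 0 \<le> x \<Longrightarrow> 0 \<le> \<rho> \<Longrightarrow> x + \<rho> \<le> \<tau> \<Longrightarrow>
    \<exists>W. \<forall>s. \<bar>s\<bar> \<le> 1 \<longrightarrow> ps_eval s W \<in> cball base r \<and>
      step (x + \<rho> * s) \<Omega> (even_part (ps_eval s W)) = ps_eval s W"
    using power_series_fixed_point[OF r] by blast
  obtain H where H: "H \<ge> 0"
    "\<And>Z. norm (Z - base) \<le> 1 \<Longrightarrow> norm (power_Suc_of (2 * p) Z - l1_lift lap Z) \<le> H"
    using nonlin_bounded_near_base by blast
  define C0 where "C0 = 2 * C + \<Omega>\<^sup>2 + 1"
  have C0: "C0 > 0" "2 * C \<le> C0" "\<Omega>\<^sup>2 \<le> C0" using C by (auto simp: C0_def add_nonneg_pos)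
  define C1 where "C1 = 2 * C0 + (\<bar>\<Omega>\<bar> / 2 + C0)\<^sup>2"
  have C1: "C1 \<ge> 0" using C0(1) by (simp add: C1_def)
  \<comment> \<open>Each smallness condition on \<open>\<epsilon>\<close> has the form \<open>c \<epsilon> \<le> 1\<close> with \<open>c\<close> a summand of \<open>T\<close>.\<close>
  define T where "T = 1 + 1/\<sigma> + 2 * C / r + 2/\<tau> + (2 * C0 + 2 * H) / r + 2 * C0 + C1 / \<sigma> + C1 + 4 * (\<bar>\<Omega>\<bar> + 1)"
  define \<epsilon>0 where "\<epsilon>0 = 1 / T"
  have nonneg: "1/\<sigma> \<ge> 0" "2 * C / r \<ge> 0" "2/\<tau> \<ge> 0" "(2 * C0 + 2 * H) / r \<ge> 0" "2 * C0 \<ge> 0" "C1 / \<sigma> \<ge> 0"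
    "4 * (\<bar>\<Omega>\<bar> + 1) \<ge> 0"
    using \<sigma> C r \<tau> C0(1) H(1) C1 by auto
  have T: "T \<ge> 1" unfolding T_def using nonneg C1 by linarith
  have le_T: "1/\<sigma> \<le> T" "2 * C / r \<le> T" "2/\<tau> \<le> T" "(2 * C0 + 2 * H) / r \<le> T" "2 * C0 \<le> T"
    "C1 / \<sigma> \<le> T" "C1 \<le> T" "4 * (\<bar>\<Omega>\<bar> + 1) \<le> T"
    unfolding T_def using nonneg C1 by linarith+
  have \<epsilon>0: "\<epsilon>0 > 0" using T by (simp add: \<epsilon>0_def)
  have small: "c * \<epsilon> \<le> 1" if "0 < \<epsilon>" "\<epsilon> \<le> \<epsilon>0" "c \<le> T" for c \<epsilon>
  proof -
    have "c * \<epsilon> \<le> T * \<epsilon>0" using that T by (intro mult_mono) auto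
    then show ?thesis using T by (simp add: \<epsilon>0_def)
  qed
  have e1: "\<epsilon> \<le> 1" and e2: "\<epsilon> \<le> \<sigma>" and e3: "C * \<epsilon> \<le> r / 2" and e4: "2 * \<epsilon> \<le> \<tau>"
    and e5: "2 * C0 * \<epsilon> + 2 * \<epsilon> * H \<le> r" and e6: "2 * C0 * \<epsilon> \<le> 1" and e7: "C1 * \<epsilon> \<le> \<sigma>" and e8: "C1 * \<epsilon> \<le> 1"
    and e9: "(\<bar>\<Omega>\<bar> + 1) * \<epsilon> \<le> 1/4"
    if \<epsilon>: "0 < \<epsilon>" "\<epsilon> \<le> \<epsilon>0" for \<epsilon>
  proof -
    note s = small[OF \<epsilon>]
    show "\<epsilon> \<le> 1" using s[of 1] T by simp
    have "1/\<sigma> * \<epsilon> \<le> 1" by (rule s[OF le_T(1)])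
    then show "\<epsilon> \<le> \<sigma>" using \<sigma> by (simp add: field_simps)
    have "2 * C / r * \<epsilon> \<le> 1" by (rule s[OF le_T(2)])
    then show "C * \<epsilon> \<le> r / 2" using r by (simp add: field_simps)
    have "2/\<tau> * \<epsilon> \<le> 1" by (rule s[OF le_T(3)])
    then show "2 * \<epsilon> \<le> \<tau>" using \<tau> by (simp add: field_simps)
    have "(2 * C0 + 2 * H) / r * \<epsilon> \<le> 1" by (rule s[OF le_T(4)])
    then show "2 * C0 * \<epsilon> + 2 * \<epsilon> * H \<le> r" using r by (simp add: field_simps)
    show "2 * C0 * \<epsilon> \<le> 1" by (rule s[OF le_T(5)])
    have "C1 / \<sigma> * \<epsilon> \<le> 1" by (rule s[OF le_T(6)])
    then show "C1 * \<epsilon> \<le> \<sigma>" using \<sigma> by (simp add: field_simps)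
    show "C1 * \<epsilon> \<le> 1" by (rule s[OF le_T(7)])
    have "4 * (\<bar>\<Omega>\<bar> + 1) * \<epsilon> \<le> 1" by (rule s[OF le_T(8)])
    then show "(\<bar>\<Omega>\<bar> + 1) * \<epsilon> \<le> 1/4" by (simp add: algebra_simps)
  qed
  have \<epsilon>\<Omega>: "\<bar>\<epsilon> * \<Omega>\<bar> \<le> 1/4" if "0 < \<epsilon>" "\<epsilon> \<le> \<epsilon>0" for \<epsilon>
    using e9[OF that] that by (simp add: abs_mult algebra_simps)

  have "\<exists>V. V \<in> cball base r \<and> step \<epsilon> \<Omega> (even_part V) = V \<and> norm (V - base) \<le> 2 * C * \<epsilon>"
    if "\<epsilon> \<in> {0<..<\<epsilon>0}" for \<epsilon>
  proof -
    have \<epsilon>: "0 < \<epsilon>" "\<epsilon> \<le> \<epsilon>0" using that by auto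
    have st: "norm (step \<epsilon> \<Omega> (even_part base) - base) \<le> C * \<epsilon>"
      using start[of \<epsilon>] e2[OF \<epsilon>] \<epsilon>(1) by (simp add: even_part_two_modes)
    show ?thesis
    proof (rule half_contraction_fixed_point[of base r "\<lambda>V. step \<epsilon> \<Omega> (even_part V)"])
      show "norm (step \<epsilon> \<Omega> (even_part A) - step \<epsilon> \<Omega> (even_part B)) \<le> 1/2 * norm (A - B)"
        if "A \<in> cball base r" "B \<in> cball base r" for A B
        using \<epsilon>(1) e2[OF \<epsilon>] \<sigma> that by (intro contr) auto
      show "norm (step \<epsilon> \<Omega> (even_part base) - base) \<le> r / 2" using st e3[OF \<epsilon>] by linarith
    qed (use r st in \<open>auto intro!: exI\<close>)
  qed
  then obtain V where V: "\<And>\<epsilon>. \<epsilon> \<in> {0<..<\<epsilon>0} \<Longrightarrow> V \<epsilon> \<in> cball base r"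
    "\<And>\<epsilon>. \<epsilon> \<in> {0<..<\<epsilon>0} \<Longrightarrow> step \<epsilon> \<Omega> (even_part (V \<epsilon>)) = V \<epsilon>"
    "\<And>\<epsilon>. \<epsilon> \<in> {0<..<\<epsilon>0} \<Longrightarrow> norm (V \<epsilon> - base) \<le> 2 * C * \<epsilon>"
    by metis
  define A where "A \<epsilon> = modes (weightD (V \<epsilon>))" for \<epsilon>
  define \<omega> where "\<omega> \<epsilon> = sqrt (1 - \<epsilon> * \<Omega>)" for \<epsilon>

  have "real_analytic_on \<omega> {0<..<\<epsilon>0}"
    unfolding \<omega>_def
  proof (rule real_analytic_sqrt)
    fix x assume "x \<in> {0<..<\<epsilon>0}"
    then show "x * \<Omega> < 1" using \<epsilon>\<Omega>[of x] by auto
  qed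

  moreover have "ell22_analytic_on A {0<..<\<epsilon>0}"
    unfolding A_def
  proof (rule ell22_analytic_on_power_series[OF \<epsilon>0])
    fix x assume x: "x \<in> {0<..<\<epsilon>0}"
    obtain W where W: "\<And>s. \<bar>s\<bar> \<le> 1 \<Longrightarrow> ps_eval s W \<in> cball base r"
      "\<And>s. \<bar>s\<bar> \<le> 1 \<Longrightarrow> step (x + \<epsilon>0 * s) \<Omega> (even_part (ps_eval s W)) = ps_eval s W"
      using series[of x \<epsilon>0] x e4[of \<epsilon>0] \<epsilon>0 by auto
    have "V (x + \<epsilon>0 * s) = ps_eval s W" if s: "\<bar>s\<bar> \<le> 1" and y: "x + \<epsilon>0 * s \<in> {0<..<\<epsilon>0}" for s
    proof (rule half_contraction_unique[of "cball base r" "\<lambda>V. step (x + \<epsilon>0 * s) \<Omega> (even_part V)"])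
      show "norm (step (x + \<epsilon>0 * s) \<Omega> (even_part A) - step (x + \<epsilon>0 * s) \<Omega> (even_part B)) \<le> 1/2 * norm (A - B)"
        if "A \<in> cball base r" "B \<in> cball base r" for A B
        using y e2[of "x + \<epsilon>0 * s"] \<sigma> that by (intro contr) auto
    qed (use V[OF y] W[OF s] in auto)
    then show "\<exists>W. \<forall>s. \<bar>s\<bar> \<le> 1 \<longrightarrow> x + \<epsilon>0 * s \<in> {0<..<\<epsilon>0} \<longrightarrow> V (x + \<epsilon>0 * s) = ps_eval s W" by blast
  qed

  moreover have "breather p \<epsilon> (\<omega> \<epsilon>) (A \<epsilon>) \<and> breather_bounds \<Omega> (l2_fun a) C0 \<epsilon> (\<omega> \<epsilon>) (A \<epsilon>)"
    if "\<epsilon> \<in> {0<..<\<epsilon>0}" for \<epsilon>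
  proof
    have \<epsilon>: "0 < \<epsilon>" "\<epsilon> \<le> \<epsilon>0" using that by auto
    have "(\<omega> \<epsilon>)\<^sup>2 = 1 - \<epsilon> * \<Omega>" using \<epsilon>\<Omega>[OF \<epsilon>] by (simp add: \<omega>_def)
    from breather_iff_fixed_point[OF _ this] fixed_point_even[OF V(2)[OF that]] \<epsilon>(1)
    show "breather p \<epsilon> (\<omega> \<epsilon>) (A \<epsilon>)" by (simp add: A_def)
    have "\<bar>\<omega> \<epsilon> - 1 + \<epsilon> * \<Omega> / 2\<bar> \<le> (\<epsilon> * \<Omega>)\<^sup>2"
      unfolding \<omega>_def by (rule sqrt_expansion_bound) (use \<epsilon>\<Omega>[OF \<epsilon>] in linarith)
    also have "\<dots> = \<Omega>\<^sup>2 * \<epsilon>\<^sup>2" by (simp add: power_mult_distrib)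
    also have "\<dots> \<le> C0 * \<epsilon>\<^sup>2" using C0(3) by (rule mult_right_mono) simp
    finally have freq: "\<bar>\<omega> \<epsilon> - 1 + \<epsilon> * \<Omega> / 2\<bar> \<le> C0 * \<epsilon>\<^sup>2" .
    have "weightD (V \<epsilon>) - base = weightD (V \<epsilon> - base)"
      by (simp add: linear_diff[OF bounded_linear.linear[OF bounded_linear_weightD]] weightD_two_modes)
    then have "norm (weightD (V \<epsilon>) - base) \<le> norm (V \<epsilon> - base)" by (simp add: norm_weightD_le)
    also have "\<dots> \<le> 2 * C * \<epsilon>" by (rule V(3)[OF that])
    also have "\<dots> \<le> C0 * \<epsilon>" using C0(2) \<epsilon>(1) by (intro mult_right_mono) auto
    finally have "norm (weightD (V \<epsilon>) - base) \<le> C0 * \<epsilon>" .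
    with nonneg_modes_le_norm[of "weightD (V \<epsilon>) - base"] freq
    show "breather_bounds \<Omega> (l2_fun a) C0 \<epsilon> (\<omega> \<epsilon>) (A \<epsilon>)"
      unfolding breather_bounds_def A_def breather_distance by linarith
  qed

  moreover have "B = B'"
    if "\<epsilon> \<in> {0<..<\<epsilon>0}" and B: "breather p \<epsilon> \<nu> B" "breather_bounds \<Omega> (l2_fun a) C0 \<epsilon> \<nu> B"
      "breather p \<epsilon> \<nu> B'" "breather_bounds \<Omega> (l2_fun a) C0 \<epsilon> \<nu> B'" for \<epsilon> \<nu> B B'
  proof -
    have \<epsilon>: "0 < \<epsilon>" "\<epsilon> \<le> \<epsilon>0" using that by auto
    define \<theta> where "\<theta> = (1 - \<nu>\<^sup>2) / \<epsilon>"
    have \<nu>: "\<nu>\<^sup>2 = 1 - \<epsilon> * \<theta>" using \<epsilon>(1) by (simp add: \<theta>_def)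
    have "\<bar>\<nu> - 1 + \<epsilon> * \<Omega> / 2\<bar> \<le> C0 * \<epsilon>\<^sup>2" using B(2) by (simp add: breather_bounds_def)
    from frequency_parameter_bound[OF this \<epsilon>(1) e1[OF \<epsilon>] less_imp_le[OF C0(1)]]
    have \<theta>: "\<bar>\<theta> - \<Omega>\<bar> \<le> C1 * \<epsilon>" by (simp add: \<theta>_def C1_def)
    have "\<bar>\<theta>\<bar> \<le> \<bar>\<Omega>\<bar> + 1" using \<theta> e8[OF \<epsilon>] by linarith
    then have "\<bar>\<theta>\<bar> * \<epsilon> \<le> (\<bar>\<Omega>\<bar> + 1) * \<epsilon>" using \<epsilon>(1) by (intro mult_right_mono) auto
    then have \<epsilon>\<theta>: "\<epsilon> * \<bar>\<theta>\<bar> \<le> 1/4" unfolding mult.commute[of \<epsilon>] using e9[OF \<epsilon>] by (rule order_trans)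
    have rescaled: "\<exists>U. U \<in> cball base r \<and> step \<epsilon> \<theta> (even_part U) = U \<and> modes (weightD U) = D"
      if D: "breather p \<epsilon> \<nu> D" "breather_bounds \<Omega> (l2_fun a) C0 \<epsilon> \<nu> D" for D
    proof -
      have "D \<in> ell22" using D(1) by (simp add: breather_def)
      then obtain Z where Z: "modes Z = D" by (rule ell22_modes)
      obtain U where U: "weightD U = Z" "reflect U = U" "step \<epsilon> \<theta> U = U"
        "norm (U - base) \<le> norm (Z - base) + 2 * \<epsilon> * norm (power_Suc_of (2 * p) Z - l1_lift lap Z)"
        using breather_rescale[OF \<epsilon>(1) \<epsilon>\<theta> \<nu>, of Z] D(1) Z by blast
      have "reflect (Z - base) = Z - base"
        using reflect_weightD[of U] U(1,2) reflect_even_part[of base]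
        by (simp add: linear_diff[OF bounded_linear.linear[OF bounded_linear_reflect]] even_part_two_modes)
      note norm_even_le[OF this]
      also have "norm (coeff (Z - base) 0) + norm (coeff (Z - base) 1) + (\<Sum>\<^sub>\<infinity>m\<in>{2..}. norm (coeff (Z - base) m)) \<le> C0 * \<epsilon>"
        using D(2) unfolding Z[symmetric] breather_bounds_def breather_distance by (rule conjunct2)
      finally have dist: "norm (Z - base) \<le> 2 * C0 * \<epsilon>" by simp
      have "norm (power_Suc_of (2 * p) Z - l1_lift lap Z) \<le> H"
        using dist e6[OF \<epsilon>] by (intro H(2)) linarith
      then have "2 * \<epsilon> * norm (power_Suc_of (2 * p) Z - l1_lift lap Z) \<le> 2 * \<epsilon> * H"
        using \<epsilon>(1) by (intro mult_left_mono) auto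
      with U(4) dist e5[OF \<epsilon>] have "norm (U - base) \<le> r" by linarith
      then have "U \<in> cball base r" by (simp add: dist_norm norm_minus_commute)
      then show ?thesis using U(1,3) Z even_part_id[OF U(2)] by auto
    qed
    obtain U U' where U: "U \<in> cball base r" "step \<epsilon> \<theta> (even_part U) = U" "modes (weightD U) = B"
      and U': "U' \<in> cball base r" "step \<epsilon> \<theta> (even_part U') = U'" "modes (weightD U') = B'"
      using rescaled[OF B(1,2)] rescaled[OF B(3,4)] by blast
    have "U = U'"
    proof (rule half_contraction_unique[of "cball base r" "\<lambda>V. step \<epsilon> \<theta> (even_part V)"])
      show "norm (step \<epsilon> \<theta> (even_part A) - step \<epsilon> \<theta> (even_part B)) \<le> 1/2 * norm (A - B)"
        if "A \<in> cball base r" "B \<in> cball base r" for A B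
        using \<epsilon>(1) e2[OF \<epsilon>] order_trans[OF \<theta> e7[OF \<epsilon>]] that by (intro contr) auto
    qed (use U U' in auto)
    then show ?thesis using U(3) U'(3) by simp
  qed

  ultimately show ?thesis using \<epsilon>0 C0(1) by blast
qed

end

lemma l2_fun_power_Suc_of: "l2_fun (power_Suc_of k u) n = l2_fun u n ^ Suc k"
  by (induction k) (simp_all add: times_l2.rep_eq)

theorem theorem1:
  fixes p :: nat and \<Omega> :: real and a :: "int ^ 'd \<Rightarrow> real"
  assumes "p \<ge> 1"
    and "\<Omega> \<notin> {- 4 * real CARD('d)..0}"
    and "a \<in> ell2"
    and "stationary_dnls p \<Omega> a"
    and "{v \<in> ell2. dnls_jacobian p \<Omega> a v = (\<lambda>n. 0)} = {\<lambda>n. 0}"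
  shows "\<exists>\<epsilon>\<^sub>0>0. \<exists>C\<^sub>0>0. \<exists>(\<omega> :: real \<Rightarrow> real) (A :: real \<Rightarrow> int \<Rightarrow> int ^ 'd \<Rightarrow> real).
    real_analytic_on \<omega> {0<..<\<epsilon>\<^sub>0} \<and>
    ell22_analytic_on A {0<..<\<epsilon>\<^sub>0} \<and>
    (\<forall>\<epsilon>\<in>{0<..<\<epsilon>\<^sub>0}.
      breather p \<epsilon> (\<omega> \<epsilon>) (A \<epsilon>) \<and> breather_bounds \<Omega> a C\<^sub>0 \<epsilon> (\<omega> \<epsilon>) (A \<epsilon>)) \<and>
    (\<forall>\<epsilon>\<in>{0<..<\<epsilon>\<^sub>0}. \<forall>\<nu> B B'.
      breather p \<epsilon> \<nu> B \<and> breather_bounds \<Omega> a C\<^sub>0 \<epsilon> \<nu> B \<and>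
      breather p \<epsilon> \<nu> B' \<and> breather_bounds \<Omega> a C\<^sub>0 \<epsilon> \<nu> B' \<longrightarrow> B = B')"
proof -
  define u where "u = Abs_l2 a"
  have a: "a = l2_fun u" using assms(3) by (simp add: u_def Abs_l2_inverse)
  define b where "b = ((2 * real p + 1) * dnls_gamma p) *\<^sub>R power_Suc_of (2 * p - 1) u"
  have pow: "l2_fun (power_Suc_of (2 * p - 1) u) n = \<bar>a n\<bar> ^ (2 * p)" for n
    using assms(1) by (simp add: l2_fun_power_Suc_of a power_even_abs)
  have jac: "l2_fun (\<Omega> *\<^sub>R v + b * v - lap v) n = dnls_jacobian p \<Omega> a (l2_fun v) n" for v n
    by (simp add: dnls_jacobian_def b_def plus_l2.rep_eq minus_l2.rep_eq scaleR_l2.rep_eq times_l2.rep_eq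
        l2_fun_lap pow[unfolded One_nat_def] add.commute)
  have ker: "v = 0" if "\<Omega> *\<^sub>R v + b * v - lap v = 0" for v
  proof -
    have "dnls_jacobian p \<Omega> a (l2_fun v) = (\<lambda>n. 0)"
      using jac[of v] that by (simp add: fun_eq_iff zero_l2.rep_eq)
    then have "l2_fun v \<in> {\<lambda>n. 0}" using assms(5) l2_fun[of v] by blast
    then show ?thesis by (intro l2_eqI) (simp add: zero_l2.rep_eq)
  qed
  obtain G where G: "bounded_linear G" "\<And>v. G (\<Omega> *\<^sub>R v + b * v - lap v) = v"
    "\<And>v. \<Omega> *\<^sub>R G v + b * G v - lap (G v) = v"
  proof (rule jacobian_invertible[OF assms(2) ker])
    fix G assume "bounded_linear G" "\<And>v. G (\<Omega> *\<^sub>R v + b * v - lap v) = v"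
      "\<And>v. \<Omega> *\<^sub>R G v + b * G v - lap (G v) = v"
    then show thesis by (rule that)
  qed
  have "l2_fun (\<Omega> *\<^sub>R u + dnls_gamma p *\<^sub>R power_Suc_of (2 * p) u - lap u) n = 0" for n
    using assms(4) unfolding stationary_dnls_def a
    by (simp add: plus_l2.rep_eq minus_l2.rep_eq scaleR_l2.rep_eq l2_fun_lap l2_fun_power_Suc_of power_even_abs mult_ac)
  then have "\<Omega> *\<^sub>R u + dnls_gamma p *\<^sub>R power_Suc_of (2 * p) u - lap u = 0"
    by (intro l2_eqI) (simp add: zero_l2.rep_eq)
  then interpret dnls_profile p \<Omega> u G
    by (rule dnls_profile.intro[OF assms(1) G[unfolded b_def]])
  show ?thesis unfolding a by (rule breather_branch)
qed

end
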